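(* Let $\mathcal H$ be a class of measurable functions $h:\mathcal X\to[-1,1]$ satisfying, for some $V>0$, $$\sup_{Q\in\mathcal P(\mathcal X)}N_{d_{Q,2}}(\mathcal H,u)=\mathcal O(u^{-V}).$$ Then there exists an absolute constant $K>0$ such that for all $t>0$, with probability at least $1-e^{-t}$, for all $\lambda\in\mathcal P(\mathcal H)$ and $f_\lambda(x)=\int h(x)\lambda(dh)$, $$\mathbb P(yf_\lambda(x)\le0)\le K\inf_{m\ge1}\ \inf_{c\in\mathcal C^m(\lambda)}\ \inf_{0<\delta\le\gamma\le1}\left(\mathbb P_n(yf_\lambda(x)\le\delta)+\mathbb P_n(\sigma^2(c;x)\ge\gamma)+\frac{Vm\gamma}{n\delta^2}\log^2\frac n\delta+\frac tn\right).$$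
   Context: $\mathcal X$ is a measurable space, $\mathcal Y=\{-1,+1\}$, $\mathbb P$ is a probability measure on $\mathcal X\times\mathcal Y$, and $(X_1,Y_1),\dots,(X_n,Y_n)$ are i.i.d. with law $\mathbb P$; "with probability" refers to this sample. $\mathbb P_n$ is the empirical distribution of the sample, so $\mathbb P_n(yf(x)\le\delta)=n^{-1}\#\{i\le n:Y_if(X_i)\le\delta\}$ and $\mathbb P_n(\sigma^2(c;x)\ge\gamma)=n^{-1}\#\{i\le n:\sigma^2(c;X_i)\ge\gamma\}$. $\mathcal P(\mathcal X)$ is the set of all discrete probability distributions on $\mathcal X$; $d_{Q,2}(f,g)=(Q(f-g)^2)^{1/2}$; $N_{d_{Q,2}}(\mathcal H,u)$ is the minimal number of $d_{Q,2}$-balls of radius $u>0$ with centers in $\mathcal H$ needed to cover $\mathcal H$. $\mathcal P(\mathcal H)$ is the set of all discrete probability distributions on $\mathcal H$. For $\lambda\in\mathcal P(\mathcal H)$, $\sigma_\lambda^2(x)=\int\left(h(x)-\int h(x)\lambda(dh)\right)^2\lambda(dh)$. For an integer $m\ge1$, $$\mathcal C^m(\lambda)=\Big\{(\alpha_1,\dots,\alpha_m,\lambda^1,\dots,\lambda^m):\lambda^k\in\mathcal P(\mathcal H),\ \alpha_k\ge0,\ \sum_{k=1}^m\alpha_k\lambda^k=\lambda\Big\},$$ and for $c=(\alpha_1,\dots,\alpha_m,\lambda^1,\dots,\lambda^m)\in\mathcal C^m(\lambda)$, $\sigma^2(c;x)=\sum_{k=1}^m\alpha_k^2\sigma_{\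lambda^k}^2(x)$.
   Formalization: The claim fails as stated; here K may depend on the constant and range of u in O(u^{-V}) and on a lower bound for V, n≥2 is assumed, and H must satisfy: for every N, the random set {(h(X_1),…,h(X_N)): h∈H} meets each open box in an event measurable up to null sets. *)

theory Defs
  imports "HOL-Probability.Probability"
begin

text \<open>Discrete distributions on a set. Since every \<open>pmf\<close> has countable support, this covers
  finitely and countably infinitely supported distributions.\<close>

definition discrete_dists :: "'a set \<Rightarrow> 'a pmf set" where
  "discrete_dists A = {p. set_pmf p \<subseteq> A}"

definition L2_dist :: "'x pmf \<Rightarrow> ('x \<Rightarrow> real) \<Rightarrow> ('x \<Rightarrow> real) \<Rightarrow> real" where
  "L2_dist Q f g = sqrt (\<integral>x. (f x - g x)\<^sup>2 \<partial>measure_pmf Q)"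

text \<open>Balls are closed; the value is \<open>\<infinity>\<close> if there is no finite cover.\<close>

definition covering_number :: "('a \<Rightarrow> 'a \<Rightarrow> real) \<Rightarrow> 'a set \<Rightarrow> real \<Rightarrow> enat" where
  "covering_number d H u =
     (INF F \<in> {F. finite F \<and> F \<subseteq> H \<and> (\<forall>h\<in>H. \<exists>g\<in>F. d g h \<le> u)}. enat (card F))"

definition uniform_covering_number :: "'x measure \<Rightarrow> ('x \<Rightarrow> real) set \<Rightarrow> real \<Rightarrow> enat" where
  "uniform_covering_number M H u =
     (SUP Q \<in> discrete_dists (space M). covering_number (L2_dist Q) H u)"

definition mix_mean :: "('x \<Rightarrow> real) pmf \<Rightarrow> 'x \<Rightarrow> real" where
  "mix_mean l x = (\<integral>h. h x \<partial>measure_pmf l)"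

definition mix_var :: "('x \<Rightarrow> real) pmf \<Rightarrow> 'x \<Rightarrow> real" where
  "mix_var l x = (\<integral>h. (h x - mix_mean l x)\<^sup>2 \<partial>measure_pmf l)"

text \<open>Only the entries with index in \<open>{1..m}\<close> of the two sequences are relevant. The equality of
  the measures \<open>\<Sum>k. \<alpha>\<^sub>k \<lambda>\<^sup>k\<close> and \<open>\<lambda>\<close> is expressed on atoms.\<close>

definition decompositions ::
    "('x \<Rightarrow> real) set \<Rightarrow> nat \<Rightarrow> ('x \<Rightarrow> real) pmf \<Rightarrow> ((nat \<Rightarrow> real) \<times> (nat \<Rightarrow> ('x \<Rightarrow> real) pmf)) set"
  where
  "decompositions H m l =
     {(\<alpha>, L). (\<forall>k\<in>{1..m}. L k \<in> discrete_dists H \<and> 0 \<le> \<alpha> k) \<and>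
              (\<forall>h. (\<Sum>k=1..m. \<alpha> k * pmf (L k) h) = pmf l h)}"

definition decomp_var ::
    "nat \<Rightarrow> (nat \<Rightarrow> real) \<times> (nat \<Rightarrow> ('x \<Rightarrow> real) pmf) \<Rightarrow> 'x \<Rightarrow> real" where
  "decomp_var m c x = (\<Sum>k=1..m. (fst c k)\<^sup>2 * mix_var (snd c k) x)"

definition empirical :: "nat \<Rightarrow> (nat \<Rightarrow> 'z) \<Rightarrow> ('z \<Rightarrow> bool) \<Rightarrow> real" where
  "empirical n \<omega> R = real (card {i\<in>{1..n}. R (\<omega> i)}) / real n"

text \<open>Measurability of the class: for every \<open>N\<close>, the random set
  \<open>{(h (x\<^sub>1), \<dots>, h (x\<^sub>N)) | h \<in> H}\<close> hits every open box in a measurable event (up to null sets).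
  Countable and, more generally, pointwise separable
  classes have this property (see the lemmas below). Some such condition is indispensable for
  statements about all members of an uncountable class: let \<open>M\<close> be the countable-cocountable
  \<open>\<sigma>\<close>-algebra on the first uncountable ordinal, let the label be constantly \<open>1\<close>, let the
  law of the first component give mass \<open>0\<close> to countable sets, and let \<open>H\<close> consist of the functions
  that are \<open>1\<close> on a countable initial segment and \<open>-1\<close> elsewhere. The covering numbers are
  polynomial, every \<open>h\<close> errs almost surely, but every sample is classified correctly by
  some \<open>h\<close>.\<close>

definition sample_measurable :: "'x measure \<Rightarrow> ('x \<Rightarrow> real) set \<Rightarrow> bool" where
  "sample_measurable D H \<longleftrightarrow>
     (\<forall>N. \<forall>a b :: nat \<Rightarrow> real.
        {x \<in> space (PiM {1..N} (\<lambda>_. D)). \<exists>h\<in>H. \<forall>i\<in>{1..N}. a i < h (x i) \<and> h (x i) < b i}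
          \<in> sets (completion (PiM {1..N} (\<lambda>_. D))))"

lemma sample_measurable_pointwise_limits:
  assumes G: "countable G" "G \<subseteq> H" "\<forall>g\<in>G. g \<in> borel_measurable D"
    and lim: "\<forall>h\<in>H. \<exists>g :: nat \<Rightarrow> 'x \<Rightarrow> real. range g \<subseteq> G \<and>
                (\<forall>x\<in>space D. (\<lambda>k. g k x) \<longlonglongrightarrow> h x)"
  shows "sample_measurable D H"
  unfolding sample_measurable_def
proof (intro allI)
  fix N :: nat and a b :: "nat \<Rightarrow> real"
  let ?P = "PiM {1..N} (\<lambda>_. D)"
  let ?R = "\<lambda>h x. \<forall>i\<in>{1..N}. a i < h (x i) \<and> h (x i) < b i"
  have approx: "\<exists>g\<in>G. ?R g x" if x: "x \<in> space ?P" and h: "h \<in> H" "?R h x" for x h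
  proof -
    obtain g :: "nat \<Rightarrow> 'x \<Rightarrow> real" where g: "range g \<subseteq> G"
      "\<And>y. y \<in> space D \<Longrightarrow> (\<lambda>k. g k y) \<longlonglongrightarrow> h y"
      using bspec[OF lim h(1)] by (elim exE conjE) (rule that, assumption, erule bspec)
    have "\<forall>\<^sub>F k in sequentially. a i < g k (x i) \<and> g k (x i) < b i" if i: "i \<in> {1..N}" for i
    proof -
      have "x i \<in> space D" using x i by (auto simp: space_PiM)
      then have l: "(\<lambda>k. g k (x i)) \<longlonglongrightarrow> h (x i)" by (rule g(2))
      show ?thesis
        using h(2) i by (intro eventually_conj order_tendstoD[OF l]) auto
    qed
    then have "\<forall>\<^sub>F k in sequentially. ?R (g k) x"
      by (intro eventually_ball_finite) auto
    then have "\<exists>k. ?R (g k) x"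
      by (rule eventually_happens'[OF sequentially_bot])
    then obtain k where "?R (g k) x" ..
    moreover have "g k \<in> G" using g(1) by (rule subsetD) (rule rangeI)
    ultimately show ?thesis by (rule bexI)
  qed
  have eq: "{x \<in> space ?P. \<exists>h\<in>H. ?R h x} = (\<Union>g\<in>G. {x \<in> space ?P. ?R g x})"
  proof (intro equalityI subsetI)
    fix x assume "x \<in> {x \<in> space ?P. \<exists>h\<in>H. ?R h x}"
    then obtain h where "x \<in> space ?P" "h \<in> H" "?R h x" by (elim CollectE conjE bexE)
    moreover from approx[OF this] obtain g where "g \<in> G" "?R g x" by (elim bexE)
    ultimately show "x \<in> (\<Union>g\<in>G. {x \<in> space ?P. ?R g x})"
      by (intro UN_I CollectI conjI)
  next
    fix x assume "x \<in> (\<Union>g\<in>G. {x \<in> space ?P. ?R g x})"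
    then obtain g where "g \<in> G" "x \<in> space ?P" "?R g x" by (elim UN_E CollectE conjE)
    with G(2) show "x \<in> {x \<in> space ?P. \<exists>h\<in>H. ?R h x}"
      by (intro CollectI conjI bexI[of _ g] subsetD[OF G(2)])
  qed
  have "{x \<in> space ?P. ?R g x} \<in> sets ?P" if "g \<in> G" for g
  proof -
    have [measurable]: "g \<in> borel_measurable D" using G(3) that by blast
    show ?thesis by measurable
  qed
  then have "(\<Union>g\<in>G. {x \<in> space ?P. ?R g x}) \<in> sets ?P"
    using G(1) by (intro sets.countable_UN') auto
  then show "{x \<in> space ?P. \<exists>h\<in>H. ?R h x} \<in> sets (completion ?P)"
    unfolding eq by (rule sets_completionI_sets)
qed

corollary sample_measurable_countable:
  assumes "countable H" "\<forall>h\<in>H. h \<in> borel_measurable D"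
  shows "sample_measurable D H"
proof (rule sample_measurable_pointwise_limits[OF assms(1) order_refl assms(2)], rule ballI)
  fix h assume "h \<in> H"
  then show "\<exists>g :: nat \<Rightarrow> 'a \<Rightarrow> real. range g \<subseteq> H \<and> (\<forall>x\<in>space D. (\<lambda>k. g k x) \<longlonglongrightarrow> h x)"
    by (intro exI[of _ "\<lambda>_. h"]) auto
qed

end

theory Submission
  imports Defs
begin

text \<open>
  Write \<open>f\<close> for the mean and \<open>\<sigma>\<^sup>2\<close> for the variance of the decomposition \<open>c\<close> of \<open>\<lambda>\<close>. The idea is to
  replace \<open>f\<close> by an average of a few members of \<open>H\<close>. Draw \<open>N\<close> independent pairs
  \<open>(h, h')\<close> from each \<open>\<lambda>\<^sup>k \<times> \<lambda>\<^sup>k\<close>. The average \<open>\<Sum>\<^sub>k \<alpha>\<^sub>k N\<^sup>-\<^sup>1 \<Sum>\<^sub>j h\<^sub>k\<^sub>j\<close> has expectation \<open>f\<close> and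
  variance \<open>\<sigma>\<^sup>2 / N\<close>, and \<open>\<Sum>\<^sub>k \<alpha>\<^sub>k\<^sup>2 (2N)\<^sup>-\<^sup>1 \<Sum>\<^sub>j (h\<^sub>k\<^sub>j - h'\<^sub>k\<^sub>j)\<^sup>2\<close> is an unbiased estimate of \<open>\<sigma>\<^sup>2\<close>.
  If \<open>N\<close> is of order \<open>(\<gamma> / \<delta>\<^sup>2) log n\<close>, then exponential moment bounds show that some draw
  does the following at all of \<open>2n\<close> given points: the average is within \<open>\<delta> / 3\<close> of \<open>f\<close> wherever
  \<open>\<sigma>\<^sup>2 < 4\<gamma>\<close>, and the variance estimate tells \<open>\<sigma>\<^sup>2 < \<gamma>\<close> from \<open>\<sigma>\<^sup>2 \<ge> 4\<gamma>\<close>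
  (\<open>stratified_sample_exists\<close>). On these points the set \<open>B\<close> where the average has margin at
  most \<open>\<delta> / 2\<close> or the variance estimate is at least \<open>2\<gamma>\<close> therefore satisfies
  \<open>{y f \<le> 0} \<subseteq> B \<subseteq> {y f \<le> \<delta>} \<union> {\<sigma>\<^sup>2 \<ge> \<gamma>}\<close>. So it suffices to compare the frequencies of the
  sets \<open>B\<close> in two independent samples.

  There are few sets \<open>B\<close>. A net of \<open>H\<close> for the uniform distribution on the \<open>2n\<close> points,
  with radius of order \<open>\<delta> / n\<close> in \<open>L\<^sup>2\<close>, is a net of radius \<open>\<delta> / 100\<close> for the maximum over
  these points (\<open>sup_net_on_points\<close>), and it has at most \<open>(n / \<delta>)\<^sup>O\<^sup>(\<^sup>V\<^sup>)\<close> members. A set \<open>B\<close> is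
  determined by \<open>2mN\<close> members of the net and \<open>m\<close> rounded weights, so the logarithm of the number
  of sets is at most a constant times \<open>A = V m (\<gamma> / \<delta>\<^sup>2) log\<^sup>2 (n / \<delta>)\<close>.

  The second sample is a ghost sample. For a fixed \<open>B\<close>, exchange each point with its partner in
  the other half with probability \<open>1/2\<close>. The probability that the second half
  then contains at least \<open>b\<close> points of \<open>B\<close> more than twice the number in the first half is at
  most \<open>(3/2)\<^sup>-\<^sup>b\<close> (\<open>swap_count_le\<close>). With \<open>b\<close> a large multiple of \<open>A + t\<close> this beats the number
  of sets (\<open>configuration_count\<close>). On the other hand, if the bound fails for
  some \<open>\<lambda>\<close> on the given sample, then with probability more than \<open>1/2\<close> the ghost sample has at
  least a quarter of the expected number of errors (\<open>count_lower_tail\<close>), and the double sample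
  is unbalanced for some \<open>B\<close>.

  The mixtures \<open>\<lambda>\<close> and the class \<open>H\<close> may be uncountable. For this reason the bad event
  is stated for function values rounded to a finite grid (\<open>bad_samples\<close>). It is then a finite
  combination of events that some \<open>h \<in> H\<close> has its values at the sample points in a given
  open box, which \<open>sample_measurable\<close> makes measurable. Rounding is absorbed by three
  nested pairs of thresholds around \<open>\<delta> / 2\<close> and \<open>2\<gamma>\<close>.
  Finally \<open>\<delta>\<close> and \<open>\<gamma>\<close> may be replaced by powers of \<open>1/2\<close>. Only finitely many triples
  \<open>(m, \<delta>, \<gamma>)\<close> give a nontrivial bound for fixed \<open>n\<close>, and a union bound over them costs a factor
  polynomial in \<open>n\<close>.
\<close>

section \<open>Exponential moments\<close>

lemma integrable_pmf_bounded:
  fixes f :: "'a \<Rightarrow> real"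
  assumes "\<And>w. w \<in> set_pmf p \<Longrightarrow> \<bar>f w\<bar> \<le> B"
  shows "integrable (measure_pmf p) f"
  using assms by (intro measure_pmf.integrable_const_bound[where B = B]) (auto simp: AE_measure_pmf_iff)

lemma pmf_expectation_mono:
  fixes f g :: "'a \<Rightarrow> real"
  assumes "integrable (measure_pmf p) f" "integrable (measure_pmf p) g"
    and "\<And>w. w \<in> set_pmf p \<Longrightarrow> f w \<le> g w"
  shows "measure_pmf.expectation p f \<le> measure_pmf.expectation p g"
  using assms by (intro integral_mono_AE) (auto simp: AE_measure_pmf_iff)

lemma exp_le_quadratic:
  fixes x :: real
  assumes "\<bar>x\<bar> \<le> 1"
  shows "exp x \<le> 1 + x + x\<^sup>2"
proof (cases "0 \<le> x")
  case True
  then show ?thesis using exp_bound[of x] assms by simp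
next
  case False
  define y where "y = - x"
  have y: "0 \<le> y" "y \<le> 1" using False assms by (auto simp: y_def)
  have "1 \<le> (1 - y + y\<^sup>2) * (1 + y)"
    using y by (simp add: algebra_simps power2_eq_square)
  also have "\<dots> \<le> (1 - y + y\<^sup>2) * exp y"
    using exp_ge_add_one_self[of y] y by (intro mult_left_mono) (auto simp: power2_eq_square)
  finally have "exp (- y) \<le> (1 - y + y\<^sup>2)"
    by (simp add: exp_minus field_simps)
  then show ?thesis by (simp add: y_def)
qed

text \<open>The second-order bound from which all exponential moments below follow, via
  \<open>1 + s \<le> e\<^sup>s\<close>.\<close>

lemma expectation_exp_le:
  fixes v :: "'a \<Rightarrow> real"
  assumes v: "\<And>w. w \<in> set_pmf p \<Longrightarrow> \<bar>v w\<bar> \<le> 1"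
  shows "measure_pmf.expectation p (\<lambda>w. exp (v w))
       \<le> exp (measure_pmf.expectation p v + measure_pmf.expectation p (\<lambda>w. (v w)\<^sup>2))"
proof -
  have i1: "integrable (measure_pmf p) v"
    using v by (rule integrable_pmf_bounded)
  have i2: "integrable (measure_pmf p) (\<lambda>w. (v w)\<^sup>2)"
    using v by (intro integrable_pmf_bounded[where B = 1]) (auto simp: abs_square_le_1)
  have i3: "integrable (measure_pmf p) (\<lambda>w. exp (v w))"
    using v by (intro integrable_pmf_bounded[where B = "exp 1"]) (auto simp: abs_le_iff)
  have "measure_pmf.expectation p (\<lambda>w. exp (v w))
      \<le> measure_pmf.expectation p (\<lambda>w. 1 + v w + (v w)\<^sup>2)"
    using v i1 i2 i3 by (intro pmf_expectation_mono) (auto intro!: exp_le_quadratic)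
  also have "\<dots> = 1 + (measure_pmf.expectation p v + measure_pmf.expectation p (\<lambda>w. (v w)\<^sup>2))"
    using i1 i2 by simp
  also have "\<dots> \<le> exp (measure_pmf.expectation p v + measure_pmf.expectation p (\<lambda>w. (v w)\<^sup>2))"
    by (rule exp_ge_add_one_self)
  finally show ?thesis .
qed

text \<open>Half the squared difference of two independent copies estimates the variance without bias.
  Unlike the empirical variance it is a sum over independent pairs, so its
  exponential moments factorize.\<close>

lemma expectation_half_square_diff:
  fixes f :: "'a \<Rightarrow> real"
  assumes f: "\<And>w. w \<in> set_pmf p \<Longrightarrow> \<bar>f w\<bar> \<le> 1"
  shows "measure_pmf.expectation (pair_pmf p p) (\<lambda>(a, b). (f a - f b)\<^sup>2 / 2)
       = measure_pmf.expectation p (\<lambda>w. (f w - measure_pmf.expectation p f)\<^sup>2)"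
proof -
  define \<mu> where "\<mu> = measure_pmf.expectation p f"
  define v where "v = measure_pmf.expectation p (\<lambda>w. (f w - \<mu>)\<^sup>2)"
  have i1: "integrable (measure_pmf p) f" using f by (rule integrable_pmf_bounded)
  have i2: "integrable (measure_pmf p) (\<lambda>w. (f w)\<^sup>2)"
    using f by (intro integrable_pmf_bounded[where B = 1]) (auto simp: abs_square_le_1)
  have i3: "integrable (measure_pmf p) (\<lambda>w. (f w - c)\<^sup>2)" for c
    using i1 i2 by (simp add: power2_diff)
  have v0: "0 \<le> v" unfolding v_def by simp
  have inner: "measure_pmf.expectation p (\<lambda>b. (a - f b)\<^sup>2 / 2) = ((a - \<mu>)\<^sup>2 + v) / 2" for a
  proof -
    have "(\<lambda>b. (a - f b)\<^sup>2 / 2) = (\<lambda>b. ((a - \<mu>)\<^sup>2 + (f b - \<mu>)\<^sup>2 - 2 * (a - \<mu>) * (f b - \<mu>)) / 2)"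
      by (simp add: fun_eq_iff power2_eq_square algebra_simps)
    then show ?thesis
      using i3[of \<mu>] i1 by (simp add: v_def) (simp add: \<mu>_def)
  qed
  have "(\<integral>\<^sup>+w. ennreal ((\<lambda>(a, b). (f a - f b)\<^sup>2 / 2) w) \<partial>pair_pmf p p)
      = (\<integral>\<^sup>+a. \<integral>\<^sup>+b. ennreal ((f a - f b)\<^sup>2 / 2) \<partial>p \<partial>p)"
    by (simp add: nn_integral_pair_pmf')
  also have "\<dots> = (\<integral>\<^sup>+a. ennreal (((f a - \<mu>)\<^sup>2 + v) / 2) \<partial>p)"
  proof (rule nn_integral_cong)
    fix a
    have "integrable (measure_pmf p) (\<lambda>b. (f a - f b)\<^sup>2 / 2)"
      using i3[of "f a"] by (simp add: power2_commute)
    then show "(\<integral>\<^sup>+b. ennreal ((f a - f b)\<^sup>2 / 2) \<partial>p) = ennreal (((f a - \<mu>)\<^sup>2 + v) / 2)"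
      using inner[of "f a"] by (subst nn_integral_eq_integral) auto
  qed
  also have "\<dots> = ennreal (measure_pmf.expectation p (\<lambda>a. ((f a - \<mu>)\<^sup>2 + v) / 2))"
    using i3 v0 by (intro nn_integral_eq_integral) auto
  also have "measure_pmf.expectation p (\<lambda>a. ((f a - \<mu>)\<^sup>2 + v) / 2) = v"
    using i3 by (simp add: v_def)
  finally have "measure_pmf.expectation (pair_pmf p p) (\<lambda>(a, b). (f a - f b)\<^sup>2 / 2) = v"
    using v0 by (intro integral_eq_nn_integral[THEN trans]) (auto simp: split_beta)
  then show ?thesis by (simp add: v_def \<mu>_def)
qed

lemma expectation_exp_centered:
  fixes f :: "'a \<Rightarrow> real"
  assumes f: "\<And>w. w \<in> set_pmf p \<Longrightarrow> \<bar>f w\<bar> \<le> 1" and b: "\<bar>b\<bar> \<le> 1 / 2"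
  shows "measure_pmf.expectation p (\<lambda>w. exp (b * (f w - measure_pmf.expectation p f)))
     \<le> exp (b\<^sup>2 * measure_pmf.expectation p (\<lambda>w. (f w - measure_pmf.expectation p f)\<^sup>2))"
proof -
  define \<mu> where "\<mu> = measure_pmf.expectation p f"
  have i: "integrable (measure_pmf p) f" using f by (rule integrable_pmf_bounded)
  have \<mu>: "\<bar>\<mu>\<bar> \<le> 1"
  proof -
    have "\<mu> \<le> measure_pmf.expectation p (\<lambda>_. 1)" "measure_pmf.expectation p (\<lambda>_. - 1) \<le> \<mu>"
      unfolding \<mu>_def using i f by (intro pmf_expectation_mono; force simp: abs_le_iff)+
    then show ?thesis by simp
  qed
  have "\<bar>b * (f w - \<mu>)\<bar> \<le> 1" if "w \<in> set_pmf p" for w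
  proof -
    have "\<bar>f w - \<mu>\<bar> \<le> 2" using f[OF that] \<mu> by linarith
    then have "\<bar>b\<bar> * \<bar>f w - \<mu>\<bar> \<le> (1/2) * 2" using b by (intro mult_mono) auto
    then show ?thesis by (simp add: abs_mult)
  qed
  from expectation_exp_le[of p "\<lambda>w. b * (f w - \<mu>)", OF this]
  show ?thesis using i by (simp add: power_mult_distrib flip: \<mu>_def)
qed

text \<open>The exponent is at most \<open>1/4\<close> in absolute value, so its square is at most a quarter of its
  absolute value. The first-order terms \<open>\<plusminus> b v\<close> thus become \<open>5/4 b v\<close> and \<open>- 3/4 b v\<close>.\<close>

lemma expectation_exp_half_square_diff:
  fixes f :: "'a \<Rightarrow> real"
  assumes f: "\<And>w. w \<in> set_pmf p \<Longrightarrow> \<bar>f w\<bar> \<le> 1" and b: "0 \<le> b" "b \<le> 1 / 8"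
  defines "v \<equiv> measure_pmf.expectation p (\<lambda>w. (f w - measure_pmf.expectation p f)\<^sup>2)"
  shows "measure_pmf.expectation (pair_pmf p p) (\<lambda>(a, c). exp (b * ((f a - f c)\<^sup>2 / 2))) \<le> exp (5/4 * b * v)"
    and "measure_pmf.expectation (pair_pmf p p) (\<lambda>(a, c). exp (- (b * ((f a - f c)\<^sup>2 / 2)))) \<le> exp (- (3/4 * b * v))"
proof -
  define z where "z = (\<lambda>(a, c). (f a - f c)\<^sup>2 / 2)"
  have z: "0 \<le> z w" "z w \<le> 2" if "w \<in> set_pmf (pair_pmf p p)" for w
  proof -
    obtain a c where w: "w = (a, c)" "a \<in> set_pmf p" "c \<in> set_pmf p" using \<open>w \<in> _\<close> by auto
    have "\<bar>f a - f c\<bar> \<le> 2" using f[OF w(2)] f[OF w(3)] by linarith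
    then have "\<bar>f a - f c\<bar>\<^sup>2 \<le> 2\<^sup>2" by (intro power_mono) auto
    then show "0 \<le> z w" "z w \<le> 2" by (auto simp: z_def w)
  qed
  have Ez: "measure_pmf.expectation (pair_pmf p p) z = v"
    using expectation_half_square_diff[of p f] f by (simp add: z_def v_def)
  have iz: "integrable (measure_pmf (pair_pmf p p)) z"
    using z by (intro integrable_pmf_bounded[where B = 2]) auto
  have *: "measure_pmf.expectation (pair_pmf p p) (\<lambda>w. exp (s * z w)) \<le> exp (s * v + 1/4 * b * v)"
    if s: "\<bar>s\<bar> = b" for s
  proof -
    have bz: "b * z w \<le> 1/4" if "w \<in> set_pmf (pair_pmf p p)" for w
      using mult_mono[of b "1/8" "z w" 2] z[OF that] b by simp
    have "measure_pmf.expectation (pair_pmf p p) (\<lambda>w. exp (s * z w))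
      \<le> exp (measure_pmf.expectation (pair_pmf p p) (\<lambda>w. s * z w)
           + measure_pmf.expectation (pair_pmf p p) (\<lambda>w. (s * z w)\<^sup>2))"
    proof (rule expectation_exp_le)
      fix w assume w: "w \<in> set_pmf (pair_pmf p p)"
      show "\<bar>s * z w\<bar> \<le> 1" using bz[OF w] z[OF w] s by (simp add: abs_mult)
    qed
    also have "measure_pmf.expectation (pair_pmf p p) (\<lambda>w. (s * z w)\<^sup>2)
      \<le> measure_pmf.expectation (pair_pmf p p) (\<lambda>w. 1/4 * b * z w)"
    proof (rule pmf_expectation_mono)
      show "integrable (measure_pmf (pair_pmf p p)) (\<lambda>w. 1/4 * b * z w)" using iz by simp
      show le: "(s * z w)\<^sup>2 \<le> 1/4 * b * z w" if w: "w \<in> set_pmf (pair_pmf p p)" for w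
      proof -
        have "(s * z w)\<^sup>2 = (b * z w) * (b * z w)"
          using s by (auto simp: power2_eq_square abs_if split: if_splits)
        also have "\<dots> \<le> 1/4 * (b * z w)"
          using bz[OF w] z[OF w] b by (intro mult_right_mono) auto
        finally show ?thesis by simp
      qed
      show "integrable (measure_pmf (pair_pmf p p)) (\<lambda>w. (s * z w)\<^sup>2)"
      proof (rule integrable_pmf_bounded[where B = 1])
        fix w assume w: "w \<in> set_pmf (pair_pmf p p)"
        show "\<bar>(s * z w)\<^sup>2\<bar> \<le> 1" using le[OF w] bz[OF w] by simp
      qed
    qed
    finally show ?thesis using iz by (simp add: Ez)
  qed
  show "measure_pmf.expectation (pair_pmf p p) (\<lambda>(a, c). exp (b * ((f a - f c)\<^sup>2 / 2))) \<le> exp (5/4 * b * v)"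
    using *[of b] b by (simp add: z_def case_prod_unfold algebra_simps)
  show "measure_pmf.expectation (pair_pmf p p) (\<lambda>(a, c). exp (- (b * ((f a - f c)\<^sup>2 / 2)))) \<le> exp (- (3/4 * b * v))"
    using *[of "- b"] b by (simp add: z_def case_prod_unfold algebra_simps)
qed

section \<open>Decompositions of a mixture\<close>

text \<open>The decomposition is given on atoms; summing over the atoms transfers it to integrals.\<close>

lemma expectation_decomposition:
  fixes \<phi> :: "('x \<Rightarrow> real) \<Rightarrow> real"
  assumes c: "(\<alpha>, L) \<in> decompositions H m l"
    and \<phi>: "\<And>h. h \<in> H \<Longrightarrow> \<bar>\<phi> h\<bar> \<le> B" and l: "l \<in> discrete_dists H"
  shows "measure_pmf.expectation l \<phi> = (\<Sum>k=1..m. \<alpha> k * measure_pmf.expectation (L k) \<phi>)"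
proof -
  \<comment> \<open>Outside of \<open>H\<close> the integrand is arbitrary; it is cut off so that the sums over all atoms converge absolutely.\<close>
  define \<phi>' where "\<phi>' h = (if h \<in> H then \<phi> h else 0)" for h
  have eq: "measure_pmf.expectation q \<phi> = infsetsum (\<lambda>h. pmf q h * \<phi>' h) UNIV"
    "Infinite_Set_Sum.abs_summable_on (\<lambda>h. pmf q h * \<phi>' h) UNIV" if "q \<in> discrete_dists H" for q
  proof -
    have "measure_pmf.expectation q \<phi> = measure_pmf.expectation q \<phi>'"
      using that by (intro integral_cong_AE) (auto simp: AE_measure_pmf_iff \<phi>'_def discrete_dists_def)
    then show "measure_pmf.expectation q \<phi> = infsetsum (\<lambda>h. pmf q h * \<phi>' h) UNIV"
      by (simp add: pmf_expectation_eq_infsetsum)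
    show "Infinite_Set_Sum.abs_summable_on (\<lambda>h. pmf q h * \<phi>' h) UNIV"
    proof (rule abs_summable_on_comparison_test[where g = "\<lambda>h. \<bar>B\<bar> * pmf q h"])
      show "Infinite_Set_Sum.abs_summable_on (\<lambda>h. \<bar>B\<bar> * pmf q h) UNIV"
        by (intro abs_summable_on_cmult_right) (rule pmf_abs_summable)
    qed (use \<phi> in \<open>auto simp: \<phi>'_def abs_mult mult.commute[of "pmf _ _"]
            intro!: mult_right_mono order_trans[OF \<phi>]\<close>)
  qed
  have L: "L k \<in> discrete_dists H" if "k \<in> {1..m}" for k
    using c that by (auto simp: decompositions_def)
  have "measure_pmf.expectation l \<phi> = infsetsum (\<lambda>h. \<Sum>k=1..m. \<alpha> k * (pmf (L k) h * \<phi>' h)) UNIV"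
    using c unfolding eq(1)[OF l] decompositions_def
    by (intro infsetsum_cong) (auto simp: mult.assoc[symmetric] simp flip: sum_distrib_right)
  also have "\<dots> = (\<Sum>k=1..m. \<alpha> k * measure_pmf.expectation (L k) \<phi>)"
    using L eq unfolding infsetsum_def abs_summable_on_def
    by (subst Bochner_Integration.integral_sum) (auto intro!: sum.cong)
  finally show ?thesis .
qed

lemma decomposition_weights:
  assumes c: "(\<alpha>, L) \<in> decompositions H m l" and l: "l \<in> discrete_dists H"
  shows "(\<Sum>k=1..m. \<alpha> k) = 1" and "k \<in> {1..m} \<Longrightarrow> 0 \<le> \<alpha> k" and "k \<in> {1..m} \<Longrightarrow> \<alpha> k \<le> 1"
proof -
  show s: "(\<Sum>k=1..m. \<alpha> k) = 1"
    using expectation_decomposition[OF c _ l, of "\<lambda>_. 1" 1] by simp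
  show nn: "0 \<le> \<alpha> k" if "k \<in> {1..m}" for k
    using c that by (auto simp: decompositions_def)
  show "\<alpha> k \<le> 1" if "k \<in> {1..m}"
    using member_le_sum[of k "{1..m}" \<alpha>] nn that s by auto
qed

section \<open>Stratified random sampling from a decomposition\<close>

text \<open>The argument \<open>v (k, j, b)\<close> is the value, at one fixed point, of the \<open>j\<close>-th function drawn
  from the \<open>k\<close>-th component of a decomposition; \<open>b\<close> selects one of the two functions of a pair.\<close>

definition stratified_mean :: "nat \<Rightarrow> nat \<Rightarrow> (nat \<Rightarrow> real) \<Rightarrow> (nat \<times> nat \<times> bool \<Rightarrow> real) \<Rightarrow> real" where
  "stratified_mean m N \<alpha> v = (\<Sum>k=1..m. \<alpha> k / real N * (\<Sum>j=1..N. v (k, j, True)))"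

definition stratified_var :: "nat \<Rightarrow> nat \<Rightarrow> (nat \<Rightarrow> real) \<Rightarrow> (nat \<times> nat \<times> bool \<Rightarrow> real) \<Rightarrow> real" where
  "stratified_var m N \<alpha> v =
     (\<Sum>k=1..m. (\<alpha> k)\<^sup>2 / (2 * real N) * (\<Sum>j=1..N. (v (k, j, True) - v (k, j, False))\<^sup>2))"

lemma exists_less_expectation:
  fixes f :: "'a \<Rightarrow> real"
  assumes "integrable (measure_pmf p) f" "measure_pmf.expectation p f < b"
  shows "\<exists>w\<in>set_pmf p. f w < b"
proof (rule ccontr)
  assume "\<not> ?thesis"
  then have "\<And>w. w \<in> set_pmf p \<Longrightarrow> b \<le> f w" by (meson not_less)
  then have "measure_pmf.expectation p (\<lambda>_. b) \<le> measure_pmf.expectation p f"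
    using assms(1) by (intro pmf_expectation_mono) auto
  with assms(2) show False by simp
qed

text \<open>The method of conditional expectations: the coordinates are chosen one after the other, and each
  choice keeps the expected sum of the exponentials below 1. When all are chosen, every
  exponential is below 1, so every exponent is negative. This replaces product
  measures and a union bound.\<close>

lemma simultaneous_choice:
  fixes \<psi> :: "'r \<Rightarrow> 'j \<Rightarrow> 'w \<Rightarrow> real" and c :: "'r \<Rightarrow> real" and p :: "'j \<Rightarrow> 'w pmf"
  assumes "finite R" "finite J"
    and "\<And>r j w. r \<in> R \<Longrightarrow> j \<in> J \<Longrightarrow> w \<in> set_pmf (p j) \<Longrightarrow> \<bar>\<psi> r j w\<bar> \<le> 1"
    and "(\<Sum>r\<in>R. exp (c r) * (\<Prod>j\<in>J. measure_pmf.expectation (p j) (\<lambda>w. exp (\<psi> r j w)))) < 1"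
  shows "\<exists>w. (\<forall>j\<in>J. w j \<in> set_pmf (p j)) \<and> (\<forall>r\<in>R. c r + (\<Sum>j\<in>J. \<psi> r j (w j)) < 0)"
  using assms(2,3,4)
proof (induction J arbitrary: c rule: finite_induct)
  case empty
  have "c r < 0" if "r \<in> R" for r
  proof -
    have "exp (c r) \<le> (\<Sum>r\<in>R. exp (c r))"
      using that assms(1) by (intro member_le_sum) auto
    also have "\<dots> < 1" using empty by simp
    finally show ?thesis by simp
  qed
  then show ?case by simp
next
  case (insert a J)
  define e where "e r = (\<Prod>j\<in>J. measure_pmf.expectation (p j) (\<lambda>w. exp (\<psi> r j w)))" for r
  have i: "integrable (measure_pmf (p a)) (\<lambda>w. exp (\<psi> r a w))" if "r \<in> R" for r
    using insert.prems(1)[OF that, of a]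
    by (intro integrable_pmf_bounded[where B = "exp 1"]) (auto simp: abs_le_iff)
  have i': "integrable (measure_pmf (p a)) (\<lambda>w. \<Sum>r\<in>R. (exp (c r) * e r) * exp (\<psi> r a w))"
    using i by (intro Bochner_Integration.integrable_sum integrable_mult_right) auto
  have "measure_pmf.expectation (p a) (\<lambda>w. \<Sum>r\<in>R. (exp (c r) * e r) * exp (\<psi> r a w))
      = (\<Sum>r\<in>R. (exp (c r) * e r) * measure_pmf.expectation (p a) (\<lambda>w. exp (\<psi> r a w)))"
    using i by (subst Bochner_Integration.integral_sum) auto
  also have "\<dots> < 1"
    using insert.prems(2) insert.hyps by (simp add: e_def ac_simps)
  finally obtain w0 where w0: "w0 \<in> set_pmf (p a)"
    "(\<Sum>r\<in>R. (exp (c r) * e r) * exp (\<psi> r a w0)) < 1"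
    using exists_less_expectation[OF i'] by blast
  have "(\<Sum>r\<in>R. exp (c r + \<psi> r a w0) * e r) < 1"
    using w0(2) by (simp add: exp_add ac_simps)
  then obtain w where w: "\<forall>j\<in>J. w j \<in> set_pmf (p j)"
    "\<forall>r\<in>R. c r + \<psi> r a w0 + (\<Sum>j\<in>J. \<psi> r j (w j)) < 0"
    using insert.IH[of "\<lambda>r. c r + \<psi> r a w0"] insert.prems(1) unfolding e_def by auto
  have upd: "(\<Sum>j\<in>J. \<psi> r j ((w(a := w0)) j)) = (\<Sum>j\<in>J. \<psi> r j (w j))" for r
    using insert.hyps by (intro sum.cong) auto
  show ?case
    using w w0(1) insert.hyps by (intro exI[of _ "w(a := w0)"]) (auto simp: upd[unfolded fun_upd_apply] add.assoc)
qed

text \<open>The sampling step. Every point gives rise to at most three tests with negative exponents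
  when the desired estimates hold. Tests 0 and 1 are the two deviations of the mean and are
  made where \<open>\<sigma>\<^sup>2 < 4\<gamma>\<close>, test 2 is the upper deviation of the variance estimate where
  \<open>\<sigma>\<^sup>2 < \<gamma>\<close>, test 3 its lower deviation where \<open>\<sigma>\<^sup>2 \<ge> 4\<gamma>\<close>. The expected exponential of each test is at
  most \<open>exp (- N \<delta>\<^sup>2 / (144\<gamma>))\<close>, so a simultaneous choice exists if three times the number of
  points times this quantity is below 1.\<close>

lemma stratified_sample_exists:
  fixes x :: "'i \<Rightarrow> 'x"
  assumes c: "(\<alpha>, L) \<in> decompositions H m l" and l: "l \<in> discrete_dists H"
    and I: "finite I" and H: "\<And>h i. h \<in> H \<Longrightarrow> i \<in> I \<Longrightarrow> \<bar>h (x i)\<bar> \<le> 1"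
    and \<delta>: "0 < \<delta>" "\<delta> \<le> \<gamma>" and N: "0 < N"
    and small: "3 * real (card I) * exp (- (real N * \<delta>\<^sup>2 / (144 * \<gamma>))) < 1"
  shows "\<exists>W. (\<forall>k\<in>{1..m}. \<forall>j\<in>{1..N}. \<forall>b. W (k, j, b) \<in> H) \<and>
     (\<forall>i\<in>I. (decomp_var m (\<alpha>, L) (x i) < 4 * \<gamma> \<longrightarrow>
              \<bar>stratified_mean m N \<alpha> (\<lambda>a. W a (x i)) - mix_mean l (x i)\<bar> < \<delta> / 3) \<and>
            (4 * \<gamma> \<le> decomp_var m (\<alpha>, L) (x i) \<longrightarrow>
              5/2 * \<gamma> < stratified_var m N \<alpha> (\<lambda>a. W a (x i))) \<and>
            (decomp_var m (\<alpha>, L) (x i) < \<gamma> \<longrightarrow>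
              stratified_var m N \<alpha> (\<lambda>a. W a (x i)) < 3/2 * \<gamma>))"
proof -
  \<comment> \<open>This minimizes the exponent \<open>4\<gamma>\<tau>\<^sup>2 - \<tau>\<delta>/3\<close> per draw of tests 0 and 1; the minimum is \<open>- \<delta>\<^sup>2 / (144\<gamma>)\<close>.\<close>
  define \<tau> where "\<tau> = \<delta> / (24 * \<gamma>)"
  define E where "E = real N * \<delta>\<^sup>2 / (144 * \<gamma>)"
  define s2 where "s2 i = decomp_var m (\<alpha>, L) (x i)" for i
  define f where "f k i = mix_mean (L k) (x i)" for k i
  define R where "R = {(i, q). i \<in> I \<and> q < (4::nat) \<and>
     ((q = 0 \<or> q = 1) \<longrightarrow> s2 i < 4 * \<gamma>) \<and> (q = 2 \<longrightarrow> s2 i < \<gamma>) \<and> (q = 3 \<longrightarrow> 4 * \<gamma> \<le> s2 i)}"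
  define J where "J = {1..m} \<times> {1..N}"
  define p where "p = (\<lambda>(k, j::nat). pair_pmf (L k) (L k))"
  define \<psi> where "\<psi> = (\<lambda>(i::'i, q::nat) (k, j::nat) (h, h').
     if q = 0 then \<tau> * \<alpha> k * (h (x i) - f k i) else
     if q = 1 then - (\<tau> * \<alpha> k) * (h (x i) - f k i) else
     if q = 2 then (\<alpha> k)\<^sup>2 / 8 * ((h (x i) - h' (x i))\<^sup>2 / 2)
     else - ((\<alpha> k)\<^sup>2 / 8 * ((h (x i) - h' (x i))\<^sup>2 / 2)))"
  define cc where "cc = (\<lambda>(i::'i, q::nat). if q = 0 \<or> q = 1 then - (real N * \<tau> * \<delta> / 3) else
     if q = 2 then - (3/16 * real N * \<gamma>) else 5/16 * real N * \<gamma>)"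
  \<comment> \<open>Bounds for the logarithm of the exponential moment of one draw, by the lemmas on exponential moments.\<close>
  define \<beta> where "\<beta> = (\<lambda>(i, q::nat) k. if q = 0 \<or> q = 1 then (\<tau> * \<alpha> k)\<^sup>2 * mix_var (L k) (x i) else
     if q = 2 then 5/32 * (\<alpha> k)\<^sup>2 * mix_var (L k) (x i) else - (3/32 * (\<alpha> k)\<^sup>2 * mix_var (L k) (x i)))"
  note w = decomposition_weights[OF c l]
  have \<gamma>: "0 < \<gamma>" using \<delta> by linarith
  have \<tau>: "0 < \<tau>" "\<tau> \<le> 1/24" using \<delta> \<gamma> by (auto simp: \<tau>_def field_simps)
  have LH: "set_pmf (L k) \<subseteq> H" if "k \<in> {1..m}" for k
    using c that by (auto simp: decompositions_def discrete_dists_def)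
  have bd: "\<bar>h (x i)\<bar> \<le> 1" if "k \<in> {1..m}" "h \<in> set_pmf (L k)" "i \<in> I" for k h i
    using LH that H by blast
  have \<tau>\<alpha>: "\<bar>\<tau> * \<alpha> k\<bar> \<le> 1/24" if "k \<in> {1..m}" for k
    using mult_mono[of \<tau> "1/24" "\<alpha> k" 1] w(2,3)[OF that] \<tau> by (simp add: abs_mult)
  have \<alpha>2: "0 \<le> (\<alpha> k)\<^sup>2 / 8" "(\<alpha> k)\<^sup>2 / 8 \<le> 1/8" if "k \<in> {1..m}" for k
    using w(2,3)[OF that] by (auto simp: power_le_one)
  have fb: "\<bar>f k i\<bar> \<le> 1" if "k \<in> {1..m}" "i \<in> I" for k i
  proof -
    have i: "integrable (measure_pmf (L k)) (\<lambda>h. h (x i))"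
      using bd[OF that(1) _ that(2)] by (rule integrable_pmf_bounded)
    have "f k i \<le> measure_pmf.expectation (L k) (\<lambda>_. 1)" "measure_pmf.expectation (L k) (\<lambda>_. - 1) \<le> f k i"
      unfolding f_def mix_mean_def using i bd[OF that(1) _ that(2)]
      by (intro pmf_expectation_mono; force simp: abs_le_iff)+
    then show ?thesis by simp
  qed
  have finR: "finite R" by (rule finite_subset[of _ "I \<times> {..<4}"]) (auto simp: R_def I)
  have finJ: "finite J" by (simp add: J_def)
  have \<psi>1: "\<bar>\<psi> r a u\<bar> \<le> 1" if r: "r \<in> R" and a: "a \<in> J" and u: "u \<in> set_pmf (p a)" for r a u
  proof -
    obtain i q where r': "r = (i, q)" "i \<in> I" using r by (auto simp: R_def)
    obtain k j where a': "a = (k, j)" "k \<in> {1..m}" using a by (auto simp: J_def)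
    obtain h h' where u': "u = (h, h')" "h \<in> set_pmf (L k)" "h' \<in> set_pmf (L k)"
      using u by (auto simp: p_def a')
    note b = bd[OF a'(2) u'(2) r'(2)] bd[OF a'(2) u'(3) r'(2)] fb[OF a'(2) r'(2)]
    have "\<bar>h (x i) - f k i\<bar> \<le> 2" using b by linarith
    then have 1: "\<bar>\<tau> * \<alpha> k\<bar> * \<bar>h (x i) - f k i\<bar> \<le> 1/24 * 2"
      using \<tau>\<alpha>[OF a'(2)] by (intro mult_mono) auto
    have "\<bar>h (x i) - h' (x i)\<bar> \<le> 2" using b by linarith
    then have "\<bar>h (x i) - h' (x i)\<bar>\<^sup>2 \<le> 2\<^sup>2" by (intro power_mono) auto
    then have 2: "(\<alpha> k)\<^sup>2 / 8 * ((h (x i) - h' (x i))\<^sup>2 / 2) \<le> 1/8 * (2\<^sup>2/2)"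
      using \<alpha>2[OF a'(2)] by (intro mult_mono) auto
    have 3: "0 \<le> (\<alpha> k)\<^sup>2 / 8 * ((h (x i) - h' (x i))\<^sup>2 / 2)" by simp
    have 4: "\<bar>\<psi> r a u\<bar> = (if q = 0 \<or> q = 1 then \<bar>\<tau> * \<alpha> k\<bar> * \<bar>h (x i) - f k i\<bar>
        else (\<alpha> k)\<^sup>2 / 8 * ((h (x i) - h' (x i))\<^sup>2 / 2))"
      by (simp add: \<psi>_def r' a' u' abs_mult)
    show ?thesis unfolding 4 using 1 2 by auto
  qed
  have e\<psi>: "measure_pmf.expectation (p a) (\<lambda>u. exp (\<psi> r a u)) \<le> exp (\<beta> r (fst a))"
    if r: "r \<in> R" and a: "a \<in> J" for r a
  proof -
    obtain i q where r': "r = (i, q)" "i \<in> I" using r by (auto simp: R_def)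
    obtain k j where a': "a = (k, j)" "k \<in> {1..m}" using a by (auto simp: J_def)
    note bb = bd[OF a'(2) _ r'(2)]
    have first: "measure_pmf.expectation (pair_pmf (L k) (L k)) (\<lambda>u. exp (b * (fst u (x i) - f k i)))
       \<le> exp (b\<^sup>2 * mix_var (L k) (x i))" if "\<bar>b\<bar> \<le> 1/2" for b
    proof -
      have "measure_pmf.expectation (map_pmf fst (pair_pmf (L k) (L k))) (\<lambda>h. exp (b * (h (x i) - f k i)))
       \<le> exp (b\<^sup>2 * mix_var (L k) (x i))"
        unfolding map_fst_pair_pmf
        using expectation_exp_centered[of "L k" "\<lambda>h. h (x i)" b] bb that
        by (simp add: f_def mix_mean_def mix_var_def)
      then show ?thesis by (simp only: integral_map_pmf)
    qed
    note second = expectation_exp_half_square_diff[of "L k" "\<lambda>h. h (x i)" "(\<alpha> k)\<^sup>2 / 8"]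
    consider "q = 0" | "q = 1" | "q = 2" | "q \<noteq> 0 \<and> q \<noteq> 1 \<and> q \<noteq> 2" by blast
    then show ?thesis
    proof cases
      case 1
      then show ?thesis using first[of "\<tau> * \<alpha> k"] \<tau>\<alpha>[OF a'(2)]
        by (simp add: \<psi>_def r' a' \<beta>_def p_def case_prod_unfold)
    next
      case 2
      then show ?thesis using first[of "- (\<tau> * \<alpha> k)"] \<tau>\<alpha>[OF a'(2)]
        by (simp add: \<psi>_def r' a' \<beta>_def p_def case_prod_unfold)
    next
      case 3
      then show ?thesis using second(1) bb \<alpha>2[OF a'(2)]
        by (simp add: \<psi>_def r' a' \<beta>_def p_def case_prod_unfold mix_var_def mix_mean_def)
    next
      case 4
      then show ?thesis using second(2) bb \<alpha>2[OF a'(2)]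
        by (simp add: \<psi>_def r' a' \<beta>_def p_def case_prod_unfold mix_var_def mix_mean_def)
    qed
  qed
  have s2: "s2 i = (\<Sum>k=1..m. (\<alpha> k)\<^sup>2 * mix_var (L k) (x i))" for i
    by (simp add: s2_def decomp_var_def)
  have expo: "cc r + real N * (\<Sum>k=1..m. \<beta> r k) \<le> - E" if r: "r \<in> R" for r
  proof -
    obtain i q where r': "r = (i, q)" "i \<in> I" "q < 4" using r by (auto simp: R_def)
    \<comment> \<open>The variance tests have exponent at most \<open>- N \<gamma> / 32\<close>; since \<open>\<delta> \<le> \<gamma>\<close> this is below \<open>- E\<close>.\<close>
    have E\<gamma>: "E \<le> real N * \<gamma> / 32"
    proof -
      have "\<delta>\<^sup>2 \<le> \<gamma>\<^sup>2" using \<delta> by (intro power_mono) auto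
      then have "2 * \<delta>\<^sup>2 \<le> 9 * \<gamma>\<^sup>2" using zero_le_power2[of \<gamma>] by linarith
      then have "\<delta>\<^sup>2 / (144 * \<gamma>) \<le> \<gamma> / 32"
        using \<gamma> by (simp add: field_simps power2_eq_square)
      then show ?thesis unfolding E_def using mult_left_mono[of "\<delta>\<^sup>2 / (144 * \<gamma>)" "\<gamma> / 32" "real N"] by simp
    qed
    consider "q = 0 \<or> q = 1" | "q = 2" | "q = 3" using r'(3) by linarith
    then show ?thesis
    proof cases
      case 1
      then have s: "s2 i \<le> 4 * \<gamma>" using r by (auto simp: R_def r')
      have "(\<Sum>k=1..m. \<beta> r k) = \<tau>\<^sup>2 * s2 i"
        using 1 by (simp add: \<beta>_def r' s2 sum_distrib_left power_mult_distrib mult.assoc)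
      also have "\<dots> \<le> \<tau>\<^sup>2 * (4 * \<gamma>)" using s by (intro mult_left_mono) auto
      finally have "cc r + real N * (\<Sum>k=1..m. \<beta> r k) \<le> - (real N * \<tau> * \<delta> / 3) + real N * (\<tau>\<^sup>2 * (4 * \<gamma>))"
        using 1 by (intro add_mono mult_left_mono) (auto simp: cc_def r')
      also have "\<dots> = - E"
        using \<gamma> by (simp add: \<tau>_def E_def field_simps power2_eq_square)
      finally show ?thesis .
    next
      case 2
      then have s: "s2 i \<le> \<gamma>" using r by (auto simp: R_def r')
      have "(\<Sum>k=1..m. \<beta> r k) = 5/32 * s2 i"
        using 2 by (simp add: \<beta>_def r' s2 sum_distrib_left mult.assoc)
      also have "\<dots> \<le> 5/32 * \<gamma>" using s by simp
      finally have "real N * (\<Sum>k=1..m. \<beta> r k) \<le> real N * (5/32 * \<gamma>)" by (intro mult_left_mono) auto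
      then show ?thesis using 2 E\<gamma> by (simp add: cc_def r')
    next
      case 3
      then have s: "4 * \<gamma> \<le> s2 i" using r by (auto simp: R_def r')
      have "(\<Sum>k=1..m. \<beta> r k) = - (3/32 * s2 i)"
        using 3 by (simp add: \<beta>_def r' s2 sum_distrib_left mult.assoc sum_negf)
      also have "\<dots> \<le> - (12/32 * \<gamma>)" using s by simp
      finally have "real N * (\<Sum>k=1..m. \<beta> r k) \<le> real N * (- (12/32 * \<gamma>))" by (intro mult_left_mono) auto
      moreover have "0 \<le> E" using \<gamma> by (simp add: E_def)
      ultimately show ?thesis using 3 E\<gamma> by (simp add: cc_def r')
    qed
  qed
  have contribution: "exp (cc r) * (\<Prod>a\<in>J. measure_pmf.expectation (p a) (\<lambda>u. exp (\<psi> r a u))) \<le> exp (- E)"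
    if r: "r \<in> R" for r
  proof -
    have "(\<Prod>a\<in>J. measure_pmf.expectation (p a) (\<lambda>u. exp (\<psi> r a u))) \<le> (\<Prod>a\<in>J. exp (\<beta> r (fst a)))"
      using e\<psi>[OF r] by (intro prod_mono) (auto intro!: integral_nonneg_AE)
    also have "\<dots> = exp (\<Sum>a\<in>J. \<beta> r (fst a))" by (simp add: exp_sum finJ)
    also have "(\<Sum>a\<in>J. \<beta> r (fst a)) = real N * (\<Sum>k=1..m. \<beta> r k)"
      by (simp add: J_def sum.cartesian_product' sum_distrib_left)
    finally have "exp (cc r) * (\<Prod>a\<in>J. measure_pmf.expectation (p a) (\<lambda>u. exp (\<psi> r a u)))
       \<le> exp (cc r) * exp (real N * (\<Sum>k=1..m. \<beta> r k))" by (intro mult_left_mono) auto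
    also have "\<dots> \<le> exp (- E)" using expo[OF r] by (simp flip: exp_add)
    finally show ?thesis .
  qed
  have cardR: "card R \<le> 3 * card I"
  proof -
    have "R \<subseteq> (\<lambda>(i, b). (i, if s2 i < 4 * \<gamma> then b else 3)) ` (I \<times> {..<3})"
    proof
      fix r assume "r \<in> R"
      then obtain i q where r: "r = (i, q)" "i \<in> I" "q < 4"
        "(q = 0 \<or> q = 1) \<longrightarrow> s2 i < 4 * \<gamma>" "q = 2 \<longrightarrow> s2 i < \<gamma>" "q = 3 \<longrightarrow> 4 * \<gamma> \<le> s2 i"
        by (auto simp: R_def)
      show "r \<in> (\<lambda>(i, b). (i, if s2 i < 4 * \<gamma> then b else 3)) ` (I \<times> {..<3})"
      proof (cases "s2 i < 4 * \<gamma>")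
        case True
        then have "q < 3" using r by (cases "q = 3") auto
        then show ?thesis using True r by (intro image_eqI[of _ _ "(i, q)"]) auto
      next
        case False
        then have "q = 3" using r \<gamma> by (cases "q = 2") auto
        then show ?thesis using False r by (intro image_eqI[of _ _ "(i, 0)"]) auto
      qed
    qed
    then have "card R \<le> card ((\<lambda>(i, b). (i, if s2 i < 4 * \<gamma> then b else (3::nat))) ` (I \<times> {..<3}))"
      by (intro card_mono) (auto simp: I)
    also have "\<dots> \<le> card (I \<times> {..<3::nat})" by (intro card_image_le) (auto simp: I)
    finally show ?thesis by (simp add: card_cartesian_product mult.commute)
  qed
  have "(\<Sum>r\<in>R. exp (cc r) * (\<Prod>a\<in>J. measure_pmf.expectation (p a) (\<lambda>u. exp (\<psi> r a u))))
     \<le> (\<Sum>r\<in>R. exp (- E))" using contribution by (intro sum_mono) auto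
  also have "\<dots> \<le> 3 * real (card I) * exp (- E)"
  proof -
    have "real (card R) \<le> 3 * real (card I)" using cardR by linarith
    then show ?thesis by simp
  qed
  also have "\<dots> < 1" using small by (simp add: E_def)
  finally obtain u where u: "\<forall>a\<in>J. u a \<in> set_pmf (p a)"
      "\<forall>r\<in>R. cc r + (\<Sum>a\<in>J. \<psi> r a (u a)) < 0"
    using simultaneous_choice[of R J p \<psi> cc] finR finJ \<psi>1 by blast
  define W where "W = (\<lambda>(k, j, b). (if b then fst else snd) (u (k, j)))"
  have WH: "W (k, j, b) \<in> H" if "k \<in> {1..m}" "j \<in> {1..N}" for k j b
    using u(1)[rule_format, of "(k, j)"] LH[of k] that by (auto simp: W_def p_def J_def)
  define g where "g i = stratified_mean m N \<alpha> (\<lambda>a. W a (x i))" for i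
  define s where "s i = stratified_var m N \<alpha> (\<lambda>a. W a (x i))" for i
  have mean: "mix_mean l (x i) = (\<Sum>k=1..m. \<alpha> k * f k i)" if "i \<in> I" for i
    unfolding mix_mean_def f_def
    by (rule expectation_decomposition[OF c _ l, where B = 1]) (use H that in auto)
  have dev: "(\<Sum>(k, j)\<in>J. b * \<alpha> k * (W (k, j, True) (x i) - f k i)) = b * real N * (g i - mix_mean l (x i))"
    if "i \<in> I" for i b
  proof -
    have "(\<Sum>(k, j)\<in>J. b * \<alpha> k * (W (k, j, True) (x i) - f k i))
      = (\<Sum>k=1..m. \<Sum>j=1..N. b * \<alpha> k * (W (k, j, True) (x i) - f k i))"
      unfolding J_def by (rule sum.cartesian_product[symmetric])
    also have "\<dots> = (\<Sum>k=1..m. b * \<alpha> k * (\<Sum>j=1..N. W (k, j, True) (x i)) - b * real N * (\<alpha> k * f k i))"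
      by (intro sum.cong) (simp_all add: sum_distrib_left[symmetric] sum_subtractf algebra_simps)
    also have "\<dots> = b * real N * (g i - mix_mean l (x i))"
      using N mean[OF that]
      by (simp add: g_def stratified_mean_def right_diff_distrib sum_subtractf sum_distrib_left mult.assoc)
    finally show ?thesis .
  qed
  have vr: "(\<Sum>(k, j)\<in>J. (\<alpha> k)\<^sup>2 / 8 * ((W (k, j, True) (x i) - W (k, j, False) (x i))\<^sup>2 / 2)) = real N * s i / 8" for i
  proof -
    have "(\<Sum>(k, j)\<in>J. (\<alpha> k)\<^sup>2 / 8 * ((W (k, j, True) (x i) - W (k, j, False) (x i))\<^sup>2 / 2))
      = (\<Sum>k=1..m. \<Sum>j=1..N. (\<alpha> k)\<^sup>2 / 8 * ((W (k, j, True) (x i) - W (k, j, False) (x i))\<^sup>2 / 2))"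
      unfolding J_def by (rule sum.cartesian_product[symmetric])
    also have "\<dots> = real N * s i / 8"
      using N unfolding s_def stratified_var_def sum_distrib_left sum_divide_distrib
      by (intro sum.cong) auto
    finally show ?thesis .
  qed
  have psi: "(\<Sum>a\<in>J. \<psi> (i, q) a (u a)) = (if q = 0 then \<tau> * real N * (g i - mix_mean l (x i)) else
     if q = 1 then - \<tau> * real N * (g i - mix_mean l (x i)) else
     if q = 2 then real N * s i / 8 else - (real N * s i / 8))" if "i \<in> I" for i q
  proof -
    have "(\<Sum>a\<in>J. \<psi> (i, q) a (u a)) = (if q = 0 then (\<Sum>(k, j)\<in>J. \<tau> * \<alpha> k * (W (k, j, True) (x i) - f k i)) else
     if q = 1 then (\<Sum>(k, j)\<in>J. - \<tau> * \<alpha> k * (W (k, j, True) (x i) - f k i)) else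
     if q = 2 then (\<Sum>(k, j)\<in>J. (\<alpha> k)\<^sup>2 / 8 * ((W (k, j, True) (x i) - W (k, j, False) (x i))\<^sup>2 / 2))
     else - (\<Sum>(k, j)\<in>J. (\<alpha> k)\<^sup>2 / 8 * ((W (k, j, True) (x i) - W (k, j, False) (x i))\<^sup>2 / 2)))"
      by (auto simp: \<psi>_def W_def split_beta sum_negf[symmetric] intro!: sum.cong)
    then show ?thesis by (simp only: dev[OF that] vr)
  qed
  have main: "(s2 i < 4 * \<gamma> \<longrightarrow> \<bar>g i - mix_mean l (x i)\<bar> < \<delta> / 3) \<and>
     (4 * \<gamma> \<le> s2 i \<longrightarrow> 5/2 * \<gamma> < s i) \<and> (s2 i < \<gamma> \<longrightarrow> s i < 3/2 * \<gamma>)" if i: "i \<in> I" for i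
  proof (intro conjI impI)
    have N': "0 < real N" using N by simp
    note fact = u(2)[rule_format, of "(i, q)" for q]
    show "\<bar>g i - mix_mean l (x i)\<bar> < \<delta> / 3" if "s2 i < 4 * \<gamma>"
    proof -
      have "(i, 0) \<in> R" "(i, 1) \<in> R" using that i by (auto simp: R_def)
      from fact[OF this(1)] fact[OF this(2)]
      have "(\<tau> * real N) * (g i - mix_mean l (x i)) < (\<tau> * real N) * (\<delta> / 3)"
        "(\<tau> * real N) * - (g i - mix_mean l (x i)) < (\<tau> * real N) * (\<delta> / 3)"
        using i by (auto simp: psi cc_def algebra_simps)
      then have "g i - mix_mean l (x i) < \<delta> / 3" "- (g i - mix_mean l (x i)) < \<delta> / 3"
        using \<tau> N' by (simp_all only: mult_less_cancel_left_pos mult_pos_pos)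
      then show ?thesis by linarith
    qed
    show "5/2 * \<gamma> < s i" if "4 * \<gamma> \<le> s2 i"
    proof -
      have "(i, 3) \<in> R" using that i by (auto simp: R_def)
      from fact[OF this] have "real N * (5/2 * \<gamma>) < real N * s i"
        using i by (auto simp: psi cc_def algebra_simps)
      then show ?thesis using N' by (simp add: mult_less_cancel_left_pos)
    qed
    show "s i < 3/2 * \<gamma>" if "s2 i < \<gamma>"
    proof -
      have "(i, 2) \<in> R" using that i \<gamma> by (auto simp: R_def)
      from fact[OF this] have "real N * s i < real N * (3/2 * \<gamma>)"
        using i by (auto simp: psi cc_def algebra_simps)
      then show ?thesis using N' by (simp add: mult_less_cancel_left_pos)
    qed
  qed
  show ?thesis
    using WH main unfolding g_def s_def s2_def by (intro exI[of _ W] conjI) blast+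
qed

section \<open>Perturbations and nets\<close>

lemma abs_average_le:
  fixes z :: "nat \<Rightarrow> real"
  assumes "\<And>j. j \<in> {1..N} \<Longrightarrow> \<bar>z j\<bar> \<le> B" "0 < N"
  shows "\<bar>(\<Sum>j=1..N. z j) / real N\<bar> \<le> B"
proof -
  have "\<bar>\<Sum>j=1..N. z j\<bar> \<le> (\<Sum>j=1..N. B)"
    using assms(1) by (intro order_trans[OF sum_abs] sum_mono) auto
  then show ?thesis using assms(2) by (simp add: field_simps)
qed

lemma abs_weighted_diff_le:
  fixes \<alpha> \<beta> S T :: "nat \<Rightarrow> real"
  assumes "\<And>k. k \<in> {1..m} \<Longrightarrow> 0 \<le> \<beta> k" "(\<Sum>k=1..m. \<beta> k) \<le> 1"
    and "\<And>k. k \<in> {1..m} \<Longrightarrow> \<bar>\<alpha>' k - \<beta>' k\<bar> \<le> e"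
    and "\<And>k. k \<in> {1..m} \<Longrightarrow> 0 \<le> \<beta>' k \<and> \<beta>' k \<le> \<beta> k"
    and "\<And>k. k \<in> {1..m} \<Longrightarrow> \<bar>S k\<bar> \<le> B" "\<And>k. k \<in> {1..m} \<Longrightarrow> \<bar>S k - T k\<bar> \<le> D" "0 \<le> D" "0 \<le> B"
  shows "\<bar>(\<Sum>k=1..m. \<alpha>' k * S k) - (\<Sum>k=1..m. \<beta>' k * T k)\<bar> \<le> real m * (e * B) + D"
proof -
  have "(\<Sum>k=1..m. \<alpha>' k * S k) - (\<Sum>k=1..m. \<beta>' k * T k)
     = (\<Sum>k=1..m. (\<alpha>' k - \<beta>' k) * S k + \<beta>' k * (S k - T k))"
    by (simp add: sum_subtractf[symmetric] algebra_simps)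
  also have "\<bar>\<dots>\<bar> \<le> (\<Sum>k=1..m. e * B + \<beta> k * D)"
  proof (intro order_trans[OF sum_abs] sum_mono)
    fix k assume k: "k \<in> {1..m}"
    have "\<bar>(\<alpha>' k - \<beta>' k) * S k\<bar> \<le> e * B"
      unfolding abs_mult using assms(3,5)[OF k] by (intro mult_mono) auto
    moreover have "\<bar>\<beta>' k * (S k - T k)\<bar> \<le> \<beta> k * D"
      unfolding abs_mult using assms(1,4,6)[OF k] by (intro mult_mono) auto
    ultimately show "\<bar>(\<alpha>' k - \<beta>' k) * S k + \<beta>' k * (S k - T k)\<bar> \<le> e * B + \<beta> k * D"
      by linarith
  qed
  also have "\<dots> = real m * (e * B) + (\<Sum>k=1..m. \<beta> k) * D"
    by (simp add: sum.distrib sum_distrib_right)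
  also have "\<dots> \<le> real m * (e * B) + 1 * D"
    using mult_right_mono[OF assms(2,7)] by simp
  finally show ?thesis by simp
qed

text \<open>Lipschitz bounds for values in \<open>[-1, 1]\<close>. The changes of the values are averaged with
  weights of sum at most 1, so they do not accumulate over \<open>m\<close> and \<open>N\<close>; the changes of the weights do
  accumulate over \<open>m\<close>.\<close>

lemma stratified_perturbation:
  assumes "0 < N" "0 \<le> d"
    and \<beta>: "\<And>k. k \<in> {1..m} \<Longrightarrow> 0 \<le> \<beta> k" "(\<Sum>k=1..m. \<beta> k) \<le> 1"
    and \<alpha>: "\<And>k. k \<in> {1..m} \<Longrightarrow> 0 \<le> \<alpha> k \<and> \<alpha> k \<le> 1" "\<And>k. k \<in> {1..m} \<Longrightarrow> \<bar>\<alpha> k - \<beta> k\<bar> \<le> e"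
    and v: "\<And>k j b. k \<in> {1..m} \<Longrightarrow> j \<in> {1..N} \<Longrightarrow> \<bar>v (k, j, b)\<bar> \<le> 1 \<and> \<bar>w (k, j, b)\<bar> \<le> 1"
    and vw: "\<And>k j b. k \<in> {1..m} \<Longrightarrow> j \<in> {1..N} \<Longrightarrow> \<bar>v (k, j, b) - w (k, j, b)\<bar> \<le> d"
  shows "\<bar>stratified_mean m N \<alpha> v - stratified_mean m N \<beta> w\<bar> \<le> real m * e + d"
    and "\<bar>stratified_var m N \<alpha> v - stratified_var m N \<beta> w\<bar> \<le> 4 * (real m * e + d)"
proof -
  have \<beta>1: "\<beta> k \<le> 1" if "k \<in> {1..m}" for k
    using member_le_sum[of k "{1..m}" \<beta>] \<beta> that by auto
  define S where "S k = (\<Sum>j=1..N. v (k, j, True)) / real N" for k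
  define T where "T k = (\<Sum>j=1..N. w (k, j, True)) / real N" for k
  have "\<bar>(\<Sum>k=1..m. \<alpha> k * S k) - (\<Sum>k=1..m. \<beta> k * T k)\<bar> \<le> real m * (e * 1) + d"
  proof (rule abs_weighted_diff_le[of m \<beta>, OF \<beta> \<alpha>(2)])
    show "\<bar>S k\<bar> \<le> 1" if "k \<in> {1..m}" for k
      unfolding S_def using v[OF that] assms(1) by (intro abs_average_le) auto
    show "\<bar>S k - T k\<bar> \<le> d" if "k \<in> {1..m}" for k
      unfolding S_def T_def diff_divide_distrib[symmetric] sum_subtractf[symmetric]
      using vw[OF that] assms(1) by (intro abs_average_le) auto
  qed (use assms \<beta> in auto)
  then show "\<bar>stratified_mean m N \<alpha> v - stratified_mean m N \<beta> w\<bar> \<le> real m * e + d"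
    by (simp add: stratified_mean_def S_def T_def)
  define S' where "S' k = (\<Sum>j=1..N. (v (k, j, True) - v (k, j, False))\<^sup>2 / 2) / real N" for k
  define T' where "T' k = (\<Sum>j=1..N. (w (k, j, True) - w (k, j, False))\<^sup>2 / 2) / real N" for k
  have "\<bar>(\<Sum>k=1..m. (\<alpha> k)\<^sup>2 * S' k) - (\<Sum>k=1..m. (\<beta> k)\<^sup>2 * T' k)\<bar> \<le> real m * ((2 * e) * 2) + 4 * d"
  proof (rule abs_weighted_diff_le[of m \<beta>, OF \<beta>])
    fix k assume k: "k \<in> {1..m}"
    have "\<bar>(\<alpha> k)\<^sup>2 - (\<beta> k)\<^sup>2\<bar> = \<bar>\<alpha> k + \<beta> k\<bar> * \<bar>\<alpha> k - \<beta> k\<bar>"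
      by (simp only: abs_mult[symmetric] square_diff_square_factored power2_eq_square)
    also have "\<dots> \<le> 2 * e"
      using \<alpha>[OF k] \<beta>1[OF k] \<beta>(1)[OF k] by (intro mult_mono) auto
    finally show "\<bar>(\<alpha> k)\<^sup>2 - (\<beta> k)\<^sup>2\<bar> \<le> 2 * e" .
    show "0 \<le> (\<beta> k)\<^sup>2 \<and> (\<beta> k)\<^sup>2 \<le> \<beta> k"
      using \<beta>(1)[OF k] \<beta>1[OF k] by (simp add: power2_eq_square mult_left_le)
    show "\<bar>S' k\<bar> \<le> 2" unfolding S'_def
    proof (rule abs_average_le[OF _ assms(1)])
      fix j assume j: "j \<in> {1..N}"
      have "\<bar>v (k, j, True) - v (k, j, False)\<bar> \<le> 2"
        using v[OF k j, of True] v[OF k j, of False] by linarith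
      then have "\<bar>v (k, j, True) - v (k, j, False)\<bar>\<^sup>2 \<le> 2\<^sup>2" by (intro power_mono) auto
      then show "\<bar>(v (k, j, True) - v (k, j, False))\<^sup>2 / 2\<bar> \<le> 2" by simp
    qed
    show "\<bar>S' k - T' k\<bar> \<le> 4 * d"
      unfolding S'_def T'_def diff_divide_distrib[symmetric] sum_subtractf[symmetric]
    proof (rule abs_average_le[OF _ assms(1)])
      fix j assume j: "j \<in> {1..N}"
      define A where "A = v (k, j, True) - v (k, j, False)"
      define B where "B = w (k, j, True) - w (k, j, False)"
      have "\<bar>A + B\<bar> \<le> 4" "\<bar>A - B\<bar> \<le> 2 * d"
        using v[OF k j, of True] v[OF k j, of False] vw[OF k j, of True] vw[OF k j, of False]
        unfolding A_def B_def by linarith+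
      then have "\<bar>A + B\<bar> * \<bar>A - B\<bar> \<le> 4 * (2 * d)" by (intro mult_mono) auto
      moreover have "\<bar>A + B\<bar> * \<bar>A - B\<bar> = \<bar>A\<^sup>2 - B\<^sup>2\<bar>"
        by (simp only: abs_mult[symmetric] square_diff_square_factored power2_eq_square)
      ultimately have "\<bar>A\<^sup>2 - B\<^sup>2\<bar> \<le> 8 * d" by simp
      then show "\<bar>((v (k, j, True) - v (k, j, False))\<^sup>2 - (w (k, j, True) - w (k, j, False))\<^sup>2) / 2\<bar> \<le> 4 * d"
        unfolding A_def B_def by simp
    qed
  qed (use assms in auto)
  moreover have "stratified_var m N \<alpha> v = (\<Sum>k=1..m. (\<alpha> k)\<^sup>2 * S' k)"
    "stratified_var m N \<beta> w = (\<Sum>k=1..m. (\<beta> k)\<^sup>2 * T' k)"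
    by (simp_all add: stratified_var_def S'_def T'_def sum_divide_distrib[symmetric])
  ultimately show "\<bar>stratified_var m N \<alpha> v - stratified_var m N \<beta> w\<bar> \<le> 4 * (real m * e + d)"
    by simp
qed

text \<open>The covering number is used for the uniform distribution on the points. A difference of
  \<open>L\<^sup>2\<close>-size \<open>u\<close> is at most \<open>u\<close> times the root of the number of points at each of them.\<close>

lemma sup_net_on_points:
  fixes x :: "'i \<Rightarrow> 'x"
  assumes cov: "ereal_of_enat (uniform_covering_number M H u) \<le> ereal B"
    and I: "finite I" "I \<noteq> {}" and x: "\<And>i. i \<in> I \<Longrightarrow> x i \<in> space M" and u: "0 \<le> u"
  shows "\<exists>F. finite F \<and> F \<subseteq> H \<and> real (card F) \<le> B \<and>
           (\<forall>h\<in>H. \<exists>g\<in>F. \<forall>i\<in>I. \<bar>g (x i) - h (x i)\<bar> \<le> u * sqrt (card I))"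
proof -
  define Q where "Q = map_pmf x (pmf_of_set I)"
  define \<F> where "\<F> = {F. finite F \<and> F \<subseteq> H \<and> (\<forall>h\<in>H. \<exists>g\<in>F. L2_dist Q g h \<le> u)}"
  have "Q \<in> discrete_dists (space M)"
    using x I by (auto simp: Q_def discrete_dists_def)
  then have "covering_number (L2_dist Q) H u \<le> uniform_covering_number M H u"
    unfolding uniform_covering_number_def by (rule SUP_upper)
  then have le: "ereal_of_enat (covering_number (L2_dist Q) H u) \<le> ereal B"
    using cov order_trans ereal_of_enat_le_iff by blast
  have cn: "covering_number (L2_dist Q) H u = Inf ((\<lambda>F. enat (card F)) ` \<F>)"
    by (simp add: covering_number_def \<F>_def)
  have "\<F> \<noteq> {}"
  proof
    assume "\<F> = {}"
    then have "covering_number (L2_dist Q) H u = \<infinity>" by (simp add: cn top_enat_def)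
    with le show False by simp
  qed
  then obtain c where "c \<in> (\<lambda>F. enat (card F)) ` \<F>" by blast
  then have "(LEAST c. c \<in> (\<lambda>F. enat (card F)) ` \<F>) \<in> (\<lambda>F. enat (card F)) ` \<F>" by (rule LeastI)
  then have "Inf ((\<lambda>F. enat (card F)) ` \<F>) \<in> (\<lambda>F. enat (card F)) ` \<F>"
    using \<open>\<F> \<noteq> {}\<close> by (simp add: Inf_enat_def)
  then obtain F where F: "F \<in> \<F>" "covering_number (L2_dist Q) H u = enat (card F)"
    unfolding cn by auto
  have "real (card F) \<le> B" using le F(2) by simp
  moreover have "\<exists>g\<in>F. \<forall>i\<in>I. \<bar>g (x i) - h (x i)\<bar> \<le> u * sqrt (card I)" if h: "h \<in> H" for h
  proof -
    obtain g where g: "g \<in> F" "L2_dist Q g h \<le> u" using F(1) h by (auto simp: \<F>_def)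
    have N: "0 < real (card I)" using I by (simp add: card_gt_0_iff)
    have "L2_dist Q g h = sqrt ((\<Sum>i\<in>I. (g (x i) - h (x i))\<^sup>2) / card I)"
      unfolding L2_dist_def Q_def using I by (simp add: integral_pmf_of_set)
    then have "(\<Sum>i\<in>I. (g (x i) - h (x i))\<^sup>2) / card I \<le> u\<^sup>2"
      using g(2) by (simp add: sqrt_le_D)
    then have s: "(\<Sum>i\<in>I. (g (x i) - h (x i))\<^sup>2) \<le> u\<^sup>2 * card I" using N by (simp add: field_simps)
    have "\<bar>g (x i) - h (x i)\<bar> \<le> u * sqrt (card I)" if i: "i \<in> I" for i
    proof -
      have "(g (x i) - h (x i))\<^sup>2 \<le> (\<Sum>i\<in>I. (g (x i) - h (x i))\<^sup>2)"
        using i I by (intro member_le_sum) auto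
      then have "\<bar>g (x i) - h (x i)\<bar>\<^sup>2 \<le> (u * sqrt (card I))\<^sup>2"
        using s by (simp add: power_mult_distrib)
      then show ?thesis by (rule power2_le_imp_le) (use u in auto)
    qed
    then show ?thesis using g(1) by blast
  qed
  ultimately show ?thesis using F(1) by (auto simp: \<F>_def)
qed

section \<open>Swapping the halves of a double sample\<close>

text \<open>Position \<open>i \<le> n\<close> of a double sample is exchanged with its partner \<open>i + n\<close> exactly if \<open>i \<in> s\<close>.\<close>

definition swap :: "nat \<Rightarrow> nat set \<Rightarrow> nat \<Rightarrow> nat" where
  "swap n s i = (if i \<in> s then i + n else if n < i \<and> i - n \<in> s then i - n else i)"

text \<open>Chernoff's bound for random swaps with base \<open>3/2\<close>. A partner pair with exactly one element in \<open>B\<close> contributes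
  \<open>3/2 + (3/2)\<^sup>-\<^sup>2 \<le> 2\<close> to the sum over its two arrangements, a pair inside \<open>B\<close> contributes
  \<open>2 (3/2)\<^sup>-\<^sup>1\<close>. The factor 2 in front of the count of the first half makes both at most 2.\<close>

lemma swap_count_le:
  fixes a :: real
  shows "real (card {s \<in> Pow {1..n}. 2 * real (card {i \<in> {1..n}. swap n s i \<in> B}) + a
                 \<le> real (card {i \<in> {n+1..2*n}. swap n s i \<in> B})})
       \<le> 2 ^ n * (3/2) powr (- a)"
proof -
  define S where "S = {s \<in> Pow {1..n}. 2 * real (card {i \<in> {1..n}. swap n s i \<in> B}) + a
                 \<le> real (card {i \<in> {n+1..2*n}. swap n s i \<in> B})}"
  define b where "b i = (of_bool (i \<in> B) :: real)" for i
  define f1 where "f1 i = (3/2) powr (b i - 2 * b (i + n))" for i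
  define f2 where "f2 i = (3/2) powr (b (i + n) - 2 * b i)" for i
  define X where "X s = real (card {i \<in> {n+1..2*n}. swap n s i \<in> B})
      - 2 * real (card {i \<in> {1..n}. swap n s i \<in> B})" for s
  have card_b: "real (card {i \<in> A. swap n s i \<in> B}) = (\<Sum>i\<in>A. b (swap n s i))" if "finite A" for A s
    using that by (simp add: b_def Collect_conj_eq Int_commute)
  have X: "(3/2) powr (X s) = (\<Prod>i\<in>s. f1 i) * (\<Prod>i\<in>{1..n} - s. f2 i)" if s: "s \<subseteq> {1..n}" for s
  proof -
    have "(\<Sum>i\<in>{n+1..2*n}. b (swap n s i)) = (\<Sum>i\<in>{1..n}. b (swap n s (i + n)))"
      by (rule sum.reindex_bij_witness[of _ "\<lambda>i. i + n" "\<lambda>i. i - n"]) auto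
    then have "X s = (\<Sum>i\<in>{1..n}. b (swap n s (i + n)) - 2 * b (swap n s i))"
      unfolding X_def by (subst (1 2) card_b) (simp_all add: sum_subtractf sum_distrib_left)
    also have "\<dots> = (\<Sum>i\<in>{1..n}. if i \<in> s then b i - 2 * b (i + n) else b (i + n) - 2 * b i)"
      using s by (intro sum.cong) (auto simp: swap_def)
    finally have "(3/2) powr (X s) = (\<Prod>i\<in>{1..n}. if i \<in> s then f1 i else f2 i)"
      by (auto simp: powr_sum f1_def f2_def intro!: prod.cong)
    also have "\<dots> = (\<Prod>i\<in>{1..n} \<inter> s. f1 i) * (\<Prod>i\<in>{1..n} \<inter> - s. f2 i)"
      by (subst prod.If_cases) auto
    also have "{1..n} \<inter> s = s" using s by auto
    finally show ?thesis by (simp add: Diff_eq)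
  qed
  have "real (card S) * (3/2) powr a = (\<Sum>s\<in>S. (3/2) powr a)" by simp
  also have "\<dots> \<le> (\<Sum>s\<in>S. (3/2) powr (X s))"
    by (intro sum_mono powr_mono) (auto simp: S_def X_def)
  also have "\<dots> \<le> (\<Sum>s\<in>Pow {1..n}. (3/2) powr (X s))"
    by (intro sum_mono2) (auto simp: S_def)
  also have "\<dots> = (\<Sum>s\<in>Pow {1..n}. (\<Prod>i\<in>s. f1 i) * (\<Prod>i\<in>{1..n} - s. f2 i))"
    using X by (intro sum.cong) auto
  also have "\<dots> = (\<Prod>i\<in>{1..n}. f1 i + f2 i)" by (simp add: prod_add)
  also have "\<dots> \<le> (\<Prod>i\<in>{1..n}. 2)"
  proof (intro prod_mono conjI)
    fix i
    have *: "(3/2::real) powr (-2) = 4/9" "(3/2::real) powr (-1) = 2/3"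
      by (simp_all add: powr_minus powr_numeral power2_eq_square)
    show "f1 i + f2 i \<le> 2"
      using * by (cases "i \<in> B"; cases "i + n \<in> B") (simp_all add: f1_def f2_def b_def)
  qed (auto simp: f1_def f2_def)
  finally have "real (card S) * (3/2) powr a \<le> 2 ^ n" by simp
  then have "real (card S) \<le> 2 ^ n * (3/2) powr (- a)"
    by (simp add: powr_minus field_simps)
  then show ?thesis by (simp add: S_def)
qed

lemma swap_inj_on:
  assumes "s \<subseteq> {1..n}"
  shows "inj_on (swap n s) {1..2*n}" "swap n s \<in> {1..2*n} \<rightarrow> {1..2*n}"
proof -
  have "swap n s (swap n s i) = i" if "i \<in> {1..2*n}" for i
  proof -
    have "\<And>j. j \<in> s \<Longrightarrow> 1 \<le> j \<and> j \<le> n" using assms by auto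
    from this[of i] this[of "i - n"] this[of "i + n"] show ?thesis
      by (auto simp: swap_def)
  qed
  then show "inj_on (swap n s) {1..2*n}" by (rule inj_on_inverseI)
  show "swap n s \<in> {1..2*n} \<rightarrow> {1..2*n}"
  proof
    fix i assume i: "i \<in> {1..2*n}"
    have "\<And>j. j \<in> s \<Longrightarrow> 1 \<le> j \<and> j \<le> n" using assms by auto
    from this[of i] this[of "i - n"] i show "swap n s i \<in> {1..2*n}"
      by (auto simp: swap_def)
  qed
qed

text \<open>The product measure is invariant under each swap, so the measure of \<open>A\<close> is the mean over the
  double samples of the fraction of swaps that lead into \<open>A\<close>. As \<open>A\<close> is measurable only up to a null set, the
  argument runs on a measurable part of \<open>A\<close>, and the null set is added afterwards.\<close>

lemma symmetrization:
  assumes P: "prob_space P"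
    and A: "A \<in> sets (completion (PiM {1..2*n} (\<lambda>_. P)))"
    and count: "\<And>z. z \<in> space (PiM {1..2*n} (\<lambda>_. P)) \<Longrightarrow>
       real (card {s \<in> Pow {1..n}. (\<lambda>i\<in>{1..2*n}. z (swap n s i)) \<in> A}) \<le> 2 ^ n * \<beta>"
    and \<beta>: "0 \<le> \<beta>"
  shows "\<exists>B \<in> sets (PiM {1..2*n} (\<lambda>_. P)). A \<subseteq> B \<and> measure (PiM {1..2*n} (\<lambda>_. P)) B \<le> \<beta>"
proof -
  define \<mu> where "\<mu> = PiM {1..2*n} (\<lambda>_. P)"
  define T where "T s z = (\<lambda>i\<in>{1..2*n}. z (swap n s i))" for s and z :: "nat \<Rightarrow> 'a"
  interpret prob_space \<mu> unfolding \<mu>_def by (intro prob_space_PiM P)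
  obtain S N0 N' where S: "A = S \<union> N0" "N0 \<subseteq> N'" "N' \<in> null_sets \<mu>" "S \<in> sets \<mu>"
    using A unfolding \<mu>_def by (rule sets_completionE)
  have T: "T s \<in> measurable \<mu> \<mu>" "distr \<mu> \<mu> (T s) = \<mu>" if s: "s \<in> Pow {1..n}" for s
  proof -
    have s': "swap n s i \<in> {1..2*n}" if "i \<in> {1..2*n}" for i
      using s that swap_inj_on(2)[of s n] by auto
    show "T s \<in> measurable \<mu> \<mu>"
      unfolding T_def \<mu>_def by (intro measurable_restrict measurable_component_singleton s')
    show "distr \<mu> \<mu> (T s) = \<mu>"
      unfolding T_def \<mu>_def using distr_PiM_reindex[of "{1..2*n}" "\<lambda>_. P" "swap n s" "{1..2*n}"] P s swap_inj_on[of s n]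
      by auto
  qed
  have "2 ^ n * emeasure \<mu> S = (\<Sum>s\<in>Pow {1..n}. emeasure \<mu> S)"
    by (simp add: card_Pow)
  also have "\<dots> = (\<Sum>s\<in>Pow {1..n}. \<integral>\<^sup>+z. indicator S (T s z) \<partial>\<mu>)"
  proof (rule sum.cong)
    fix s assume s: "s \<in> Pow {1..n}"
    have "emeasure \<mu> S = emeasure (distr \<mu> \<mu> (T s)) S" by (simp add: T(2)[OF s])
    also have "\<dots> = (\<integral>\<^sup>+z. indicator S z \<partial>distr \<mu> \<mu> (T s))" using S(4) by simp
    also have "\<dots> = (\<integral>\<^sup>+z. indicator S (T s z) \<partial>\<mu>)"
      using T(1)[OF s] S(4) by (intro nn_integral_distr) auto
    finally show "emeasure \<mu> S = (\<integral>\<^sup>+z. indicator S (T s z) \<partial>\<mu>)" .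
  qed simp
  also have "\<dots> = (\<integral>\<^sup>+z. (\<Sum>s\<in>Pow {1..n}. indicator S (T s z)) \<partial>\<mu>)"
    using T(1) S(4) by (subst nn_integral_sum) (auto intro: measurable_compose)
  also have "\<dots> \<le> (\<integral>\<^sup>+z. ennreal (2 ^ n * \<beta>) \<partial>\<mu>)"
  proof (rule nn_integral_mono)
    fix z assume z: "z \<in> space \<mu>"
    have "(\<Sum>s\<in>Pow {1..n}. indicator S (T s z)) = of_nat (card {s \<in> Pow {1..n}. T s z \<in> S})"
      by (simp add: indicator_def Collect_conj_eq Pow_def)
    also have "\<dots> = ennreal (real (card {s \<in> Pow {1..n}. T s z \<in> S}))"
      by (simp add: ennreal_of_nat_eq_real_of_nat)
    also have "\<dots> \<le> ennreal (real (card {s \<in> Pow {1..n}. T s z \<in> A}))"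
      using S(1) by (intro ennreal_leI of_nat_mono card_mono) auto
    also have "\<dots> \<le> ennreal (2 ^ n * \<beta>)"
      using count[of z] z by (intro ennreal_leI) (simp add: \<mu>_def T_def)
    finally show "(\<Sum>s\<in>Pow {1..n}. indicator S (T s z)) \<le> ennreal (2 ^ n * \<beta>)" .
  qed
  also have "\<dots> = ennreal (2 ^ n * \<beta>)" by (simp add: emeasure_space_1)
  finally have "ennreal (2 ^ n * measure \<mu> S) \<le> ennreal (2 ^ n * \<beta>)"
    by (simp add: emeasure_eq_measure ennreal_mult' flip: ennreal_power ennreal_numeral)
  then have "measure \<mu> S \<le> \<beta>"
    using \<beta> by (simp add: ennreal_le_iff)
  moreover have "measure \<mu> (S \<union> N') = measure \<mu> S"
    using S(3,4) by (simp add: measure_Un_null_set)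
  ultimately show ?thesis
    unfolding \<mu>_def[symmetric] using S by (intro bexI[of _ "S \<union> N'"]) auto
qed

text \<open>Fubini and Markov: outside of \<open>E\<close> at least half of the ghost samples lead into \<open>B\<close>.\<close>

lemma ghost_sample_sections:
  fixes n :: nat
  assumes P: "prob_space P" and B: "B \<in> sets (PiM {1..2*n} (\<lambda>_. P))"
  defines "J \<equiv> {n+1..2*n}"
  shows "\<exists>E \<in> sets (PiM {1..n} (\<lambda>_. P)).
     1 - 2 * measure (PiM {1..2*n} (\<lambda>_. P)) B \<le> measure (PiM {1..n} (\<lambda>_. P)) E \<and>
     (\<forall>\<omega>\<in>E. measure (PiM J (\<lambda>_. P)) {y \<in> space (PiM J (\<lambda>_. P)). merge {1..n} J (\<omega>, y) \<in> B} < 1/2)"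
proof -
  define \<mu> where "\<mu> = PiM {1..2*n} (\<lambda>_. P)"
  define \<mu>1 where "\<mu>1 = PiM {1..n} (\<lambda>_. P)"
  define \<mu>2 where "\<mu>2 = PiM J (\<lambda>_. P)"
  interpret P: prob_space P by fact
  interpret \<mu>: prob_space \<mu> unfolding \<mu>_def by (intro prob_space_PiM P)
  interpret \<mu>1: prob_space \<mu>1 unfolding \<mu>1_def by (intro prob_space_PiM P)
  interpret \<mu>2: prob_space \<mu>2 unfolding \<mu>2_def by (intro prob_space_PiM P)
  interpret PP: product_sigma_finite "\<lambda>_::nat. P" by standard
  have U: "{1..n} \<union> J = {1..2*n}" by (auto simp: J_def)
  have D: "{1..n} \<inter> J = {}" by (auto simp: J_def)
  have mer[measurable]: "merge {1..n} J \<in> measurable (\<mu>1 \<Otimes>\<^sub>M \<mu>2) \<mu>"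
    unfolding \<mu>1_def \<mu>2_def \<mu>_def U[symmetric] by (rule measurable_merge)
  have B'[measurable]: "B \<in> sets \<mu>" using B by (simp add: \<mu>_def)
  define q where "q \<omega> = (\<integral>\<^sup>+y. indicator B (merge {1..n} J (\<omega>, y)) \<partial>\<mu>2)" for \<omega>
  have [measurable]: "q \<in> borel_measurable \<mu>1" unfolding q_def by measurable
  have q: "q \<omega> = emeasure \<mu>2 {y \<in> space \<mu>2. merge {1..n} J (\<omega>, y) \<in> B}" if "\<omega> \<in> space \<mu>1" for \<omega>
  proof -
    have "{y \<in> space \<mu>2. merge {1..n} J (\<omega>, y) \<in> B} \<in> sets \<mu>2" using that by measurable
    then have "emeasure \<mu>2 {y \<in> space \<mu>2. merge {1..n} J (\<omega>, y) \<in> B}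
       = (\<integral>\<^sup>+y. indicator {y \<in> space \<mu>2. merge {1..n} J (\<omega>, y) \<in> B} y \<partial>\<mu>2)" by simp
    also have "\<dots> = q \<omega>" unfolding q_def by (intro nn_integral_cong) (auto simp: indicator_def)
    finally show ?thesis ..
  qed
  have BU: "indicator B \<in> borel_measurable (PiM ({1..n} \<union> J) (\<lambda>_. P))"
    unfolding U using B by simp
  have fold: "emeasure \<mu> B = (\<integral>\<^sup>+\<omega>. q \<omega> \<partial>\<mu>1)"
  proof -
    have "emeasure \<mu> B = (\<integral>\<^sup>+z. indicator B z \<partial>\<mu>)" by simp
    also have "\<dots> = (\<integral>\<^sup>+\<omega>. q \<omega> \<partial>\<mu>1)"
      unfolding q_def \<mu>_def \<mu>1_def \<mu>2_def U[symmetric]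
      by (rule PP.product_nn_integral_fold[OF D _ _ BU]) (simp_all add: J_def)
    finally show ?thesis .
  qed
  define E where "E = {\<omega> \<in> space \<mu>1. q \<omega> < 1/2}"
  have E: "E \<in> sets \<mu>1" unfolding E_def by measurable
  have "emeasure \<mu>1 (space \<mu>1 - E) \<le> 2 * (\<integral>\<^sup>+\<omega>. q \<omega> \<partial>\<mu>1)"
  proof -
    have "emeasure \<mu>1 (space \<mu>1 - E) = (\<integral>\<^sup>+\<omega>. indicator (space \<mu>1 - E) \<omega> \<partial>\<mu>1)"
      using E by simp
    also have "\<dots> \<le> (\<integral>\<^sup>+\<omega>. 2 * q \<omega> \<partial>\<mu>1)"
    proof (rule nn_integral_mono)
      fix \<omega> assume "\<omega> \<in> space \<mu>1"
      have "1 \<le> 2 * q \<omega>" if "1/2 \<le> q \<omega>"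
      proof -
        have "(2::ennreal) * (1/2) \<le> 2 * q \<omega>" using that by (rule mult_left_mono) simp
        then show ?thesis by (simp add: ennreal_times_divide)
      qed
      then show "indicator (space \<mu>1 - E) \<omega> \<le> 2 * q \<omega>"
        by (auto simp: E_def indicator_def not_less)
    qed
    also have "\<dots> = 2 * (\<integral>\<^sup>+\<omega>. q \<omega> \<partial>\<mu>1)" by (intro nn_integral_cmult) auto
    finally show ?thesis .
  qed
  then have "ennreal (measure \<mu>1 (space \<mu>1 - E)) \<le> ennreal (2 * measure \<mu> B)"
    by (simp add: fold[symmetric] \<mu>.emeasure_eq_measure \<mu>1.emeasure_eq_measure ennreal_mult')
  then have "measure \<mu>1 (space \<mu>1 - E) \<le> 2 * measure \<mu> B"
    by (simp add: ennreal_le_iff)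
  then have "1 - 2 * measure \<mu> B \<le> measure \<mu>1 E"
    using E by (simp add: \<mu>1.prob_compl)
  moreover have "measure \<mu>2 {y \<in> space \<mu>2. merge {1..n} J (\<omega>, y) \<in> B} < 1/2" if "\<omega> \<in> E" for \<omega>
  proof -
    have "ennreal (1/2) = ennreal 1 / ennreal 2" by (rule divide_ennreal[symmetric]) auto
    then have "ennreal (measure \<mu>2 {y \<in> space \<mu>2. merge {1..n} J (\<omega>, y) \<in> B}) < ennreal (1/2)"
      using that q[of \<omega>] by (simp add: E_def \<mu>2.emeasure_eq_measure)
    then show ?thesis by (rule ennreal_less_iff[THEN iffD1, rotated]) simp
  qed
  ultimately show ?thesis using E by (auto simp: \<mu>_def \<mu>1_def \<mu>2_def)
qed

text \<open>Chernoff's bound with base \<open>1/2\<close>: the expectation of \<open>2\<^sup>-\<^sup>S\<close> for the count \<open>S\<close> is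
  \<open>(1 - p/2)\<^sup>n \<le> exp (- n p / 2)\<close>, while \<open>2\<^sup>-\<^sup>S \<ge> exp (- n p / 4)\<close> if \<open>S \<le> n p / 4\<close>. So the lower tail has
  probability at most \<open>exp (- n p / 4) \<le> 1 / e < 1/2\<close>.\<close>

lemma count_lower_tail:
  fixes J :: "nat set"
  assumes P: "prob_space P" and D: "D \<in> sets P" and J: "finite J"
    and large: "4 \<le> real (card J) * measure P D"
  shows "{y \<in> space (PiM J (\<lambda>_. P)). real (card J) * measure P D / 4 \<le> real (card {i \<in> J. y i \<in> D})}
           \<in> sets (PiM J (\<lambda>_. P))" (is "?A \<in> _")
    and "1/2 < measure (PiM J (\<lambda>_. P)) {y \<in> space (PiM J (\<lambda>_. P)).
           real (card J) * measure P D / 4 \<le> real (card {i \<in> J. y i \<in> D})}"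
proof -
  define p where "p = measure P D"
  define \<mu> where "\<mu> = PiM J (\<lambda>_. P)"
  interpret P: prob_space P by fact
  interpret \<mu>: prob_space \<mu> unfolding \<mu>_def by (intro prob_space_PiM P)
  interpret PP: product_sigma_finite "\<lambda>_::nat. P" by standard
  note D[measurable]
  have cnt: "real (card {i \<in> J. y i \<in> D}) = (\<Sum>i\<in>J. indicator D (y i))" for y
    using J by (simp add: indicator_def Collect_conj_eq)
  have m: "(\<lambda>y. \<Sum>i\<in>J. indicator D (y i) :: real) \<in> borel_measurable \<mu>"
    unfolding \<mu>_def by measurable
  have A: "?A \<in> sets \<mu>" using m unfolding cnt \<mu>_def[symmetric] by measurable
  then show "?A \<in> sets (PiM J (\<lambda>_. P))" by (simp add: \<mu>_def)
  define f where "f x = 1 - indicator D x / (2::real)" for x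
  have f01: "0 < f x" "f x \<le> 1" for x by (auto simp: f_def indicator_def)
  have fm[measurable]: "f \<in> borel_measurable P" unfolding f_def by measurable
  have fi: "integrable P f"
    using f01 by (intro P.integrable_const_bound[where B = 1]) (auto simp: less_imp_le abs_of_pos)
  define F where "F y = (\<Prod>i\<in>J. f (y i))" for y
  have F: "F y = (1/2) ^ card {i \<in> J. y i \<in> D}" for y
  proof -
    have "F y = (\<Prod>i\<in>J. if y i \<in> D then 1/2 else 1)"
      unfolding F_def f_def by (intro prod.cong) (auto simp: indicator_def)
    then show ?thesis using J by (simp add: prod.If_cases Collect_conj_eq)
  qed
  have Fm: "F \<in> borel_measurable \<mu>" unfolding F_def \<mu>_def by measurable
  have Fi: "integrable \<mu> F"
    using Fm by (intro \<mu>.integrable_const_bound[where B = 1]) (auto simp: F power_le_one)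
  have "(\<integral>y. F y \<partial>\<mu>) = (\<integral>x. f x \<partial>P) ^ card J"
    unfolding F_def \<mu>_def using J fi by (subst PP.product_integral_prod) auto
  also have "(\<integral>x. f x \<partial>P) = 1 - p / 2"
  proof -
    have "integrable P (indicat_real D)"
      using D by (intro integrable_real_indicator) (auto simp: P.emeasure_eq_measure)
    then show ?thesis unfolding f_def p_def using D by (simp add: P.prob_space)
  qed
  also have "(1 - p / 2) ^ card J \<le> exp (- (p / 2)) ^ card J"
    using exp_ge_add_one_self[of "- (p/2)"] P.prob_le_1[of D] by (intro power_mono) (linarith, unfold p_def, linarith)
  also have "\<dots> = exp (- (real (card J) * p / 2))" by (simp flip: exp_of_nat_mult)
  finally have EF: "(\<integral>y. F y \<partial>\<mu>) \<le> exp (- (real (card J) * p / 2))" .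
  define c where "c = exp (- (real (card J) * p / 4))"
  have c: "0 < c" by (simp add: c_def)
  have "measure \<mu> (space \<mu> - ?A) * c \<le> (\<integral>y. F y \<partial>\<mu>)"
  proof -
    have "measure \<mu> (space \<mu> - ?A) * c = (\<integral>y. indicator (space \<mu> - ?A) y * c \<partial>\<mu>)"
      using A by simp
    also have "\<dots> \<le> (\<integral>y. F y \<partial>\<mu>)"
    proof (rule integral_mono)
      show "integrable \<mu> (\<lambda>y. indicator (space \<mu> - ?A) y * c)"
        using sets.compl_sets[OF A]
        by (intro integrable_mult_left integrable_real_indicator) (auto simp: \<mu>.emeasure_eq_measure)
      fix y assume y: "y \<in> space \<mu>"
      have "c \<le> F y" if "y \<notin> ?A"
      proof -
        define k where "k = card {i \<in> J. y i \<in> D}"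
        have k: "real k \<le> real (card J) * p / 4" using that y by (auto simp: \<mu>_def k_def p_def)
        have "c \<le> exp (- real k)" using k by (simp add: c_def)
        also have "\<dots> = exp (-1) ^ k" by (simp flip: exp_of_nat_mult)
        also have "\<dots> \<le> (1/2) ^ k"
          using exp_ge_add_one_self[of 1] by (intro power_mono) (auto simp: exp_minus field_simps)
        finally show ?thesis by (simp add: F k_def)
      qed
      moreover have "0 \<le> F y" by (simp add: F)
      ultimately show "indicator (space \<mu> - ?A) y * c \<le> F y" by (auto simp: indicator_def)
    qed (rule Fi)
    finally show ?thesis .
  qed
  also note EF
  also have "exp (- (real (card J) * p / 2)) = c * c"
    by (simp add: c_def flip: exp_add)
  finally have "measure \<mu> (space \<mu> - ?A) \<le> c" using c by simp
  also have "c \<le> exp (-1)" using large by (simp add: c_def p_def)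
  also have "exp (-1) < (1/2 :: real)"
  proof -
    have "2 < exp (1::real)" using exp_lower_Taylor_quadratic[of "1::real"] by simp
    then show ?thesis by (simp add: exp_minus field_simps)
  qed
  finally have "measure \<mu> (space \<mu> - ?A) < 1/2" .
  then show "1/2 < measure (PiM J (\<lambda>_. P)) ?A"
    using A by (simp add: \<mu>.prob_compl flip: \<mu>_def)
qed

section \<open>Unbalanced double samples\<close>

text \<open>Membership of a labelled point in the set \<open>B\<close> of the introduction, with thresholds \<open>d\<close> for the margin and
  \<open>g\<close> for the variance estimate.\<close>

definition risky :: "nat \<Rightarrow> nat \<Rightarrow> (nat \<Rightarrow> real) \<Rightarrow> real \<Rightarrow> (nat \<times> nat \<times> bool \<Rightarrow> real) \<Rightarrow> real \<Rightarrow> real \<Rightarrow> bool" where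
  "risky m N \<alpha> y v d g \<longleftrightarrow> y * stratified_mean m N \<alpha> v \<le> d \<or> g \<le> stratified_var m N \<alpha> v"

definition slots :: "nat \<Rightarrow> nat \<Rightarrow> (nat \<times> nat \<times> bool) set" where
  "slots m N = {1..m} \<times> {1..N} \<times> UNIV"

definition weight_grid :: "nat \<Rightarrow> nat \<Rightarrow> (nat \<Rightarrow> nat) set" where
  "weight_grid m G = {a \<in> PiE {1..m} (\<lambda>_. {0..G}). (\<Sum>k=1..m. a k) \<le> G}"

definition value_grid :: "nat \<Rightarrow> real set" where
  "value_grid G = (\<lambda>k::int. of_int k / real G) ` {- int G..int G}"

text \<open>The first half counts a larger set than \<open>B\<close>, which has thresholds \<open>\<delta> / 2\<close> and \<open>2\<gamma>\<close>, and the second half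
  counts a smaller one. Therefore the condition still yields an excess of \<open>B\<close> in the second half after the
  values have been perturbed slightly.\<close>

definition unbalanced ::
  "nat \<Rightarrow> nat \<Rightarrow> nat \<Rightarrow> nat \<Rightarrow> real \<Rightarrow> real \<Rightarrow> real \<Rightarrow>
   (nat \<Rightarrow> nat) \<times> (nat \<times> nat \<times> bool \<Rightarrow> nat \<Rightarrow> real) \<Rightarrow> (nat \<Rightarrow> real) \<Rightarrow> bool" where
  "unbalanced n m N G \<delta> \<gamma> b = (\<lambda>(a, v) y.
     2 * real (card {i \<in> {1..n}. risky m N (\<lambda>k. real (a k) / real G) (y i) (\<lambda>j. v j i) (3/5 * \<delta>) (8/5 * \<gamma>)}) + b
      \<le> real (card {i \<in> {n+1..2*n}. risky m N (\<lambda>k. real (a k) / real G) (y i) (\<lambda>j. v j i) (2/5 * \<delta>) (12/5 * \<gamma>)}))"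

text \<open>The functions of \<open>H\<close> enter only through grid values close to theirs. This leaves finitely
  many events about \<open>H\<close>, all of them of the form covered by \<open>sample_measurable\<close>.\<close>

definition bad_samples ::
  "'x measure \<Rightarrow> ('x \<Rightarrow> real) set \<Rightarrow> nat \<Rightarrow> nat \<Rightarrow> nat \<Rightarrow> nat \<Rightarrow> real \<Rightarrow> real \<Rightarrow> real \<Rightarrow> (nat \<Rightarrow> 'x \<times> real) set" where
  "bad_samples M H n m N G \<delta> \<gamma> b = {z \<in> PiE {1..2*n} (\<lambda>_. space M \<times> {-1, 1}).
     \<exists>\<theta> \<in> weight_grid m G \<times> PiE (slots m N) (\<lambda>_. PiE {1..2*n} (\<lambda>_. value_grid G)).
       (\<forall>j\<in>slots m N. \<exists>h\<in>H. \<forall>i\<in>{1..2*n}. \<bar>h (fst (z i)) - snd \<theta> j i\<bar> < 1 / real G) \<and>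
       unbalanced n m N G \<delta> \<gamma> b \<theta> (\<lambda>i\<in>{1..2*n}. snd (z i))}"

lemma finite_slots: "finite (slots m N)" by (simp add: slots_def)

lemma card_slots: "card (slots m N) = 2 * m * N"
  by (simp add: slots_def card_cartesian_product card_UNIV_bool)

lemma finite_weight_grid: "finite (weight_grid m G)"
  unfolding weight_grid_def by (rule finite_subset[OF _ finite_PiE[of "{1..m}" "\<lambda>_. {0..G}"]]) auto

lemma card_weight_grid: "card (weight_grid m G) \<le> (G + 1) ^ m"
proof -
  have "card (weight_grid m G) \<le> card (PiE {1..m} (\<lambda>_. {0..G}))"
    unfolding weight_grid_def by (intro card_mono finite_PiE) auto
  then show ?thesis by (simp add: card_PiE)
qed

lemma value_grid_bounded: "r \<in> value_grid G \<Longrightarrow> \<bar>r\<bar> \<le> 1"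
  by (auto simp: value_grid_def abs_divide field_simps split: if_splits)
     (cases "G = 0"; auto simp: field_simps abs_le_iff)+

section \<open>Measurability of unbalanced double samples\<close>

lemma vimage_sets_completion:
  assumes f: "f \<in> measurable M N" and d: "distr M N f = N" and A: "A \<in> sets (completion N)"
  shows "f -` A \<inter> space M \<in> sets (completion M)"
proof -
  obtain S N0 N' where S: "A = S \<union> N0" "N0 \<subseteq> N'" "N' \<in> null_sets N" "S \<in> sets N"
    using A by (rule sets_completionE)
  have "f -` N' \<inter> space M \<in> null_sets M"
    using S(3) null_sets_distr_iff[OF f, of N'] by (simp add: d)
  then show ?thesis
    using S f by (intro sets_completionI[of _ "f -` S \<inter> space M" "f -` N0 \<inter> space M" "f -` N' \<inter> space M"])
      (auto intro: measurable_sets)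
qed

text \<open>Labels take two values, so the condition \<open>R\<close> on the labels is a finite union of measurable
  events, whatever \<open>R\<close> is. The condition on \<open>H\<close> concerns the unlabelled points, and their
  events are pulled back along the projection.\<close>

lemma sample_event_measurable:
  fixes v :: "'t \<Rightarrow> 'j \<Rightarrow> nat \<Rightarrow> real"
  assumes P: "prob_space P" and sP: "sets P = sets (M \<Otimes>\<^sub>M count_space {-1, 1 :: real})"
    and H: "sample_measurable (distr P M fst) H"
    and fin: "finite \<Theta>" "finite J"
  shows "{z \<in> space (PiM {1..N} (\<lambda>_. P)). \<exists>\<theta>\<in>\<Theta>.
            (\<forall>j\<in>J. \<exists>h\<in>H. \<forall>i\<in>{1..N}. \<bar>h (fst (z i)) - v \<theta> j i\<bar> < \<epsilon>) \<and>
            R \<theta> (\<lambda>i\<in>{1..N}. snd (z i))} \<in> sets (completion (PiM {1..N} (\<lambda>_. P)))" (is "?E \<in> _")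
proof -
  define D where "D = distr P M fst"
  define \<mu> where "\<mu> = PiM {1..N} (\<lambda>_. P)"
  interpret P: prob_space P by fact
  have fst_m[measurable]: "fst \<in> measurable P M"
    using measurable_fst[of M "count_space {-1, 1 :: real}"] measurable_cong_sets[OF sP refl] by blast
  have snd_m: "snd \<in> measurable P (count_space {-1, 1 :: real})"
    using measurable_snd[of M "count_space {-1, 1 :: real}"] measurable_cong_sets[OF sP refl] by blast
  have spP: "space P = space M \<times> {-1, 1}"
    using sets_eq_imp_space_eq[OF sP] by (simp add: space_pair_measure)
  have pD: "prob_space D" unfolding D_def by (rule P.prob_space_distr) measurable
  have dist: "distr \<mu> (PiM {1..N} (\<lambda>_. D)) (compose {1..N} fst) = PiM {1..N} (\<lambda>_. D)"
    unfolding \<mu>_def using distr_PiM_finite_prob_space'[of "{1..N}" "\<lambda>_. P" "\<lambda>_. D" fst] P pD fst_m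
    by (simp add: D_def cong: distr_cong)
  have cm: "compose {1..N} fst \<in> measurable \<mu> (PiM {1..N} (\<lambda>_. D))"
    unfolding \<mu>_def compose_def D_def
    by (intro measurable_restrict measurable_compose[OF measurable_component_singleton]) auto
  have lab: "{z \<in> space \<mu>. Q (\<lambda>i\<in>{1..N}. snd (z i))} \<in> sets \<mu>" for Q
  proof -
    have "{z \<in> space \<mu>. Q (\<lambda>i\<in>{1..N}. snd (z i))}
        = (\<Union>y\<in>{y \<in> PiE {1..N} (\<lambda>_. {-1, 1}). Q y}. {z \<in> space \<mu>. \<forall>i\<in>{1..N}. snd (z i) = y i})"
      (is "?L = ?R")
    proof (intro equalityI subsetI)
      fix z assume z: "z \<in> ?L"
      then have "(\<lambda>i\<in>{1..N}. snd (z i)) \<in> PiE {1..N} (\<lambda>_. {-1, 1})"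
        by (auto simp: \<mu>_def space_PiM spP PiE_iff mem_Times_iff)
      then show "z \<in> ?R" using z by (intro UN_I[of "\<lambda>i\<in>{1..N}. snd (z i)"]) auto
    next
      fix z assume "z \<in> ?R"
      then obtain y where y: "y \<in> PiE {1..N} (\<lambda>_. {-1, 1})" "Q y" "z \<in> space \<mu>" "\<forall>i\<in>{1..N}. snd (z i) = y i"
        by auto
      then have "(\<lambda>i\<in>{1..N}. snd (z i)) = y"
        by (auto simp: fun_eq_iff PiE_iff extensional_def)
      then show "z \<in> ?L" using y by simp
    qed
    also have "\<dots> \<in> sets \<mu>"
    proof (rule sets.finite_UN)
      show "finite {y \<in> PiE {1..N} (\<lambda>_. {-1, 1 :: real}). Q y}"
        by (intro finite_subset[OF _ finite_PiE[of "{1..N}" "\<lambda>_. {-1, 1 :: real}"]]) auto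
      fix y assume y: "y \<in> {y \<in> PiE {1..N} (\<lambda>_. {-1, 1 :: real}). Q y}"
      have "{z \<in> space \<mu>. snd (z i) = y i} \<in> sets \<mu>" if i: "i \<in> {1..N}" for i
      proof -
        have "(\<lambda>z. snd (z i)) \<in> measurable \<mu> (count_space {-1, 1})"
          unfolding \<mu>_def using i by (intro measurable_compose[OF _ snd_m] measurable_component_singleton)
        then have "(\<lambda>z. snd (z i)) -` {y i} \<inter> space \<mu> \<in> sets \<mu>"
          using y i by (intro measurable_sets[where A = "count_space {-1, 1}"]) (auto simp: PiE_iff)
        then show ?thesis by (simp add: vimage_def Int_def conj_commute)
      qed
      then show "{z \<in> space \<mu>. \<forall>i\<in>{1..N}. snd (z i) = y i} \<in> sets \<mu>"
        by (intro sets.sets_Collect_finite_All) auto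
    qed
    finally show ?thesis .
  qed
  have box: "{z \<in> space \<mu>. \<exists>h\<in>H. \<forall>i\<in>{1..N}. \<bar>h (fst (z i)) - a i\<bar> < \<epsilon>} \<in> sets (completion \<mu>)" for a
  proof -
    define A where "A = {x \<in> space (PiM {1..N} (\<lambda>_. D)). \<exists>h\<in>H. \<forall>i\<in>{1..N}. a i - \<epsilon> < h (x i) \<and> h (x i) < a i + \<epsilon>}"
    have "A \<in> sets (completion (PiM {1..N} (\<lambda>_. D)))"
      unfolding A_def D_def using H[unfolded sample_measurable_def, rule_format, of N "\<lambda>i. a i - \<epsilon>" "\<lambda>i. a i + \<epsilon>"] .
    then have "compose {1..N} fst -` A \<inter> space \<mu> \<in> sets (completion \<mu>)"
      by (rule vimage_sets_completion[OF cm dist])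
    also have "compose {1..N} fst -` A \<inter> space \<mu> = {z \<in> space \<mu>. \<exists>h\<in>H. \<forall>i\<in>{1..N}. \<bar>h (fst (z i)) - a i\<bar> < \<epsilon>}"
    proof -
      have "\<bar>r - a i\<bar> < \<epsilon> \<longleftrightarrow> a i - \<epsilon> < r \<and> r < a i + \<epsilon>" for r i by arith
      then show ?thesis using measurable_space[OF cm] by (auto simp: A_def compose_def)
    qed
    finally show ?thesis .
  qed
  have "?E = (\<Union>\<theta>\<in>\<Theta>. {z \<in> space \<mu>. \<forall>j\<in>J. \<exists>h\<in>H. \<forall>i\<in>{1..N}. \<bar>h (fst (z i)) - v \<theta> j i\<bar> < \<epsilon>} \<inter>
       {z \<in> space \<mu>. R \<theta> (\<lambda>i\<in>{1..N}. snd (z i))})"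
    by (auto simp: \<mu>_def)
  also have "\<dots> \<in> sets (completion \<mu>)"
  proof (intro sets.finite_UN fin sets.Int sets_completionI_sets[OF lab])
    fix \<theta>
    have "{z \<in> space (completion \<mu>). \<forall>j\<in>J. \<exists>h\<in>H. \<forall>i\<in>{1..N}. \<bar>h (fst (z i)) - v \<theta> j i\<bar> < \<epsilon>} \<in> sets (completion \<mu>)"
      using box fin(2) by (intro sets.sets_Collect_finite_All) auto
    then show "{z \<in> space \<mu>. \<forall>j\<in>J. \<exists>h\<in>H. \<forall>i\<in>{1..N}. \<bar>h (fst (z i)) - v \<theta> j i\<bar> < \<epsilon>} \<in> sets (completion \<mu>)"
      by simp
  qed
  finally show ?thesis by (simp add: \<mu>_def)
qed

lemma bad_samples_measurable:
  assumes P: "prob_space P" and sP: "sets P = sets (M \<Otimes>\<^sub>M count_space {-1, 1 :: real})"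
    and H: "sample_measurable (distr P M fst) H"
  shows "bad_samples M H n m N G \<delta> \<gamma> b \<in> sets (completion (PiM {1..2*n} (\<lambda>_. P)))"
proof -
  have "space P = space M \<times> {-1, 1}"
    using sets_eq_imp_space_eq[OF sP] by (simp add: space_pair_measure)
  then have spc: "space (PiM {1..2*n} (\<lambda>_. P)) = PiE {1..2*n} (\<lambda>_. space M \<times> {-1, 1})"
    by (simp add: space_PiM)
  have fin: "finite (weight_grid m G \<times> PiE (slots m N) (\<lambda>_. PiE {1..2*n} (\<lambda>_. value_grid G)))"
    by (intro finite_cartesian_product finite_weight_grid finite_PiE finite_slots)
       (auto simp: value_grid_def)
  show ?thesis
    using sample_event_measurable[where N = "2*n" and v = snd and R = "unbalanced n m N G \<delta> \<gamma> b"
        and \<epsilon> = "1 / real G", OF P sP H fin finite_slots]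
    unfolding bad_samples_def spc .
qed

section \<open>Few double samples are unbalanced\<close>

text \<open>The error \<open>\<delta> / 50\<close> is small enough to separate the consecutive margin thresholds \<open>\<delta> / 3\<close>, \<open>2\<delta> / 5\<close>, \<open>\<delta> / 2\<close>,
  \<open>3\<delta> / 5\<close> and \<open>2\<delta> / 3\<close>, and \<open>4\<gamma> / 50\<close> separates those for the variance.\<close>

lemma labelled_stratified_perturbation:
  assumes N: "0 < N" and e: "0 \<le> e" "0 \<le> d" and close: "real m * e + d \<le> \<delta> / 50" and \<delta>: "\<delta> \<le> \<gamma>"
    and \<beta>: "\<And>k. k \<in> {1..m} \<Longrightarrow> 0 \<le> \<beta> k" "(\<Sum>k=1..m. \<beta> k) \<le> 1"
    and \<alpha>: "\<And>k. k \<in> {1..m} \<Longrightarrow> 0 \<le> \<alpha> k \<and> \<alpha> k \<le> 1" "\<And>k. k \<in> {1..m} \<Longrightarrow> \<bar>\<alpha> k - \<beta> k\<bar> \<le> e"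
    and vw: "\<And>j. j \<in> slots m N \<Longrightarrow> \<bar>v j\<bar> \<le> 1 \<and> \<bar>w j\<bar> \<le> 1 \<and> \<bar>v j - w j\<bar> \<le> d"
    and y: "y \<in> {-1, 1 :: real}"
  shows "\<bar>y * stratified_mean m N \<alpha> v - y * stratified_mean m N \<beta> w\<bar> \<le> \<delta> / 50"
    and "\<bar>stratified_var m N \<alpha> v - stratified_var m N \<beta> w\<bar> \<le> 4 * \<gamma> / 50"
proof -
  have "\<bar>stratified_mean m N \<alpha> v - stratified_mean m N \<beta> w\<bar> \<le> real m * e + d"
    by (rule stratified_perturbation) (use assms in \<open>auto simp: slots_def\<close>)
  then show "\<bar>y * stratified_mean m N \<alpha> v - y * stratified_mean m N \<beta> w\<bar> \<le> \<delta> / 50"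
    using y close by (auto simp: abs_minus_commute)
  have "\<bar>stratified_var m N \<alpha> v - stratified_var m N \<beta> w\<bar> \<le> 4 * (real m * e + d)"
    by (rule stratified_perturbation) (use assms in \<open>auto simp: slots_def\<close>)
  then show "\<bar>stratified_var m N \<alpha> v - stratified_var m N \<beta> w\<bar> \<le> 4 * \<gamma> / 50"
    using mult_left_mono[of "real m * e + d" "\<gamma> / 50" 4] close \<delta> by simp
qed

lemma weight_gridD:
  assumes "a \<in> weight_grid m G" "0 < G"
  shows "k \<in> {1..m} \<Longrightarrow> 0 \<le> real (a k) / real G \<and> real (a k) / real G \<le> 1"
    and "(\<Sum>k=1..m. real (a k) / real G) \<le> 1"
proof -
  show "k \<in> {1..m} \<Longrightarrow> 0 \<le> real (a k) / real G \<and> real (a k) / real G \<le> 1"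
    using assms by (auto simp: weight_grid_def PiE_iff)
  have "real (\<Sum>k=1..m. a k) \<le> real G" using assms(1) unfolding weight_grid_def of_nat_le_iff by blast
  then show "(\<Sum>k=1..m. real (a k) / real G) \<le> 1"
    using assms(2) by (simp add: sum_divide_distrib[symmetric])
qed

text \<open>The union bound over the sets \<open>B\<close>. For a fixed double sample, each bad arrangement comes with
  grid values near functions of \<open>H\<close>; replacing these by members of the net turns
  both pairs of thresholds into \<open>\<delta> / 2\<close> and \<open>2\<gamma>\<close>, so the arrangement is unbalanced for one
  of the sets \<open>B\<close> attached to the net. The net does not depend on the arrangement because swaps only permute
  the points.\<close>

lemma swap_count_bad_samples:
  fixes z :: "nat \<Rightarrow> 'x \<times> real"
  assumes z: "z \<in> PiE {1..2*n} (\<lambda>_. space M \<times> {-1, 1})"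
    and H: "\<And>h x. h \<in> H \<Longrightarrow> x \<in> space M \<Longrightarrow> \<bar>h x\<bar> \<le> 1"
    and F: "finite F" "F \<subseteq> H"
    and net: "\<And>h. h \<in> H \<Longrightarrow> \<exists>g\<in>F. \<forall>i\<in>{1..2*n}. \<bar>g (fst (z i)) - h (fst (z i))\<bar> \<le> d"
    and N: "0 < N" and G: "0 < G" and d: "0 \<le> d" "d + 1 / real G \<le> \<delta> / 50" and \<delta>: "0 < \<delta>" "\<delta> \<le> \<gamma>"
  shows "real (card {s \<in> Pow {1..n}. (\<lambda>i\<in>{1..2*n}. z (swap n s i)) \<in> bad_samples M H n m N G \<delta> \<gamma> b})
     \<le> 2 ^ n * (real (G + 1) ^ m * real (card F) ^ (2 * m * N) * (3/2) powr (- b))"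
proof -
  define \<Gamma> where "\<Gamma> = weight_grid m G \<times> PiE (slots m N) (\<lambda>_. F)"
  define B where "B = (\<lambda>(a :: nat \<Rightarrow> nat, g). {i \<in> {1..2*n}. risky m N (\<lambda>k. real (a k) / real G) (snd (z i))
       (\<lambda>j. (g j :: 'x \<Rightarrow> real) (fst (z i))) (\<delta> / 2) (2 * \<gamma>)})"
  define S where "S \<theta> = {s \<in> Pow {1..n}. 2 * real (card {i \<in> {1..n}. swap n s i \<in> B \<theta>}) + b
                 \<le> real (card {i \<in> {n+1..2*n}. swap n s i \<in> B \<theta>})}" for \<theta>
  have fin: "finite \<Gamma>"
    unfolding \<Gamma>_def by (intro finite_cartesian_product finite_weight_grid finite_PiE finite_slots F)
  have finS: "finite (S \<theta>)" for \<theta> unfolding S_def by simp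
  have sub: "{s \<in> Pow {1..n}. (\<lambda>i\<in>{1..2*n}. z (swap n s i)) \<in> bad_samples M H n m N G \<delta> \<gamma> b} \<subseteq> (\<Union>\<theta>\<in>\<Gamma>. S \<theta>)"
  proof
    fix s assume "s \<in> {s \<in> Pow {1..n}. (\<lambda>i\<in>{1..2*n}. z (swap n s i)) \<in> bad_samples M H n m N G \<delta> \<gamma> b}"
    then have s: "s \<subseteq> {1..n}" and bad: "(\<lambda>i\<in>{1..2*n}. z (swap n s i)) \<in> bad_samples M H n m N G \<delta> \<gamma> b"
      by auto
    have sw: "swap n s i \<in> {1..2*n}" if "i \<in> {1..2*n}" for i
      using swap_inj_on(2)[OF s] that by auto
    obtain a v where a: "a \<in> weight_grid m G"
      and v: "v \<in> PiE (slots m N) (\<lambda>_. PiE {1..2*n} (\<lambda>_. value_grid G))"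
      and vh: "\<forall>j\<in>slots m N. \<exists>h\<in>H. \<forall>i\<in>{1..2*n}. \<bar>h (fst (z (swap n s i))) - v j i\<bar> < 1 / real G"
      and unb: "unbalanced n m N G \<delta> \<gamma> b (a, v) (\<lambda>i\<in>{1..2*n}. snd (z (swap n s i)))"
      using bad unfolding bad_samples_def by (auto cong: restrict_cong)
    have "\<exists>g\<in>F. \<forall>i\<in>{1..2*n}. \<bar>v j i - g (fst (z (swap n s i)))\<bar> \<le> d + 1 / real G"
      if j: "j \<in> slots m N" for j
    proof -
      obtain h where h: "h \<in> H" "\<And>i. i \<in> {1..2*n} \<Longrightarrow> \<bar>h (fst (z (swap n s i))) - v j i\<bar> < 1 / real G"
        using vh j by blast
      obtain g where g: "g \<in> F" "\<And>i. i \<in> {1..2*n} \<Longrightarrow> \<bar>g (fst (z i)) - h (fst (z i))\<bar> \<le> d"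
        using net[OF h(1)] by blast
      have "\<bar>v j i - g (fst (z (swap n s i)))\<bar> \<le> d + 1 / real G" if "i \<in> {1..2*n}" for i
        using h(2)[OF that] g(2)[OF sw[OF that]] by linarith
      then show ?thesis using g(1) by blast
    qed
    then obtain g0 where g0: "\<And>j. j \<in> slots m N \<Longrightarrow> g0 j \<in> F"
      "\<And>j i. j \<in> slots m N \<Longrightarrow> i \<in> {1..2*n} \<Longrightarrow> \<bar>v j i - g0 j (fst (z (swap n s i)))\<bar> \<le> d + 1 / real G"
      by metis
    define g where "g = restrict g0 (slots m N)"
    have g: "g \<in> PiE (slots m N) (\<lambda>_. F)" using g0(1) by (auto simp: g_def)
    define w where "w k = real (a k) / real G" for k
    note wg = weight_gridD[OF a G, folded w_def]
    have close: "\<bar>snd (z (swap n s i)) * stratified_mean m N w (\<lambda>j. v j i) -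
          snd (z (swap n s i)) * stratified_mean m N w (\<lambda>j. g j (fst (z (swap n s i))))\<bar> \<le> \<delta> / 50"
      "\<bar>stratified_var m N w (\<lambda>j. v j i) - stratified_var m N w (\<lambda>j. g j (fst (z (swap n s i))))\<bar> \<le> 4 * \<gamma> / 50"
      if i: "i \<in> {1..2*n}" for i
    proof -
      have zi: "fst (z (swap n s i)) \<in> space M" "snd (z (swap n s i)) \<in> {-1, 1}"
        using z sw[OF i] by (auto simp: PiE_iff mem_Times_iff)
      have vw: "\<bar>v j i\<bar> \<le> 1 \<and> \<bar>g j (fst (z (swap n s i)))\<bar> \<le> 1 \<and>
          \<bar>v j i - g j (fst (z (swap n s i)))\<bar> \<le> d + 1 / real G" if j: "j \<in> slots m N" for j
      proof (intro conjI)
        have "v j i \<in> value_grid G" using v i j by (auto simp: PiE_iff)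
        then show "\<bar>v j i\<bar> \<le> 1" by (rule value_grid_bounded)
        show "\<bar>g j (fst (z (swap n s i)))\<bar> \<le> 1" using g F(2) j zi(1) by (intro H) (auto simp: PiE_iff)
        show "\<bar>v j i - g j (fst (z (swap n s i)))\<bar> \<le> d + 1 / real G" using g0(2)[OF j i] j by (simp add: g_def)
      qed
      have d': "0 \<le> d + 1 / real G" "real m * 0 + (d + 1 / real G) \<le> \<delta> / 50" using d G by auto
      show "\<bar>snd (z (swap n s i)) * stratified_mean m N w (\<lambda>j. v j i) -
          snd (z (swap n s i)) * stratified_mean m N w (\<lambda>j. g j (fst (z (swap n s i))))\<bar> \<le> \<delta> / 50"
        by (rule labelled_stratified_perturbation(1)[OF N order_refl d' \<delta>(2) _ wg(2) wg(1) _ vw zi(2)]) (use wg in auto)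
      show "\<bar>stratified_var m N w (\<lambda>j. v j i) - stratified_var m N w (\<lambda>j. g j (fst (z (swap n s i))))\<bar> \<le> 4 * \<gamma> / 50"
        by (rule labelled_stratified_perturbation(2)[OF N order_refl d' \<delta>(2) _ wg(2) wg(1) _ vw zi(2)]) (use wg in auto)
    qed
    have up: "swap n s i \<in> B (a, g)"
      if i: "i \<in> {1..2*n}" and r: "risky m N w (snd (z (swap n s i))) (\<lambda>j. v j i) (2/5 * \<delta>) (12/5 * \<gamma>)" for i
    proof -
      have "risky m N w (snd (z (swap n s i))) (\<lambda>j. g j (fst (z (swap n s i)))) (\<delta> / 2) (2 * \<gamma>)"
        using r close[OF i] \<delta> unfolding risky_def by (elim disjE) (rule disjI1, linarith, rule disjI2, linarith)
      then show ?thesis using sw[OF i] by (simp add: B_def w_def[abs_def])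
    qed
    have down: "risky m N w (snd (z (swap n s i))) (\<lambda>j. v j i) (3/5 * \<delta>) (8/5 * \<gamma>)"
      if i: "i \<in> {1..2*n}" and b: "swap n s i \<in> B (a, g)" for i
    proof -
      have "risky m N w (snd (z (swap n s i))) (\<lambda>j. g j (fst (z (swap n s i)))) (\<delta> / 2) (2 * \<gamma>)"
        using b by (simp add: B_def w_def[abs_def])
      then show ?thesis
        using close[OF i] \<delta> unfolding risky_def by (elim disjE) (rule disjI1, linarith, rule disjI2, linarith)
    qed
    have "2 * real (card {i \<in> {1..n}. swap n s i \<in> B (a, g)}) + b
        \<le> 2 * real (card {i \<in> {1..n}. risky m N w (snd (z (swap n s i))) (\<lambda>j. v j i) (3/5 * \<delta>) (8/5 * \<gamma>)}) + b"
    proof -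
      have "card {i \<in> {1..n}. swap n s i \<in> B (a, g)}
        \<le> card {i \<in> {1..n}. risky m N w (snd (z (swap n s i))) (\<lambda>j. v j i) (3/5 * \<delta>) (8/5 * \<gamma>)}"
      proof (rule card_mono)
        show "{i \<in> {1..n}. swap n s i \<in> B (a, g)} \<subseteq>
          {i \<in> {1..n}. risky m N w (snd (z (swap n s i))) (\<lambda>j. v j i) (3/5 * \<delta>) (8/5 * \<gamma>)}"
        proof
          fix i assume "i \<in> {i \<in> {1..n}. swap n s i \<in> B (a, g)}"
          then show "i \<in> {i \<in> {1..n}. risky m N w (snd (z (swap n s i))) (\<lambda>j. v j i) (3/5 * \<delta>) (8/5 * \<gamma>)}"
            using down[of i] by simp
        qed
      qed simp
      then show ?thesis by simp
    qed
    also have "\<dots> \<le> real (card {i \<in> {n+1..2*n}. risky m N w (snd (z (swap n s i))) (\<lambda>j. v j i) (2/5 * \<delta>) (12/5 * \<gamma>)})"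
    proof -
      have *: "{i \<in> {1..n}. risky m N w ((\<lambda>i\<in>{1..2*n}. snd (z (swap n s i))) i) (\<lambda>j. v j i) (3/5 * \<delta>) (8/5 * \<gamma>)}
         = {i \<in> {1..n}. risky m N w (snd (z (swap n s i))) (\<lambda>j. v j i) (3/5 * \<delta>) (8/5 * \<gamma>)}"
        "{i \<in> {n+1..2*n}. risky m N w ((\<lambda>i\<in>{1..2*n}. snd (z (swap n s i))) i) (\<lambda>j. v j i) (2/5 * \<delta>) (12/5 * \<gamma>)}
         = {i \<in> {n+1..2*n}. risky m N w (snd (z (swap n s i))) (\<lambda>j. v j i) (2/5 * \<delta>) (12/5 * \<gamma>)}"
        by auto
      show ?thesis
        using unb unfolding unbalanced_def prod.case w_def[symmetric] * .
    qed
    also have "\<dots> \<le> real (card {i \<in> {n+1..2*n}. swap n s i \<in> B (a, g)})"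
    proof (intro of_nat_mono card_mono)
      show "{i \<in> {n+1..2*n}. risky m N w (snd (z (swap n s i))) (\<lambda>j. v j i) (2/5 * \<delta>) (12/5 * \<gamma>)}
        \<subseteq> {i \<in> {n+1..2*n}. swap n s i \<in> B (a, g)}"
      proof
        fix i assume "i \<in> {i \<in> {n+1..2*n}. risky m N w (snd (z (swap n s i))) (\<lambda>j. v j i) (2/5 * \<delta>) (12/5 * \<gamma>)}"
        then show "i \<in> {i \<in> {n+1..2*n}. swap n s i \<in> B (a, g)}" using up[of i] by simp
      qed
    qed simp
    finally have "s \<in> S (a, g)" using s by (simp add: S_def)
    then show "s \<in> (\<Union>\<theta>\<in>\<Gamma>. S \<theta>)" using a g by (intro UN_I[of "(a, g)"]) (auto simp: \<Gamma>_def)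
  qed
  have "real (card {s \<in> Pow {1..n}. (\<lambda>i\<in>{1..2*n}. z (swap n s i)) \<in> bad_samples M H n m N G \<delta> \<gamma> b})
     \<le> real (card (\<Union>\<theta>\<in>\<Gamma>. S \<theta>))"
    using fin finS by (intro of_nat_mono card_mono sub) auto
  also have "\<dots> \<le> real (\<Sum>\<theta>\<in>\<Gamma>. card (S \<theta>))" by (intro of_nat_mono card_UN_le fin)
  also have "\<dots> = (\<Sum>\<theta>\<in>\<Gamma>. real (card (S \<theta>)))" by simp
  also have "\<dots> \<le> (\<Sum>\<theta>\<in>\<Gamma>. 2 ^ n * (3/2) powr (- b))"
    unfolding S_def by (intro sum_mono swap_count_le)
  also have "\<dots> = real (card \<Gamma>) * (2 ^ n * (3/2) powr (- b))" by simp
  also have "\<dots> \<le> (real (G + 1) ^ m * real (card F) ^ (2 * m * N)) * (2 ^ n * (3/2) powr (- b))"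
  proof (rule mult_right_mono)
    have "card \<Gamma> = card (weight_grid m G) * card F ^ (2 * m * N)"
      by (simp add: \<Gamma>_def card_cartesian_product card_PiE finite_slots card_slots)
    also have "\<dots> \<le> (G + 1) ^ m * card F ^ (2 * m * N)"
      by (intro mult_right_mono card_weight_grid) simp
    finally have "real (card \<Gamma>) \<le> real ((G + 1) ^ m * card F ^ (2 * m * N))" by (rule of_nat_mono)
    then show "real (card \<Gamma>) \<le> real (G + 1) ^ m * real (card F) ^ (2 * m * N)"
      by (simp only: of_nat_mult of_nat_power)
  qed simp
  finally show ?thesis by (simp add: mult_ac)
qed

lemma half_le_ln2: "1/2 \<le> ln (2::real)"
  using ln_le_minus_one[of "1/2::real"] by (simp add: ln_div)

text \<open>Here \<open>f\<close> stands for the size of the net, \<open>A\<close> is \<open>n\<close> times the complexity term for \<open>\<delta> = 2\<^sup>-\<^sup>p\<close> and \<open>\<gamma> = 2\<^sup>-\<^sup>q\<close>, and \<open>r = \<gamma> / \<delta>\<^sup>2\<close>. The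
  logarithm of the number of sets \<open>B\<close> is at most \<open>(16 / V0 + 1444 c2) A\<close>: the net contributes
  \<open>2mN \<cdot> V \<Lambda> c2\<close> with \<open>N \<le> 722 r \<Lambda>\<close>, and the weights contribute \<open>8 m \<Lambda> \<le> 16 A / V0\<close>. Another \<open>16 A / V0\<close>
  pays for the factor \<open>n\<^sup>-\<^sup>8\<close> used in the union bound over the triples \<open>(m, p, q)\<close>.\<close>

lemma configuration_count:
  fixes V V0 c1 C1 f t \<kappa> r \<Lambda> A c2 :: real and n m p q N :: nat
  assumes n: "2 \<le> n" and m: "1 \<le> m" and pq: "q \<le> p" and V: "0 < V0" "V0 \<le> V"
    and c1: "0 < c1" "c1 \<le> 1" and C1: "1 \<le> C1" and f: "0 \<le> f" "f \<le> C1 * (real n * 2 ^ p / c1) powr V"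
    and t: "0 < t"
    and r_def: "r = 2 ^ (2 * p) / 2 ^ q" and \<Lambda>_def: "\<Lambda> = ln (real n * 2 ^ p)"
    and A_def: "A = V * real m * r * \<Lambda>\<^sup>2"
    and N_def: "N = nat \<lceil>144 * r * ln (16 * real n)\<rceil>"
    and c2_def: "c2 = 1 + 2 * ln (1 / c1) + 2 * ln C1 / V0"
    and \<kappa>: "3 * (1 + 32 / V0 + 1444 * c2) \<le> \<kappa>"
  shows "real (100 * n * 2 ^ p + 1) ^ m * f ^ (2 * m * N) * (3/2) powr (- (\<kappa> * (A + t))) \<le> exp (- t) / real n ^ 8"
proof -
  define D where "D = real n * 2 ^ p"
  have D2: "2 \<le> D" unfolding D_def using mult_mono[of 2 "real n" 1 "2 ^ p"] n by simp
  have Dn: "real n \<le> D" unfolding D_def using mult_left_mono[of 1 "2 ^ p" "real n"] by simp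
  have \<Lambda>: "\<Lambda> = ln D" by (simp add: \<Lambda>_def D_def)
  have ln_n: "ln (real n) \<le> \<Lambda>" unfolding \<Lambda> using Dn n by simp
  have ln2: "ln 2 \<le> ln (real n)" using n by simp
  have \<Lambda>h: "1/2 \<le> \<Lambda>" using half_le_ln2 ln2 ln_n by linarith
  have r1: "1 \<le> r"
  proof -
    have "(2::real) ^ q \<le> 2 ^ (2 * p)" using pq by (intro power_increasing) auto
    then show ?thesis by (simp add: r_def)
  qed
  have lc1: "0 \<le> ln (1 / c1)" using c1 by simp
  have lC1: "0 \<le> ln C1" using C1 by simp
  have c2: "1 \<le> c2" using lc1 lC1 V by (simp add: c2_def)
  have V': "0 < V" using V by linarith
  have r\<Lambda>: "1/2 \<le> r * \<Lambda>" using mult_mono[of 1 r "1/2" \<Lambda>] r1 \<Lambda>h by simp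
  have N: "real N \<le> 722 * (r * \<Lambda>)"
  proof -
    have "ln (16 * real n) = 4 * ln 2 + ln (real n)"
      using n ln_realpow[of "2::real" 4] by (simp add: ln_mult)
    then have l: "0 \<le> ln (16 * real n)" "ln (16 * real n) \<le> 5 * \<Lambda>" using ln2 ln_n half_le_ln2 by linarith+
    have "real N \<le> 144 * r * ln (16 * real n) + 1"
      unfolding N_def using l r1 by simp
    also have "\<dots> \<le> 144 * r * (5 * \<Lambda>) + 2 * (r * \<Lambda>)"
      using l r1 r\<Lambda> by (intro add_mono mult_left_mono) auto
    finally show ?thesis by (simp add: mult_ac)
  qed
  have Am: "real m * \<Lambda> \<le> 2 * A / V0"
  proof -
    have "V0 * (real m * \<Lambda>) * (1/2) \<le> V * (real m * \<Lambda>) * (r * \<Lambda>)"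
      using V V' r\<Lambda> \<Lambda>h by (intro mult_mono) auto
    also have "\<dots> = A" by (simp add: A_def power2_eq_square)
    finally show ?thesis using V by (simp add: field_simps)
  qed
  have A0: "0 \<le> A" unfolding A_def using V' r1 by simp
  have f': "f \<le> exp (V * \<Lambda> * c2)"
  proof -
    have "(D / c1) powr V = exp (V * (\<Lambda> + ln (1 / c1)))"
      using D2 c1 by (simp add: powr_def \<Lambda> ln_div)
    then have "C1 * (D / c1) powr V = exp (ln C1 + V * (\<Lambda> + ln (1 / c1)))"
      using C1 by (simp add: exp_add)
    moreover have "ln C1 + V * (\<Lambda> + ln (1 / c1)) \<le> V * \<Lambda> * c2"
    proof -
      have "1 \<le> (V / V0) * (2 * \<Lambda>)"
        using mult_mono[of 1 "V / V0" 1 "2 * \<Lambda>"] V \<Lambda>h by simp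
      then have "ln C1 * 1 \<le> ln C1 * ((V / V0) * (2 * \<Lambda>))" using lC1 by (rule mult_left_mono)
      moreover have "V * ln (1 / c1) * 1 \<le> V * ln (1 / c1) * (2 * \<Lambda>)"
        using lc1 V' \<Lambda>h by (intro mult_left_mono) auto
      moreover have "V * \<Lambda> * c2 = V * \<Lambda> + V * ln (1 / c1) * (2 * \<Lambda>) + ln C1 * ((V / V0) * (2 * \<Lambda>))"
        by (simp add: c2_def algebra_simps)
      ultimately show ?thesis by (simp add: distrib_left)
    qed
    ultimately show ?thesis using f(2) by (simp add: D_def) (meson exp_le_cancel_iff order_trans)
  qed
  have "f ^ (2 * m * N) \<le> exp (V * \<Lambda> * c2) ^ (2 * m * N)"
    using f f' by (intro power_mono)
  also have "\<dots> = exp (real (2 * m) * (V * \<Lambda> * c2) * real N)"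
    by (simp flip: exp_of_nat_mult add: mult_ac)
  also have "\<dots> \<le> exp (1444 * c2 * A)"
  proof -
    have "real (2 * m) * (V * \<Lambda> * c2) * real N \<le> real (2 * m) * (V * \<Lambda> * c2) * (722 * (r * \<Lambda>))"
      using N V' \<Lambda>h c2 by (intro mult_left_mono) auto
    also have "\<dots> = 1444 * c2 * A" by (simp add: A_def power2_eq_square)
    finally show ?thesis by simp
  qed
  finally have F: "f ^ (2 * m * N) \<le> exp (1444 * c2 * A)" .
  have "real (100 * n * 2 ^ p + 1) \<le> D ^ 8"
  proof -
    have "2 ^ 7 * D \<le> D ^ 7 * D" using D2 by (intro mult_right_mono power_mono) auto
    also have "\<dots> = D ^ 8" by (simp add: eval_nat_numeral)
    finally show ?thesis using D2 by (simp add: D_def)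
  qed
  then have "real (100 * n * 2 ^ p + 1) ^ m \<le> (D ^ 8) ^ m" by (intro power_mono) auto
  also have "\<dots> = exp (8 * (real m * \<Lambda>))"
    using D2 by (simp add: \<Lambda> exp_of_nat_mult[symmetric] flip: power_mult exp_of_nat2_mult)
       (simp add: power_mult powr_def flip: powr_realpow)
  also have "\<dots> \<le> exp (16 * A / V0)" using Am by simp
  finally have G: "real (100 * n * 2 ^ p + 1) ^ m \<le> exp (16 * A / V0)" .
  have b: "(3/2) powr (- (\<kappa> * (A + t))) \<le> exp (- (\<kappa> * (A + t) / 3))"
  proof -
    have k: "0 \<le> \<kappa>" using \<kappa> c2 V by (smt (verit) divide_nonneg_pos)
    have "1/3 \<le> ln (3/2::real)" using ln_le_minus_one[of "2/3::real"] by (simp add: ln_div)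
    then have "(\<kappa> * (A + t)) * (1/3) \<le> (\<kappa> * (A + t)) * ln (3/2)"
      using k A0 t by (intro mult_left_mono) auto
    then show ?thesis by (simp add: powr_def)
  qed
  have "real (100 * n * 2 ^ p + 1) ^ m * f ^ (2 * m * N) * (3/2) powr (- (\<kappa> * (A + t)))
     \<le> exp (16 * A / V0) * exp (1444 * c2 * A) * exp (- (\<kappa> * (A + t) / 3))"
    using F G b f by (intro mult_mono) auto
  also have "\<dots> = exp (16 * A / V0 + 1444 * c2 * A - \<kappa> * (A + t) / 3)"
    by (simp flip: exp_add)
  also have "\<dots> \<le> exp (- t - 8 * ln (real n))"
  proof -
    have s: "1 + 32 / V0 + 1444 * c2 \<le> \<kappa> / 3" using \<kappa> by simp
    have "(32 / V0 + 1444 * c2) * A \<le> \<kappa> / 3 * A" using s A0 by (intro mult_right_mono) auto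
    moreover have "1 * t \<le> \<kappa> / 3 * t"
    proof (rule mult_right_mono)
      have "0 \<le> 32 / V0" using V by simp
      then show "1 \<le> \<kappa> / 3" using s c2 by linarith
    qed (use t in simp)
    moreover have "8 * ln (real n) \<le> 16 * A / V0"
    proof -
      have "1 * \<Lambda> \<le> real m * \<Lambda>" using m \<Lambda>h by (intro mult_right_mono) auto
      then show ?thesis using Am ln_n by simp
    qed
    moreover have "\<kappa> * (A + t) / 3 = \<kappa> / 3 * A + \<kappa> / 3 * t" by (simp add: algebra_simps)
    moreover have "(32 / V0 + 1444 * c2) * A = 32 * A / V0 + 1444 * c2 * A" by (simp add: algebra_simps)
    ultimately have "16 * A / V0 + 1444 * c2 * A - \<kappa> * (A + t) / 3 \<le> - t - 8 * ln (real n)" by linarith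
    then show ?thesis by simp
  qed
  also have "\<dots> = exp (- t) / real n ^ 8"
    using n by (simp add: exp_diff exp_of_nat_mult[of 8 "ln (real n)", simplified])
  finally show ?thesis .
qed

section \<open>Classifiers violating the bound produce unbalanced double samples\<close>

lemma floor_grid:
  assumes "0 < G"
  shows "\<bar>r - of_int \<lfloor>r * real G\<rfloor> / real G\<bar> < 1 / real G"
    and "\<bar>r\<bar> \<le> 1 \<Longrightarrow> of_int \<lfloor>r * real G\<rfloor> / real G \<in> value_grid G"
proof -
  have "\<bar>r * real G - of_int \<lfloor>r * real G\<rfloor>\<bar> < 1" by linarith
  then have "\<bar>r * real G - of_int \<lfloor>r * real G\<rfloor>\<bar> / real G < 1 / real G"
    using assms by (intro divide_strict_right_mono) auto
  also have "\<bar>r * real G - of_int \<lfloor>r * real G\<rfloor>\<bar> / real G = \<bar>(r * real G - of_int \<lfloor>r * real G\<rfloor>) / real G\<bar>"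
    by (simp add: abs_divide)
  also have "(r * real G - of_int \<lfloor>r * real G\<rfloor>) / real G = r - of_int \<lfloor>r * real G\<rfloor> / real G"
    using assms by (simp add: field_simps)
  finally show "\<bar>r - of_int \<lfloor>r * real G\<rfloor> / real G\<bar> < 1 / real G" .
  assume r: "\<bar>r\<bar> \<le> 1"
  have "r * real G \<le> 1 * real G" "(-1) * real G \<le> r * real G"
    using r by (intro mult_right_mono; simp)+
  then have "\<lfloor>r * real G\<rfloor> \<in> {- int G..int G}"
    by (auto simp: le_floor_iff floor_le_iff)
  then show "of_int \<lfloor>r * real G\<rfloor> / real G \<in> value_grid G" unfolding value_grid_def by blast
qed

text \<open>A mixture with many errors in the second half but few small margins and few large variances in the first
  half yields a bad double sample: the functions drawn by \<open>stratified_sample_exists\<close> and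
  the weights are rounded down to the grid.\<close>

lemma unbalanced_margins_imp_bad_samples:
  fixes z :: "nat \<Rightarrow> 'x \<times> real"
  assumes z: "z \<in> PiE {1..2*n} (\<lambda>_. space M \<times> {-1, 1})"
    and H: "\<And>h x. h \<in> H \<Longrightarrow> x \<in> space M \<Longrightarrow> \<bar>h x\<bar> \<le> 1"
    and l: "l \<in> discrete_dists H" and c: "c \<in> decompositions H m l"
    and N: "0 < N" and G: "0 < G" and G': "(real m + 1) / real G \<le> \<delta> / 50" and \<delta>: "0 < \<delta>" "\<delta> \<le> \<gamma>"
    and small: "3 * real (2 * n) * exp (- (real N * \<delta>\<^sup>2 / (144 * \<gamma>))) < 1"
    and unb: "2 * real (card {i \<in> {1..n}. snd (z i) * mix_mean l (fst (z i)) \<le> \<delta> \<or> \<gamma> \<le> decomp_var m c (fst (z i))}) + b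
       \<le> real (card {i \<in> {n+1..2*n}. snd (z i) * mix_mean l (fst (z i)) \<le> 0})"
  shows "z \<in> bad_samples M H n m N G \<delta> \<gamma> b"
proof -
  obtain \<alpha> L where c': "c = (\<alpha>, L)" by (cases c)
  define x where "x i = fst (z i)" for i
  define y where "y i = snd (z i)" for i
  have zi: "x i \<in> space M" "y i \<in> {-1, 1}" if "i \<in> {1..2*n}" for i
    using z that by (auto simp: PiE_iff mem_Times_iff x_def y_def)
  note wts = decomposition_weights[OF c[unfolded c'] l]
  have "\<exists>W. (\<forall>k\<in>{1..m}. \<forall>j\<in>{1..N}. \<forall>b. W (k, j, b) \<in> H) \<and>
     (\<forall>i\<in>{1..2*n}. (decomp_var m (\<alpha>, L) (x i) < 4 * \<gamma> \<longrightarrow>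
              \<bar>stratified_mean m N \<alpha> (\<lambda>a. W a (x i)) - mix_mean l (x i)\<bar> < \<delta> / 3) \<and>
            (4 * \<gamma> \<le> decomp_var m (\<alpha>, L) (x i) \<longrightarrow>
              5/2 * \<gamma> < stratified_var m N \<alpha> (\<lambda>a. W a (x i))) \<and>
            (decomp_var m (\<alpha>, L) (x i) < \<gamma> \<longrightarrow>
              stratified_var m N \<alpha> (\<lambda>a. W a (x i)) < 3/2 * \<gamma>))"
    by (rule stratified_sample_exists[OF c[unfolded c'] l _ _ \<delta> N]) (use H zi small in auto)
  then obtain W where W: "\<And>k j b. k \<in> {1..m} \<Longrightarrow> j \<in> {1..N} \<Longrightarrow> W (k, j, b) \<in> H"
    and Wf: "\<And>i. i \<in> {1..2*n} \<Longrightarrow> decomp_var m c (x i) < 4 * \<gamma> \<Longrightarrow>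
        \<bar>stratified_mean m N \<alpha> (\<lambda>a. W a (x i)) - mix_mean l (x i)\<bar> < \<delta> / 3"
    and Wu: "\<And>i. i \<in> {1..2*n} \<Longrightarrow> 4 * \<gamma> \<le> decomp_var m c (x i) \<Longrightarrow>
        5/2 * \<gamma> < stratified_var m N \<alpha> (\<lambda>a. W a (x i))"
    and Wl: "\<And>i. i \<in> {1..2*n} \<Longrightarrow> decomp_var m c (x i) < \<gamma> \<Longrightarrow>
        stratified_var m N \<alpha> (\<lambda>a. W a (x i)) < 3/2 * \<gamma>"
    unfolding c' by blast
  have W': "W j \<in> H" if "j \<in> slots m N" for j
    using that W by (auto simp: slots_def)
  define a where "a = (\<lambda>k\<in>{1..m}. nat \<lfloor>\<alpha> k * real G\<rfloor>)"
  define w where "w k = real (a k) / real G" for k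
  define v where "v = (\<lambda>j\<in>slots m N. \<lambda>i\<in>{1..2*n}. of_int \<lfloor>W j (x i) * real G\<rfloor> / real G)"
  have ra: "real (a k) = of_int \<lfloor>\<alpha> k * real G\<rfloor>" if "k \<in> {1..m}" for k
    using wts(2)[OF that] that by (simp add: a_def)
  have wa: "\<bar>\<alpha> k - w k\<bar> \<le> 1 / real G" "w k \<le> \<alpha> k" "0 \<le> w k" if k: "k \<in> {1..m}" for k
  proof -
    show "\<bar>\<alpha> k - w k\<bar> \<le> 1 / real G" using floor_grid(1)[OF G, of "\<alpha> k"] ra[OF k] by (simp add: w_def)
    have "real (a k) \<le> \<alpha> k * real G" using ra[OF k] by simp
    then show "w k \<le> \<alpha> k" using G by (simp add: w_def field_simps)
    show "0 \<le> w k" by (simp add: w_def)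
  qed
  have sw: "(\<Sum>k=1..m. w k) \<le> 1"
    using sum_mono[of "{1..m}" w \<alpha>] wa(2) wts(1) by simp
  have a: "a \<in> weight_grid m G"
  proof -
    have "w k \<le> 1" if "k \<in> {1..m}" for k using wa(2)[OF that] wts(3)[OF that] by linarith
    then have "a k \<le> G" if "k \<in> {1..m}" for k using that G by (simp add: w_def)
    moreover have "real (\<Sum>k=1..m. a k) \<le> real G"
      using sw G by (simp add: w_def sum_divide_distrib[symmetric])
    then have "(\<Sum>k=1..m. a k) \<le> G" unfolding of_nat_le_iff .
    ultimately show ?thesis by (auto simp: weight_grid_def a_def)
  qed
  have Wb: "\<bar>W j (x i)\<bar> \<le> 1" if "j \<in> slots m N" "i \<in> {1..2*n}" for j i
    using H[OF W'[OF that(1)] zi(1)[OF that(2)]] .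
  have vW: "\<bar>W j (x i) - v j i\<bar> < 1 / real G" "v j i \<in> value_grid G" if "j \<in> slots m N" "i \<in> {1..2*n}" for j i
    using floor_grid[OF G, of "W j (x i)"] Wb[OF that] that by (simp_all add: v_def)
  have v: "v \<in> PiE (slots m N) (\<lambda>_. PiE {1..2*n} (\<lambda>_. value_grid G))"
    using vW(2) by (auto simp: PiE_iff) (auto simp: v_def)
  have close: "\<bar>y i * stratified_mean m N \<alpha> (\<lambda>j. W j (x i)) - y i * stratified_mean m N w (\<lambda>j. v j i)\<bar> \<le> \<delta> / 50"
    "\<bar>stratified_var m N \<alpha> (\<lambda>j. W j (x i)) - stratified_var m N w (\<lambda>j. v j i)\<bar> \<le> 4 * \<gamma> / 50"
    if i: "i \<in> {1..2*n}" for i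
  proof -
    have vw: "\<bar>W j (x i)\<bar> \<le> 1 \<and> \<bar>v j i\<bar> \<le> 1 \<and> \<bar>W j (x i) - v j i\<bar> \<le> 1 / real G" if j: "j \<in> slots m N" for j
      using vW[OF j i] Wb[OF j i] value_grid_bounded by auto
    have e: "0 \<le> 1 / real G" "real m * (1 / real G) + 1 / real G \<le> \<delta> / 50"
      using G' G by (auto simp: add_divide_distrib)
    have \<alpha>: "0 \<le> \<alpha> k \<and> \<alpha> k \<le> 1" if "k \<in> {1..m}" for k using wts that by auto
    show "\<bar>y i * stratified_mean m N \<alpha> (\<lambda>j. W j (x i)) - y i * stratified_mean m N w (\<lambda>j. v j i)\<bar> \<le> \<delta> / 50"
      by (rule labelled_stratified_perturbation(1)[OF N e(1) e(1) e(2) \<delta>(2) wa(3) sw \<alpha> wa(1) vw zi(2)[OF i]])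
    show "\<bar>stratified_var m N \<alpha> (\<lambda>j. W j (x i)) - stratified_var m N w (\<lambda>j. v j i)\<bar> \<le> 4 * \<gamma> / 50"
      by (rule labelled_stratified_perturbation(2)[OF N e(1) e(1) e(2) \<delta>(2) wa(3) sw \<alpha> wa(1) vw zi(2)[OF i]])
  qed
  have yf: "\<bar>y i * stratified_mean m N \<alpha> (\<lambda>j. W j (x i)) - y i * mix_mean l (x i)\<bar> < \<delta> / 3"
    if "i \<in> {1..2*n}" "decomp_var m c (x i) < 4 * \<gamma>" for i
    using Wf[OF that] zi(2)[OF that(1)] by (auto simp: abs_minus_commute)
  have \<gamma>: "0 < \<gamma>" using \<delta> by linarith
  have up: "risky m N w (y i) (\<lambda>j. v j i) (2/5 * \<delta>) (12/5 * \<gamma>)"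
    if i: "i \<in> {1..2*n}" and le: "y i * mix_mean l (x i) \<le> 0" for i
  proof (cases "decomp_var m c (x i) < 4 * \<gamma>")
    case True
    then have "y i * stratified_mean m N w (\<lambda>j. v j i) \<le> 2/5 * \<delta>"
      using yf[OF i True] close(1)[OF i] le \<delta> by linarith
    then show ?thesis by (simp add: risky_def)
  next
    case False
    then have "12/5 * \<gamma> \<le> stratified_var m N w (\<lambda>j. v j i)"
      using Wu[OF i] close(2)[OF i] \<gamma> by linarith
    then show ?thesis by (simp add: risky_def)
  qed
  have down: "y i * mix_mean l (x i) \<le> \<delta> \<or> \<gamma> \<le> decomp_var m c (x i)"
    if i: "i \<in> {1..2*n}" and r: "risky m N w (y i) (\<lambda>j. v j i) (3/5 * \<delta>) (8/5 * \<gamma>)" for i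
  proof (rule ccontr)
    assume "\<not> ?thesis"
    then have n: "\<delta> < y i * mix_mean l (x i)" "decomp_var m c (x i) < \<gamma>" by auto
    then have "decomp_var m c (x i) < 4 * \<gamma>" using \<gamma> by linarith
    from yf[OF i this] Wl[OF i n(2)] close[OF i] r n(1) \<delta> \<gamma> show False
      unfolding risky_def by linarith
  qed
  have "unbalanced n m N G \<delta> \<gamma> b (a, v) (\<lambda>i\<in>{1..2*n}. snd (z i))"
  proof -
    have *: "{i \<in> {1..n}. risky m N w ((\<lambda>i\<in>{1..2*n}. snd (z i)) i) (\<lambda>j. v j i) (3/5 * \<delta>) (8/5 * \<gamma>)}
       = {i \<in> {1..n}. risky m N w (y i) (\<lambda>j. v j i) (3/5 * \<delta>) (8/5 * \<gamma>)}"
      "{i \<in> {n+1..2*n}. risky m N w ((\<lambda>i\<in>{1..2*n}. snd (z i)) i) (\<lambda>j. v j i) (2/5 * \<delta>) (12/5 * \<gamma>)}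
       = {i \<in> {n+1..2*n}. risky m N w (y i) (\<lambda>j. v j i) (2/5 * \<delta>) (12/5 * \<gamma>)}"
      by (auto simp: y_def)
    have "card {i \<in> {1..n}. risky m N w (y i) (\<lambda>j. v j i) (3/5 * \<delta>) (8/5 * \<gamma>)}
      \<le> card {i \<in> {1..n}. snd (z i) * mix_mean l (fst (z i)) \<le> \<delta> \<or> \<gamma> \<le> decomp_var m c (fst (z i))}"
    proof (intro card_mono subsetI)
      fix i assume "i \<in> {i \<in> {1..n}. risky m N w (y i) (\<lambda>j. v j i) (3/5 * \<delta>) (8/5 * \<gamma>)}"
      then show "i \<in> {i \<in> {1..n}. snd (z i) * mix_mean l (fst (z i)) \<le> \<delta> \<or> \<gamma> \<le> decomp_var m c (fst (z i))}"
        using down[of i] by (simp add: x_def y_def)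
    qed simp
    moreover have "card {i \<in> {n+1..2*n}. snd (z i) * mix_mean l (fst (z i)) \<le> 0}
      \<le> card {i \<in> {n+1..2*n}. risky m N w (y i) (\<lambda>j. v j i) (2/5 * \<delta>) (12/5 * \<gamma>)}"
    proof (intro card_mono subsetI)
      fix i assume "i \<in> {i \<in> {n+1..2*n}. snd (z i) * mix_mean l (fst (z i)) \<le> 0}"
      then show "i \<in> {i \<in> {n+1..2*n}. risky m N w (y i) (\<lambda>j. v j i) (2/5 * \<delta>) (12/5 * \<gamma>)}"
        using up[of i] by (simp add: x_def y_def)
    qed simp
    ultimately show ?thesis
      unfolding unbalanced_def prod.case w_def[symmetric] * using unb by linarith
  qed
  moreover have "\<forall>j\<in>slots m N. \<exists>h\<in>H. \<forall>i\<in>{1..2*n}. \<bar>h (fst (z i)) - v j i\<bar> < 1 / real G"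
    using W' vW(1) unfolding x_def by blast
  ultimately show ?thesis
    unfolding bad_samples_def using z a v by (intro CollectI conjI bexI[of _ "(a, v)"]) auto
qed

section \<open>The margin bound\<close>

text \<open>The bound for \<open>\<delta> = 2\<^sup>-\<^sup>p\<close> and \<open>\<gamma> = 2\<^sup>-\<^sup>q\<close>, multiplied by \<open>n\<close>. The event \<open>E\<close> must serve all
  \<open>m\<close>, \<open>p\<close> and \<open>q\<close>; the bound is trivial unless \<open>m 2\<^sup>p < n\<close>, so that finitely many triples suffice.\<close>

lemma dyadic_margin_bound:
  fixes M :: "'x measure" and H :: "('x \<Rightarrow> real) set" and P :: "('x \<times> real) measure"
    and n :: nat and t C u0 V0 V c1 C1 \<kappa> :: real
  assumes u0: "0 < u0" and V: "0 < V0" "V0 \<le> V"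
    and H: "\<forall>h\<in>H. h \<in> borel_measurable M \<and> (\<forall>x\<in>space M. h x \<in> {-1..1})"
    and cov: "\<forall>u. 0 < u \<and> u < u0 \<longrightarrow>
        ereal_of_enat (uniform_covering_number M H u) \<le> ereal (C * u powr (- V))"
    and P: "prob_space P" and sP: "sets P = sets (M \<Otimes>\<^sub>M count_space {-1, 1})"
    and sm: "sample_measurable (distr P M fst) H" and n: "2 \<le> n" and t: "0 < t"
    and c1_def: "c1 = min (u0 / 2) (1 / 100)" and C1_def: "C1 = max C 1"
    and \<kappa>_def: "\<kappa> = 3 * (1 + 32 / V0 + 1444 * (1 + 2 * ln (1 / c1) + 2 * ln C1 / V0))"
  shows "\<exists>E \<in> sets (PiM {1..n} (\<lambda>_. P)). 1 - exp (- t) \<le> measure (PiM {1..n} (\<lambda>_. P)) E \<and>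
     (\<forall>\<omega>\<in>E. \<forall>l \<in> discrete_dists H. \<forall>m\<ge>1. \<forall>c \<in> decompositions H m l. \<forall>p q. q \<le> p \<longrightarrow>
        real n * measure P {z \<in> space P. snd z * mix_mean l (fst z) \<le> 0}
        \<le> 4 * \<kappa> * (real (card {i \<in> {1..n}. snd (\<omega> i) * mix_mean l (fst (\<omega> i)) \<le> 1 / 2 ^ p})
            + real (card {i \<in> {1..n}. 1 / 2 ^ q \<le> decomp_var m c (fst (\<omega> i))})
            + V * real m * (2 ^ (2 * p) / 2 ^ q) * (ln (real n * 2 ^ p))\<^sup>2 + t))"
proof -
  define r where "r p q = (2 ^ (2 * p) / 2 ^ q :: real)" for p q :: nat
  define A where "A m p q = V * real m * r p q * (ln (real n * 2 ^ p))\<^sup>2" for m p q :: nat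
  \<comment> \<open>The choice of \<open>N\<close> makes the bound for each test of \<open>stratified_sample_exists\<close> at most \<open>1 / (16 n)\<close>,
  and \<open>2n\<close> points have at most \<open>6n\<close> tests.\<close>
  define N where "N p q = nat \<lceil>144 * r p q * ln (16 * real n)\<rceil>" for p q :: nat
  \<comment> \<open>Grid width \<open>\<delta> / (100 n)\<close>: rounding \<open>m \<le> n\<close> weights and the values costs at most \<open>\<delta> / 50\<close> in total.\<close>
  define G where "G p = 100 * n * 2 ^ p" for p :: nat
  define \<mu> where "\<mu> = PiM {1..2*n} (\<lambda>_. P)"
  define bad where "bad = (\<lambda>(m, p, q). bad_samples M H n m (N p q) (G p) (1 / 2 ^ p) (1 / 2 ^ q) (\<kappa> * (A m p q + t)))"
  define \<Theta> where "\<Theta> = {(m, p, q). m \<in> {1..n} \<and> p \<in> {0..n} \<and> q \<in> {0..p}}"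
  interpret P: prob_space P by fact
  interpret \<mu>: prob_space \<mu> unfolding \<mu>_def by (intro prob_space_PiM P)
  have spP: "space P = space M \<times> {-1, 1}"
    using sets_eq_imp_space_eq[OF sP] by (simp add: space_pair_measure)
  have sp\<mu>: "space \<mu> = PiE {1..2*n} (\<lambda>_. space M \<times> {-1, 1})" by (simp add: \<mu>_def space_PiM spP)
  have Hb: "\<bar>h x\<bar> \<le> 1" if "h \<in> H" "x \<in> space M" for h x
    using H that by (auto simp: abs_le_iff)
  have c1: "0 < c1" "c1 \<le> 1/100" "c1 < u0" using u0 by (auto simp: c1_def)
  have C1: "1 \<le> C1" "C \<le> C1" by (auto simp: C1_def)
  have ln_nn: "0 \<le> ln (1 / c1)" "0 \<le> ln C1" using c1 C1 by auto
  have \<kappa>: "3 \<le> \<kappa>" "96 / V0 \<le> \<kappa>" using ln_nn V by (auto simp: \<kappa>_def)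
  have r1: "2 ^ p \<le> r p q" if "q \<le> p" for p q
  proof -
    have "(2::real) ^ p * 2 ^ q \<le> 2 ^ p * 2 ^ p" using that by (intro mult_left_mono power_increasing) auto
    also have "\<dots> = 2 ^ (2 * p)" by (simp add: mult_2 power_add)
    finally show ?thesis by (simp add: r_def field_simps)
  qed
  have r_alt: "(1 / 2 ^ p)\<^sup>2 / (144 * (1 / 2 ^ q)) = 1 / (144 * r p q)" for p q
    by (simp add: r_def power_divide power_mult mult.commute[of 2])
  have rpos: "0 < r p q" for p q by (simp add: r_def)
  have lnn: "0 < ln (16 * real n)" using n by simp
  have Npos: "0 < N p q" for p q
    unfolding N_def using rpos[of p q] lnn by (simp add: mult_pos_pos)
  have small: "3 * real (2 * n) * exp (- (real (N p q) * (1 / 2 ^ p)\<^sup>2 / (144 * (1 / 2 ^ q)))) < 1" for p q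
  proof -
    have "144 * r p q * ln (16 * real n) \<le> real (N p q)" unfolding N_def by (rule real_nat_ceiling_ge)
    then have "ln (16 * real n) \<le> real (N p q) * (1 / (144 * r p q))"
      using rpos[of p q] by (simp add: field_simps)
    then have "exp (- (real (N p q) * (1 / (144 * r p q)))) \<le> exp (- ln (16 * real n))" by simp
    also have "\<dots> = 1 / (16 * real n)" using n by (simp add: exp_minus inverse_eq_divide)
    finally have "3 * real (2 * n) * exp (- (real (N p q) * (1 / (144 * r p q)))) \<le> 3 * real (2 * n) * (1 / (16 * real n))"
      by (intro mult_left_mono) auto
    also have "\<dots> < 1" using n by simp
    finally show ?thesis by (simp only: times_divide_eq_right[symmetric] r_alt)
  qed
  have Gpos: "0 < G p" for p using n by (simp add: G_def)
  have rG: "1 / real (G p) = (1 / 2 ^ p) / (100 * real n)" for p by (simp add: G_def)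
  have B: "\<exists>B \<in> sets \<mu>. bad \<theta> \<subseteq> B \<and> measure \<mu> B \<le> exp (- t) / real n ^ 8" if \<theta>: "\<theta> \<in> \<Theta>" for \<theta>
  proof -
    obtain m p q where \<theta>': "\<theta> = (m, p, q)" "1 \<le> m" "m \<le> n" "q \<le> p"
      using \<theta> by (auto simp: \<Theta>_def)
    define \<delta> :: real where "\<delta> = 1 / 2 ^ p"
    define \<gamma> :: real where "\<gamma> = 1 / 2 ^ q"
    have \<delta>: "0 < \<delta>" "\<delta> \<le> \<gamma>" "\<delta> \<le> 1" using \<theta>'(4) by (auto simp: \<delta>_def \<gamma>_def intro!: divide_left_mono power_increasing)
    \<comment> \<open>The maximal distance on the \<open>2n\<close> points is \<open>u \<surd>(2n) \<le> u n\<close>, hence at most \<open>\<delta> / 100\<close>.\<close>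
    define u where "u = c1 * \<delta> / real n"
    have u: "0 < u" "u < u0"
    proof -
      show "0 < u" using c1 \<delta> n by (simp add: u_def)
      have "c1 * \<delta> / real n \<le> c1 * 1 / 1" using c1 \<delta> n by (intro frac_le mult_left_mono) auto
      then show "u < u0" using c1 by (simp add: u_def)
    qed
    have d: "u * sqrt (real (2 * n)) \<le> \<delta> / 100"
    proof -
      have "sqrt (real (2 * n)) \<le> real n"
        using n by (intro real_le_lsqrt) (auto simp: power2_eq_square)
      then have "u * sqrt (real (2 * n)) \<le> u * real n" using u by (intro mult_left_mono) auto
      also have "\<dots> = c1 * \<delta>" using n by (simp add: u_def)
      also have "\<dots> \<le> 1/100 * \<delta>" using c1 \<delta> by (intro mult_right_mono) auto
      finally show ?thesis by simp
    qed
    have count: "real (card {s \<in> Pow {1..n}. (\<lambda>i\<in>{1..2*n}. z (swap n s i)) \<in> bad \<theta>})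
        \<le> 2 ^ n * (exp (- t) / real n ^ 8)" if z: "z \<in> space (PiM {1..2*n} (\<lambda>_. P))" for z
    proof -
      have z': "z \<in> PiE {1..2*n} (\<lambda>_. space M \<times> {-1, 1})" using z sp\<mu> by (simp add: \<mu>_def)
      have zM: "fst (z i) \<in> space M" if "i \<in> {1..2*n}" for i
        using z' that by (auto simp: PiE_iff mem_Times_iff)
      have cov': "ereal_of_enat (uniform_covering_number M H u) \<le> ereal (C * u powr (- V))"
        using cov u by blast
      have ne: "{1..2*n} \<noteq> {}" using n by simp
      obtain F where F: "finite F" "F \<subseteq> H" "real (card F) \<le> C * u powr (- V)"
        "\<forall>h\<in>H. \<exists>g\<in>F. \<forall>i\<in>{1..2*n}. \<bar>g (fst (z i)) - h (fst (z i))\<bar> \<le> u * sqrt (real (2 * n))"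
        using sup_net_on_points[OF cov' finite_atLeastAtMost ne zM, of "\<lambda>i. i"] u by auto
      have "real (card {s \<in> Pow {1..n}. (\<lambda>i\<in>{1..2*n}. z (swap n s i)) \<in> bad \<theta>})
        \<le> 2 ^ n * (real (G p + 1) ^ m * real (card F) ^ (2 * m * N p q) * (3/2) powr (- (\<kappa> * (A m p q + t))))"
        unfolding \<theta>'(1) bad_def prod.case \<delta>_def[symmetric] \<gamma>_def[symmetric]
      proof (rule swap_count_bad_samples[where F = F and d = "u * sqrt (real (2 * n))"])
        show "\<exists>g\<in>F. \<forall>i\<in>{1..2*n}. \<bar>g (fst (z i)) - h (fst (z i))\<bar> \<le> u * sqrt (real (2 * n))" if "h \<in> H" for h
          using F(4) that by blast
        show "0 \<le> u * sqrt (real (2 * n))" using u by simp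
        have "\<delta> / (100 * real n) \<le> \<delta> / 100" using n \<delta> by (intro divide_left_mono) auto
        then show "u * sqrt (real (2 * n)) + 1 / real (G p) \<le> \<delta> / 50"
          unfolding rG \<delta>_def[symmetric] using d by linarith
        show "\<bar>h x\<bar> \<le> 1" if "h \<in> H" "x \<in> space M" for h x using Hb that .
      qed (fact z' F(1,2) Npos Gpos \<delta>(1,2))+
      also have "\<dots> \<le> 2 ^ n * (exp (- t) / real n ^ 8)"
      proof (rule mult_left_mono)
        have le: "C * u powr (- V) \<le> C1 * u powr (- V)" using C1 by (intro mult_right_mono) auto
        have eq: "u powr (- V) = (real n * 2 ^ p / c1) powr V"
          using u n c1 by (simp add: powr_minus_divide powr_divide powr_mult u_def \<delta>_def field_simps)
        have Fle: "real (card F) \<le> C1 * (real n * 2 ^ p / c1) powr V"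
          unfolding eq[symmetric] using F(3) le by (rule order_trans)
        show "real (G p + 1) ^ m * real (card F) ^ (2 * m * N p q) * (3/2) powr (- (\<kappa> * (A m p q + t)))
            \<le> exp (- t) / real n ^ 8"
          unfolding G_def
          by (rule configuration_count[OF n \<theta>'(2,4) V c1(1) _ C1(1) _ Fle t r_def refl A_def N_def refl])
             (use c1 in \<open>auto simp: \<kappa>_def\<close>)
      qed simp
      finally show ?thesis .
    qed
    have "bad \<theta> \<in> sets (completion (PiM {1..2*n} (\<lambda>_. P)))"
      unfolding \<theta>'(1) bad_def prod.case by (rule bad_samples_measurable[OF P sP sm])
    from symmetrization[OF P this count] show ?thesis unfolding \<mu>_def by simp
  qed
  then obtain B where B: "\<And>\<theta>. \<theta> \<in> \<Theta> \<Longrightarrow> B \<theta> \<in> sets \<mu>" "\<And>\<theta>. \<theta> \<in> \<Theta> \<Longrightarrow> bad \<theta> \<subseteq> B \<theta>"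
    "\<And>\<theta>. \<theta> \<in> \<Theta> \<Longrightarrow> measure \<mu> (B \<theta>) \<le> exp (- t) / real n ^ 8" by metis
  have sub\<Theta>: "\<Theta> \<subseteq> {1..n} \<times> {0..n} \<times> {0..n}" by (auto simp: \<Theta>_def)
  have fin\<Theta>: "finite \<Theta>" using sub\<Theta> by (rule finite_subset) simp
  define BB where "BB = (\<Union>\<theta>\<in>\<Theta>. B \<theta>)"
  have BB: "BB \<in> sets \<mu>" unfolding BB_def using B(1) fin\<Theta> by auto
  have "measure \<mu> BB \<le> (\<Sum>\<theta>\<in>\<Theta>. measure \<mu> (B \<theta>))"
    unfolding BB_def using B(1) fin\<Theta> by (intro \<mu>.finite_measure_subadditive_finite) auto
  also have "\<dots> \<le> (\<Sum>\<theta>\<in>\<Theta>. exp (- t) / real n ^ 8)" using B(3) by (intro sum_mono) auto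
  also have "\<dots> = real (card \<Theta>) * (exp (- t) / real n ^ 8)" by simp
  also have "\<dots> \<le> (real n ^ 8 / 2) * (exp (- t) / real n ^ 8)"
  proof (rule mult_right_mono)
    have "card \<Theta> \<le> card ({1..n} \<times> {0..n} \<times> {0..n})" using sub\<Theta> by (intro card_mono) auto
    also have "\<dots> = n * ((n + 1) * (n + 1))" by (simp add: card_cartesian_product)
    finally have "real (card \<Theta>) \<le> real (n * ((n + 1) * (n + 1)))" by (rule of_nat_mono)
    also have "\<dots> = real n * ((real n + 1) * (real n + 1))" by (simp add: algebra_simps)
    also have "\<dots> \<le> real n * (real n ^ 2 * real n ^ 2)"
    proof -
      have "2 * real n \<le> real n * real n" using n by (intro mult_right_mono) auto
      moreover have "2 \<le> real n" using n by simp
      ultimately have "real n + 1 \<le> real n ^ 2" unfolding power2_eq_square by linarith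
      then show ?thesis by (intro mult_left_mono mult_mono) auto
    qed
    also have "\<dots> = real n ^ 5" by (simp add: eval_nat_numeral)
    also have "\<dots> \<le> real n ^ 8 / 2"
    proof -
      have "2 * real n ^ 5 \<le> real n ^ 3 * real n ^ 5"
      proof (rule mult_right_mono)
        have "(2::real) ^ 3 \<le> real n ^ 3" using n by (intro power_mono) auto
        then show "2 \<le> real n ^ 3" by simp
      qed simp
      then show ?thesis by (simp flip: power_add)
    qed
    finally show "real (card \<Theta>) \<le> real n ^ 8 / 2" .
  qed simp
  also have "\<dots> = exp (- t) / 2" using n by simp
  finally have mBB: "measure \<mu> BB \<le> exp (- t) / 2" .
  define J where "J = {n+1..2*n}"
  obtain E where E: "E \<in> sets (PiM {1..n} (\<lambda>_. P))"
    "1 - 2 * measure \<mu> BB \<le> measure (PiM {1..n} (\<lambda>_. P)) E"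
    "\<And>\<omega>. \<omega> \<in> E \<Longrightarrow> measure (PiM J (\<lambda>_. P)) {y \<in> space (PiM J (\<lambda>_. P)). merge {1..n} J (\<omega>, y) \<in> BB} < 1/2"
    using ghost_sample_sections[OF P, of BB n] BB unfolding \<mu>_def J_def by blast
  have main: "real n * measure P {z \<in> space P. snd z * mix_mean l (fst z) \<le> 0}
        \<le> 4 * \<kappa> * (real (card {i \<in> {1..n}. snd (\<omega> i) * mix_mean l (fst (\<omega> i)) \<le> 1 / 2 ^ p})
            + real (card {i \<in> {1..n}. 1 / 2 ^ q \<le> decomp_var m c (fst (\<omega> i))})
            + A m p q + t)"
    if \<omega>: "\<omega> \<in> E" and l: "l \<in> discrete_dists H" and m: "1 \<le> m" and c: "c \<in> decompositions H m l" and pq: "q \<le> p"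
    for \<omega> l m c p q
  proof (rule ccontr)
    define D where "D = {z \<in> space P. snd z * mix_mean l (fst z) \<le> 0}"
    define S1 where "S1 = real (card {i \<in> {1..n}. snd (\<omega> i) * mix_mean l (fst (\<omega> i)) \<le> 1 / 2 ^ p})"
    define S2 where "S2 = real (card {i \<in> {1..n}. 1 / 2 ^ q \<le> decomp_var m c (fst (\<omega> i))})"
    assume "\<not> ?thesis"
    then have contra: "4 * \<kappa> * (S1 + S2 + A m p q + t) < real n * measure P D"
      by (simp add: S1_def S2_def D_def)
    have S0: "0 \<le> S1" "0 \<le> S2" by (auto simp: S1_def S2_def)
    have np: "2 \<le> real n * 2 ^ p" using mult_mono[of 2 "real n" 1 "2 ^ p"] n by simp
    have "1/2 \<le> ln (real n * 2 ^ p)"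
      using half_le_ln2 np ln_le_cancel_iff[of 2 "real n * 2 ^ p"] by linarith
    then have L: "1/4 \<le> (ln (real n * 2 ^ p))\<^sup>2"
      using power_mono[of "1/2" "ln (real n * 2 ^ p)" 2] by (simp add: power2_eq_square)
    have A: "V0 * (real m * 2 ^ p) / 4 \<le> A m p q"
    proof -
      have "V0 * real m * 2 ^ p * (1/4) \<le> V * real m * r p q * (ln (real n * 2 ^ p))\<^sup>2"
        using V L r1[OF pq] rpos[of p q] by (intro mult_mono mult_nonneg_nonneg) auto
      then show ?thesis by (simp add: A_def)
    qed
    have big: "96 * (real m * 2 ^ p) \<le> 4 * \<kappa> * A m p q"
    proof -
      have "4 * (96 / V0) * (V0 * (real m * 2 ^ p) / 4) \<le> 4 * \<kappa> * A m p q"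
        using A \<kappa> V by (intro mult_mono) auto
      then show ?thesis using V by simp
    qed
    have \<kappa>A: "4 * \<kappa> * A m p q \<le> 4 * \<kappa> * (S1 + S2 + A m p q + t)"
      using S0 t \<kappa> by (intro mult_left_mono) auto
    have mp1: "1 \<le> real m * 2 ^ p" using mult_mono[of 1 "real m" 1 "2 ^ p"] m by simp
    have mpn: "real m * 2 ^ p < real n"
    proof -
      have "real n * measure P D \<le> real n * 1" by (intro mult_left_mono) auto
      then show ?thesis using big \<kappa>A contra mp1 by linarith
    qed
    have "m \<le> n"
    proof -
      have "real m * 1 \<le> real m * 2 ^ p" by (intro mult_left_mono) auto
      then show ?thesis using mpn by simp
    qed
    moreover have "p \<le> n"
    proof -
      have "1 * 2 ^ p \<le> real m * 2 ^ p" using m by (intro mult_right_mono) auto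
      moreover have "real p < 2 ^ p" by (rule of_nat_less_two_power)
      ultimately have "real p < real n" using mpn by linarith
      then show ?thesis by simp
    qed
    ultimately have \<theta>: "(m, p, q) \<in> \<Theta>" using m pq by (simp add: \<Theta>_def)
    \<comment> \<open>A set that is not measurable has measure 0 by convention, for which the bound holds.\<close>
    have D: "D \<in> sets P"
    proof (rule ccontr)
      assume "D \<notin> sets P"
      then have "measure P D = 0" by (rule measure_notin_sets)
      then show False using contra big \<kappa>A mp1 by simp
    qed
    have cJ: "card J = n" by (simp add: J_def)
    have large: "4 \<le> real (card J) * measure P D" using contra big \<kappa>A mp1 cJ by simp
    define Y where "Y = {y \<in> space (PiM J (\<lambda>_. P)). real (card J) * measure P D / 4 \<le> real (card {i \<in> J. y i \<in> D})}"
    have Y: "Y \<in> sets (PiM J (\<lambda>_. P))" "1/2 < measure (PiM J (\<lambda>_. P)) Y"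
      unfolding Y_def by (rule count_lower_tail[OF P D _ large]; simp add: J_def)+
    have \<omega>s: "\<omega> \<in> space (PiM {1..n} (\<lambda>_. P))" using \<omega> E(1) sets.sets_into_space by blast
    have U: "{1..n} \<union> J = {1..2*n}" by (auto simp: J_def)
    have sub: "Y \<subseteq> {y \<in> space (PiM J (\<lambda>_. P)). merge {1..n} J (\<omega>, y) \<in> BB}"
    proof
      fix y assume y: "y \<in> Y"
      define z where "z = merge {1..n} J (\<omega>, y)"
      have ys: "y \<in> space (PiM J (\<lambda>_. P))" using y by (simp add: Y_def)
      have z1: "z i = \<omega> i" if "i \<in> {1..n}" for i using that by (simp add: z_def merge_def)
      have z2: "z i = y i" if "i \<in> J" for i using that by (auto simp: z_def merge_def J_def)
      have z: "z \<in> PiE {1..2*n} (\<lambda>_. space M \<times> {-1, 1})"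
      proof -
        have "\<omega> \<in> PiE {1..n} (\<lambda>_. space M \<times> {-1, 1})" "y \<in> PiE J (\<lambda>_. space M \<times> {-1, 1})"
          using \<omega>s ys by (auto simp: space_PiM spP)
        then have "z \<in> PiE ({1..n} \<union> J) (\<lambda>_. space M \<times> {-1, 1})"
          unfolding z_def by (subst PiE_cancel_merge) (auto simp: J_def)
        then show ?thesis by (simp only: U)
      qed
      have "z \<in> bad (m, p, q)"
        unfolding bad_def prod.case
      proof (rule unbalanced_margins_imp_bad_samples)
        show "\<bar>h x\<bar> \<le> 1" if "h \<in> H" "x \<in> space M" for h x using Hb that .
        have "(real m + 1) / real (G p) \<le> (real n + real n) / real (G p)"
          using \<open>m \<le> n\<close> n by (intro divide_right_mono) auto
        also have "\<dots> = 1 / 2 ^ p / 50" using n by (simp add: G_def field_simps)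
        finally show "(real m + 1) / real (G p) \<le> 1 / 2 ^ p / 50" .
        show "(0::real) < 1 / 2 ^ p" by simp
        show "(1::real) / 2 ^ p \<le> 1 / 2 ^ q" using pq by (intro divide_left_mono power_increasing) auto
        have combine: "2 * X + T2 \<le> Z" if "X \<le> S" "Q / 4 \<le> Z" "2 * S \<le> T1" "4 * T1 + 4 * T2 < Q"
          for X Z S Q T1 T2 :: real using that by linarith
        define T1 where "T1 = \<kappa> * (S1 + S2)"
        define T2 where "T2 = \<kappa> * (A m p q + t)"
        have "{i \<in> {1..n}. snd (z i) * mix_mean l (fst (z i)) \<le> 1 / 2 ^ p \<or> 1 / 2 ^ q \<le> decomp_var m c (fst (z i))}
           = {i \<in> {1..n}. snd (\<omega> i) * mix_mean l (fst (\<omega> i)) \<le> 1 / 2 ^ p} \<union>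
             {i \<in> {1..n}. 1 / 2 ^ q \<le> decomp_var m c (fst (\<omega> i))}" using z1 by auto
        then have "real (card {i \<in> {1..n}. snd (z i) * mix_mean l (fst (z i)) \<le> 1 / 2 ^ p \<or> 1 / 2 ^ q \<le> decomp_var m c (fst (z i))})
          \<le> S1 + S2"
          unfolding S1_def S2_def using card_Un_le by (simp only: of_nat_add[symmetric] of_nat_le_iff)
        moreover have "real n * measure P D / 4 \<le> real (card {i \<in> {n+1..2*n}. snd (z i) * mix_mean l (fst (z i)) \<le> 0})"
        proof -
          have "{i \<in> J. y i \<in> D} \<subseteq> {i \<in> {n+1..2*n}. snd (z i) * mix_mean l (fst (z i)) \<le> 0}"
            using z2 by (auto simp: D_def J_def)
          then have "card {i \<in> J. y i \<in> D} \<le> card {i \<in> {n+1..2*n}. snd (z i) * mix_mean l (fst (z i)) \<le> 0}"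
            by (intro card_mono) auto
          then show ?thesis using y cJ by (simp add: Y_def)
        qed
        moreover have "2 * (S1 + S2) \<le> T1" unfolding T1_def using \<kappa> S0 by (intro mult_right_mono) auto
        moreover have "4 * T1 + 4 * T2 < real n * measure P D"
          using contra by (simp add: T1_def T2_def algebra_simps)
        ultimately show "2 * real (card {i \<in> {1..n}. snd (z i) * mix_mean l (fst (z i)) \<le> 1 / 2 ^ p \<or> 1 / 2 ^ q \<le> decomp_var m c (fst (z i))})
            + \<kappa> * (A m p q + t) \<le> real (card {i \<in> {n+1..2*n}. snd (z i) * mix_mean l (fst (z i)) \<le> 0})"
          unfolding T2_def[symmetric] by (rule combine)
      qed (fact z l c Npos Gpos small)+
      then have "z \<in> BB" using B(2)[OF \<theta>] \<theta> by (auto simp: BB_def)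
      then show "y \<in> {y \<in> space (PiM J (\<lambda>_. P)). merge {1..n} J (\<omega>, y) \<in> BB}"
        using ys by (simp add: z_def)
    qed
    interpret \<mu>2: prob_space "PiM J (\<lambda>_. P)" by (intro prob_space_PiM P)
    have "{y \<in> space (PiM J (\<lambda>_. P)). merge {1..n} J (\<omega>, y) \<in> BB} \<in> sets (PiM J (\<lambda>_. P))"
    proof -
      have "(\<lambda>y. merge {1..n} J (\<omega>, y)) \<in> measurable (PiM J (\<lambda>_. P)) (PiM ({1..n} \<union> J) (\<lambda>_. P))"
        using \<omega>s by measurable
      then have "(\<lambda>y. merge {1..n} J (\<omega>, y)) \<in> measurable (PiM J (\<lambda>_. P)) \<mu>"
        by (simp only: U \<mu>_def)
      from measurable_sets[OF this BB] show ?thesis by (simp add: vimage_def Int_def conj_commute)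
    qed
    then have "measure (PiM J (\<lambda>_. P)) Y \<le> measure (PiM J (\<lambda>_. P)) {y \<in> space (PiM J (\<lambda>_. P)). merge {1..n} J (\<omega>, y) \<in> BB}"
      by (rule \<mu>2.finite_measure_mono[OF sub])
    then show False using Y(2) E(3)[OF \<omega>] by linarith
  qed
  show ?thesis
    using E(1,2) mBB main unfolding A_def r_def by (intro bexI[of _ E] conjI) auto
qed

lemma dyadic_bracket:
  fixes x :: real
  assumes "0 < x" "x \<le> 1"
  shows "\<exists>k. 1 / 2 ^ Suc k < x \<and> x \<le> 1 / 2 ^ k"
proof -
  have "\<exists>k. (1/2) ^ k < x" using assms by (intro real_arch_pow_inv) auto
  then have ex: "\<exists>k. 1 / 2 ^ k < x" by (simp add: power_one_over)
  define k where "k = (LEAST k. 1 / 2 ^ k < x)"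
  have k: "1 / 2 ^ k < x" unfolding k_def using ex by (rule LeastI_ex)
  have "k \<noteq> 0" using k assms by (cases k) auto
  then obtain j where j: "k = Suc j" by (cases k) auto
  have "\<not> 1 / 2 ^ j < x" using not_less_Least[of j "\<lambda>k. 1 / 2 ^ k < x"] j by (simp add: k_def)
  then show ?thesis using k j by (intro exI[of _ j]) auto
qed

theorem theorem4:
  fixes C u0 V0 :: real
  assumes "0 < u0" and "0 < V0"
  shows "\<exists>K>0. \<forall>(M :: 'x measure) (H :: ('x \<Rightarrow> real) set) (V :: real)
           (P :: ('x \<times> real) measure) (n :: nat) (t :: real).
     V0 \<le> V \<longrightarrow>
     (\<forall>h\<in>H. h \<in> borel_measurable M \<and> (\<forall>x\<in>space M. h x \<in> {-1..1})) \<longrightarrow>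
     (\<forall>u. 0 < u \<and> u < u0 \<longrightarrow>
        ereal_of_enat (uniform_covering_number M H u) \<le> ereal (C * u powr (- V))) \<longrightarrow>
     prob_space P \<longrightarrow>
     sets P = sets (M \<Otimes>\<^sub>M count_space {-1, 1}) \<longrightarrow>
     sample_measurable (distr P M fst) H \<longrightarrow>
     2 \<le> n \<longrightarrow>
     0 < t \<longrightarrow>
     (\<exists>E \<in> sets (PiM {1..n} (\<lambda>_. P)).
        measure (PiM {1..n} (\<lambda>_. P)) E \<ge> 1 - exp (- t) \<and>
        (\<forall>\<omega>\<in>E. \<forall>l \<in> discrete_dists H.
           measure P {z \<in> space P. snd z * mix_mean l (fst z) \<le> 0}
           \<le> K * (INF m \<in> {1..}. INF c \<in> decompositions H m l.
                    INF (\<delta>, \<gamma>) \<in> {(\<delta>, \<gamma>). 0 < \<delta> \<and> \<delta> \<le> \<gamma> \<and> \<gamma> \<le> 1}.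
                      empirical n \<omega> (\<lambda>z. snd z * mix_mean l (fst z) \<le> \<delta>)
                    + empirical n \<omega> (\<lambda>z. decomp_var m c (fst z) \<ge> \<gamma>)
                    + V * real m * \<gamma> / (real n * \<delta>\<^sup>2) * (ln (real n / \<delta>))\<^sup>2
                    + t / real n)))"
proof -
  \<comment> \<open>The net radius is \<open>c1 \<delta> / n\<close>; it must be below \<open>u0\<close>, and \<open>n\<close> times the radius at most \<open>\<delta> / 100\<close>. The
  factor \<open>\<kappa>\<close> is the one that \<open>configuration_count\<close> asks for. The final constant is \<open>4 \<kappa>\<close>, with
  \<open>4\<close> for passing from errors on the ghost sample to their probability, times \<open>32\<close> for
  rounding \<open>\<delta>\<close> and \<open>\<gamma>\<close>.\<close>
  define c1 where "c1 = min (u0 / 2) (1 / 100)"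
  define C1 where "C1 = max C 1"
  define \<kappa> where "\<kappa> = 3 * (1 + 32 / V0 + 1444 * (1 + 2 * ln (1 / c1) + 2 * ln C1 / V0))"
  have "0 \<le> ln (1 / c1)" "0 \<le> ln C1" using assms by (auto simp: c1_def C1_def)
  then have \<kappa>: "0 < \<kappa>" using assms by (simp add: \<kappa>_def add_pos_nonneg)
  show ?thesis
  proof (intro exI[of _ "128 * \<kappa>"] conjI allI impI)
    show "0 < 128 * \<kappa>" using \<kappa> by simp
  next
    fix M :: "'x measure" and H :: "('x \<Rightarrow> real) set" and V :: real
      and P :: "('x \<times> real) measure" and n :: nat and t :: real
    assume V: "V0 \<le> V" and H: "\<forall>h\<in>H. h \<in> borel_measurable M \<and> (\<forall>x\<in>space M. h x \<in> {-1..1})"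
      and cov: "\<forall>u. 0 < u \<and> u < u0 \<longrightarrow>
        ereal_of_enat (uniform_covering_number M H u) \<le> ereal (C * u powr (- V))"
      and P: "prob_space P" and sP: "sets P = sets (M \<Otimes>\<^sub>M count_space {-1, 1})"
      and sm: "sample_measurable (distr P M fst) H" and n: "2 \<le> n" and t: "0 < t"
    obtain E where E: "E \<in> sets (PiM {1..n} (\<lambda>_. P))" "1 - exp (- t) \<le> measure (PiM {1..n} (\<lambda>_. P)) E"
      and main: "\<And>\<omega> l m c p q. \<omega> \<in> E \<Longrightarrow> l \<in> discrete_dists H \<Longrightarrow> 1 \<le> m \<Longrightarrow> c \<in> decompositions H m l \<Longrightarrow> q \<le> p \<Longrightarrow>
        real n * measure P {z \<in> space P. snd z * mix_mean l (fst z) \<le> 0}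
        \<le> 4 * \<kappa> * (real (card {i \<in> {1..n}. snd (\<omega> i) * mix_mean l (fst (\<omega> i)) \<le> 1 / 2 ^ p})
            + real (card {i \<in> {1..n}. 1 / 2 ^ q \<le> decomp_var m c (fst (\<omega> i))})
            + V * real m * (2 ^ (2 * p) / 2 ^ q) * (ln (real n * 2 ^ p))\<^sup>2 + t)"
      using dyadic_margin_bound[OF assms V H cov P sP sm n t c1_def C1_def \<kappa>_def] by blast
    have "measure P {z \<in> space P. snd z * mix_mean l (fst z) \<le> 0}
       \<le> 128 * \<kappa> * (INF m \<in> {1..}. INF c \<in> decompositions H m l.
                    INF (\<delta>, \<gamma>) \<in> {(\<delta>, \<gamma>). 0 < \<delta> \<and> \<delta> \<le> \<gamma> \<and> \<gamma> \<le> 1}.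
                      empirical n \<omega> (\<lambda>z. snd z * mix_mean l (fst z) \<le> \<delta>)
                    + empirical n \<omega> (\<lambda>z. decomp_var m c (fst z) \<ge> \<gamma>)
                    + V * real m * \<gamma> / (real n * \<delta>\<^sup>2) * (ln (real n / \<delta>))\<^sup>2
                    + t / real n)"
      if \<omega>: "\<omega> \<in> E" and l: "l \<in> discrete_dists H" for \<omega> l
    proof -
      define \<pi> where "\<pi> = measure P {z \<in> space P. snd z * mix_mean l (fst z) \<le> 0}"
      have bound: "\<pi> / (128 * \<kappa>) \<le> empirical n \<omega> (\<lambda>z. snd z * mix_mean l (fst z) \<le> \<delta>)
                    + empirical n \<omega> (\<lambda>z. decomp_var m c (fst z) \<ge> \<gamma>)
                    + V * real m * \<gamma> / (real n * \<delta>\<^sup>2) * (ln (real n / \<delta>))\<^sup>2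
                    + t / real n"
        if m: "1 \<le> m" and c: "c \<in> decompositions H m l" and \<delta>: "0 < \<delta>" "\<delta> \<le> \<gamma>" "\<gamma> \<le> 1" for m c \<delta> \<gamma>
      proof -
        \<comment> \<open>The scale \<open>2\<^sup>-\<^sup>p\<close> is taken below \<open>\<delta>\<close> and \<open>2\<^sup>-\<^sup>q\<close> above \<open>\<gamma>\<close>, so both empirical terms can only shrink. The
  complexity term grows by at most \<open>4 \<cdot> 2 \<cdot> 4 = 32\<close>.\<close>
        obtain p' where p': "1 / 2 ^ Suc p' < \<delta>" "\<delta> \<le> 1 / 2 ^ p'" using dyadic_bracket[of \<delta>] \<delta> by auto
        obtain q where q: "1 / 2 ^ Suc q < \<gamma>" "\<gamma> \<le> 1 / 2 ^ q" using dyadic_bracket[of \<gamma>] \<delta> by auto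
        define p where "p = Suc p'"
        have p: "1 / 2 ^ p < \<delta>" "\<delta> \<le> 2 / 2 ^ p" using p' by (auto simp: p_def)
        have "q \<le> p"
        proof (rule ccontr)
          assume "\<not> q \<le> p"
          then have "1 / 2 ^ q \<le> (1 / 2 ^ p :: real)" by (intro divide_left_mono power_increasing) auto
          then show False using p(1) q(2) \<delta>(2) by linarith
        qed
        define S1 where "S1 = real (card {i \<in> {1..n}. snd (\<omega> i) * mix_mean l (fst (\<omega> i)) \<le> \<delta>})"
        define S2 where "S2 = real (card {i \<in> {1..n}. decomp_var m c (fst (\<omega> i)) \<ge> \<gamma>})"
        define A where "A = V * real m * (\<gamma> / \<delta>\<^sup>2) * (ln (real n / \<delta>))\<^sup>2"
        have s1: "real (card {i \<in> {1..n}. snd (\<omega> i) * mix_mean l (fst (\<omega> i)) \<le> 1 / 2 ^ p}) \<le> S1"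
          unfolding S1_def using p(1) by (intro of_nat_mono card_mono) auto
        have s2: "real (card {i \<in> {1..n}. 1 / 2 ^ q \<le> decomp_var m c (fst (\<omega> i))}) \<le> S2"
          unfolding S2_def using q(2) by (intro of_nat_mono card_mono) auto
        have a: "V * real m * (2 ^ (2 * p) / 2 ^ q) * (ln (real n * 2 ^ p))\<^sup>2 \<le> 32 * A"
        proof -
          have "(2::real) ^ p \<le> 2 / \<delta>" using p(2) \<delta>(1) by (simp add: field_simps)
          then have "((2::real) ^ p)\<^sup>2 \<le> (2 / \<delta>)\<^sup>2" by (intro power_mono) auto
          moreover have "1 / 2 ^ q \<le> 2 * \<gamma>" using q(1) by simp
          ultimately have "((2::real) ^ p)\<^sup>2 * (1 / 2 ^ q) \<le> (2 / \<delta>)\<^sup>2 * (2 * \<gamma>)"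
            by (intro mult_mono) auto
          then have r: "2 ^ (2 * p) / 2 ^ q \<le> 8 * (\<gamma> / \<delta>\<^sup>2)"
            by (simp add: power_mult[symmetric] mult.commute[of p] power_divide)
          have nd: "2 \<le> real n / \<delta>"
          proof -
            have "2 / 1 \<le> real n / \<delta>" using n \<delta> by (intro frac_le) auto
            then show ?thesis by simp
          qed
          have "real n * 2 ^ p \<le> 2 * (real n / \<delta>)"
            using mult_left_mono[OF \<open>(2::real) ^ p \<le> 2 / \<delta>\<close>, of "real n"] by (simp add: mult.commute)
          then have "ln (real n * 2 ^ p) \<le> ln (2 * (real n / \<delta>))"
            using n nd by (subst ln_le_cancel_iff) auto
          also have "\<dots> = ln 2 + ln (real n / \<delta>)" using nd by (intro ln_mult_pos) auto
          also have "\<dots> \<le> 2 * ln (real n / \<delta>)" using nd by simp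
          finally have "ln (real n * 2 ^ p) \<le> 2 * ln (real n / \<delta>)" .
          moreover have "1 \<le> real n * 2 ^ p" using mult_mono[of 1 "real n" 1 "2 ^ p"] n by simp
          then have "0 \<le> ln (real n * 2 ^ p)" by (rule ln_ge_zero)
          ultimately have "(ln (real n * 2 ^ p))\<^sup>2 \<le> (2 * ln (real n / \<delta>))\<^sup>2" by (intro power_mono)
          then have "V * real m * (2 ^ (2 * p) / 2 ^ q) * (ln (real n * 2 ^ p))\<^sup>2
             \<le> V * real m * (8 * (\<gamma> / \<delta>\<^sup>2)) * (2 * ln (real n / \<delta>))\<^sup>2"
            using r V assms \<delta> by (intro mult_mono) auto
          then show ?thesis by (simp add: A_def power_mult_distrib)
        qed
        have "real n * \<pi> \<le> 4 * \<kappa> * (S1 + S2 + 32 * A + t)"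
          unfolding \<pi>_def using \<kappa> s1 s2 a
          by (intro order_trans[OF main[OF \<omega> l m c \<open>q \<le> p\<close>]] mult_left_mono) auto
        also have "\<dots> \<le> 4 * \<kappa> * (32 * (S1 + S2 + A + t))"
          using \<kappa> t by (intro mult_left_mono) (auto simp: S1_def S2_def)
        also have "\<dots> = (128 * \<kappa>) * (S1 + S2 + A + t)" by (simp add: algebra_simps)
        finally have "real n * \<pi> \<le> (128 * \<kappa>) * (S1 + S2 + A + t)" .
        then have "\<pi> / (128 * \<kappa>) \<le> (S1 + S2 + A + t) / real n"
          using \<kappa> n by (simp add: field_simps)
        also have "\<dots> = S1 / real n + S2 / real n + V * real m * \<gamma> / (real n * \<delta>\<^sup>2) * (ln (real n / \<delta>))\<^sup>2 + t / real n"
          by (simp add: A_def add_divide_distrib mult_ac)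
        finally show ?thesis by (simp add: empirical_def S1_def S2_def)
      qed
      have ne: "decompositions H m l \<noteq> {}" if "1 \<le> m" for m
      proof -
        have "(\<Sum>k=1..m. of_bool (k = 1) * pmf l h) = pmf l h" for h
        proof -
          have "(\<Sum>k=1..m. of_bool (k = 1) * pmf l h) = (\<Sum>k=1..m. if k = 1 then pmf l h else 0)"
            by (intro sum.cong) auto
          then show ?thesis using that by simp
        qed
        then have "(\<lambda>k. of_bool (k = 1), \<lambda>_. l) \<in> decompositions H m l"
          using l by (simp add: decompositions_def)
        then show ?thesis by blast
      qed
      have "\<pi> / (128 * \<kappa>) \<le> (INF m \<in> {1..}. INF c \<in> decompositions H m l.
                    INF (\<delta>, \<gamma>) \<in> {(\<delta>, \<gamma>). 0 < \<delta> \<and> \<delta> \<le> \<gamma> \<and> \<gamma> \<le> 1}.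
                      empirical n \<omega> (\<lambda>z. snd z * mix_mean l (fst z) \<le> \<delta>)
                    + empirical n \<omega> (\<lambda>z. decomp_var m c (fst z) \<ge> \<gamma>)
                    + V * real m * \<gamma> / (real n * \<delta>\<^sup>2) * (ln (real n / \<delta>))\<^sup>2
                    + t / real n)"
      proof (intro cINF_greatest)
        show "{1::nat..} \<noteq> {}" by simp
        show "decompositions H m l \<noteq> {}" if "m \<in> {1..}" for m using ne that by simp
        have "(1, 1) \<in> {(\<delta>, \<gamma>). 0 < \<delta> \<and> \<delta> \<le> \<gamma> \<and> \<gamma> \<le> (1::real)}" by simp
        then show "{(\<delta>, \<gamma>). 0 < \<delta> \<and> \<delta> \<le> \<gamma> \<and> \<gamma> \<le> (1::real)} \<noteq> {}" by blast
      qed (use bound in auto)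
      then show ?thesis using \<kappa> unfolding \<pi>_def[symmetric] by (simp add: field_simps)
    qed
    then show "\<exists>E \<in> sets (PiM {1..n} (\<lambda>_. P)).
        measure (PiM {1..n} (\<lambda>_. P)) E \<ge> 1 - exp (- t) \<and>
        (\<forall>\<omega>\<in>E. \<forall>l \<in> discrete_dists H.
           measure P {z \<in> space P. snd z * mix_mean l (fst z) \<le> 0}
           \<le> 128 * \<kappa> * (INF m \<in> {1..}. INF c \<in> decompositions H m l.
                    INF (\<delta>, \<gamma>) \<in> {(\<delta>, \<gamma>). 0 < \<delta> \<and> \<delta> \<le> \<gamma> \<and> \<gamma> \<le> 1}.
                      empirical n \<omega> (\<lambda>z. snd z * mix_mean l (fst z) \<le> \<delta>)
                    + empirical n \<omega> (\<lambda>z. decomp_var m c (fst z) \<ge> \<gamma>)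
                    + V * real m * \<gamma> / (real n * \<delta>\<^sup>2) * (ln (real n / \<delta>))\<^sup>2
                    + t / real n))"
      using E by (intro bexI[of _ E] conjI ballI) auto
  qed
qed

end
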